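(* Let $d\in\mathbb{N}$ with $d>2$, let $k\in\mathbb{N}$ with $k>1$, and let $\epsilon>0$. Let $M_k(n)$ be the $k$-th highest degree at time $n$ in the max-choice preferential attachment tree model with parameter $d$. Then $$\lim_{n\to\infty}\mathbb{P}\left(n^{c^{d-1}d/2-\epsilon}<M_k(n)<n^{c^{d-1}d/2+\epsilon}\right)=1,$$ where $c=1-x^{\ast}/2$ and $x^{\ast}$ is the unique positive solution of the equation $1-(1-x/2)^{d}=x$ in the interval $0\le x\le 1$.
   Context: Max-choice preferential attachment tree model with parameter $d$: let $V=\{v_i : i\in\mathbb{N}\}$ be a countable non-random set of vertices. Random trees $P_n$, $n\in\mathbb{N}$, are defined inductively. $P_1$ is the one-edge tree on the vertices $v_1,v_2$. Given $P_n$ (whose vertex set is $V(P_n)=\{v_1,\dots,v_{n+1}\}$), add the vertex $v_{n+2}$ and one edge as follows. Let $\mathcal{F}_n=\sigma\{\mathcal{E}_1,\dots,\mathcal{E}_n\}$, where $\mathcal{E}_m$ is the edge set of $P_m$. Conditionally on $\mathcal{F}_n$, let $X_n^1,\dots,X_n^d$ be i.i.d. vertices of $V(P_n)$ with $\mathbb{P}[X_n^1=v_i\mid\mathcal{F}_n]=\frac{\deg v_i(n)}{2n}$, where $\deg v_i(n)$ is the degree of $v_i$ in $P_n$ (so $\sum_i\deg v_i(n)=2n$). Let $Y_n$ be whichever of $X_n^1,\dots,X_n^d$ has the largest degree in $P_n$, ties being broken by an independent fair random choice among the tied vertices. $P_{n+1}$ is obtained from $P_n$ by adding $v_{n+2}$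 and the edge $\{v_{n+2},Y_n\}$. $M_1(n)\ge M_2(n)\ge\dots\ge M_k(n)$ denote the $k$ highest vertex degrees in $P_n$, listed with multiplicity; if $P_n$ has fewer than $k$ vertices, put $M_k(n)=1$. *)

theory Defs
  imports "HOL-Probability.Probability"
begin

text \<open>A graph without isolated vertices is given by its edge set; the vertex \<open>v\<^sub>i\<close> is the number
  \<open>i\<close> (indices start at 1).\<close>

definition degree_of :: "nat set set \<Rightarrow> nat \<Rightarrow> nat" where
  "degree_of E v = card {e \<in> E. v \<in> e}"

definition degrees_desc :: "nat set set \<Rightarrow> nat list" where
  "degrees_desc E = rev (sorted_list_of_multiset (image_mset (degree_of E) (mset_set (\<Union>E))))"

definition kth_degree :: "nat \<Rightarrow> nat set set \<Rightarrow> nat" where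
  "kth_degree k E = (if k \<le> card (\<Union>E) then degrees_desc E ! (k - 1) else 1)"

text \<open>The edge set of \<open>P\<^sub>n\<close> when \<open>y m\<close> is the vertex to which \<open>v\<^bsub>m+2\<^esub>\<close> is attached. The value at
  time 0 is a dummy.\<close>

fun pa_edges :: "(nat \<Rightarrow> nat) \<Rightarrow> nat \<Rightarrow> nat set set" where
  "pa_edges y 0 = {}"
| "pa_edges y (Suc 0) = {{1, 2}}"
| "pa_edges y (Suc (Suc n)) = insert {n + 3, y (Suc n)} (pa_edges y (Suc n))"

definition max_degree_among :: "nat set set \<Rightarrow> nat set \<Rightarrow> nat set" where
  "max_degree_among E S = {v \<in> S. \<forall>u\<in>S. degree_of E u \<le> degree_of E v}"

definition rv_events :: "'w measure \<Rightarrow> ('w \<Rightarrow> 'a) \<Rightarrow> 'w set set" where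
  "rv_events M Z = {Z -` A \<inter> space M | A. True}"

definition cond_prob_given :: "'w measure \<Rightarrow> 'w measure \<Rightarrow> ('w \<Rightarrow> bool) \<Rightarrow> 'w \<Rightarrow> real" where
  "cond_prob_given M G Q = real_cond_exp M G (indicator {w \<in> space M. Q w})"

text \<open>In the following locale \<open>X n j\<close> and \<open>Y n\<close> are \<open>X\<^sub>n\<^sup>j\<close> and \<open>Y\<^sub>n\<close>; the tree process is a function
  of \<open>Y\<close>.\<close>

definition pa_tree :: "(nat \<Rightarrow> 'w \<Rightarrow> nat) \<Rightarrow> nat \<Rightarrow> 'w \<Rightarrow> nat set set" where
  "pa_tree Y n w = pa_edges (\<lambda>m. Y m w) n"

text \<open>\<open>\<F>\<^sub>n\<close>, and \<open>\<F>\<^sub>n\<close> enlarged by the candidates \<open>X\<^sub>n\<^sup>1, \<dots>, X\<^sub>n\<^sup>d\<close>.\<close>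

definition edge_sigma :: "'w measure \<Rightarrow> (nat \<Rightarrow> 'w \<Rightarrow> nat) \<Rightarrow> nat \<Rightarrow> 'w measure" where
  "edge_sigma M Y n = sigma (space M) (\<Union>m\<in>{1..n}. rv_events M (pa_tree Y m))"

definition choice_sigma :: "'w measure \<Rightarrow> nat \<Rightarrow> (nat \<Rightarrow> nat \<Rightarrow> 'w \<Rightarrow> nat) \<Rightarrow> (nat \<Rightarrow> 'w \<Rightarrow> nat) \<Rightarrow> nat \<Rightarrow> 'w measure" where
  "choice_sigma M d X Y n =
    sigma (space M) ((\<Union>m\<in>{1..n}. rv_events M (pa_tree Y m)) \<union> (\<Union>j\<in>{1..d}. rv_events M (X n j)))"

text \<open>Assumption \<open>Y_law\<close> says that, given \<open>\<F>\<^sub>n\<close> and the candidates, \<open>Y\<^sub>n\<close> is uniform on the set of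
  (distinct) candidates of largest degree; this is the independent fair tie-breaking.\<close>

locale max_choice_pa = prob_space M
  for M :: "'w measure" +
  fixes d :: nat and X :: "nat \<Rightarrow> nat \<Rightarrow> 'w \<Rightarrow> nat" and Y :: "nat \<Rightarrow> 'w \<Rightarrow> nat"
  assumes X_measurable: "\<And>n j. n \<ge> 1 \<Longrightarrow> j \<in> {1..d} \<Longrightarrow> X n j \<in> M \<rightarrow>\<^sub>M count_space UNIV"
    and Y_measurable: "\<And>n. n \<ge> 1 \<Longrightarrow> Y n \<in> M \<rightarrow>\<^sub>M count_space UNIV"
    and X_law: "\<And>n j i. n \<ge> 1 \<Longrightarrow> j \<in> {1..d} \<Longrightarrow>
      AE w in M. cond_prob_given M (edge_sigma M Y n) (\<lambda>w. X n j w = i) w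
        = real (degree_of (pa_tree Y n w) i) / (2 * real n)"
    and X_cond_indep: "\<And>n x. n \<ge> 1 \<Longrightarrow>
      AE w in M. cond_prob_given M (edge_sigma M Y n) (\<lambda>w. \<forall>j\<in>{1..d}. X n j w = x j) w
        = (\<Prod>j\<in>{1..d}. cond_prob_given M (edge_sigma M Y n) (\<lambda>w. X n j w = x j) w)"
    and Y_law: "\<And>n v. n \<ge> 1 \<Longrightarrow>
      AE w in M. cond_prob_given M (choice_sigma M d X Y n) (\<lambda>w. Y n w = v) w
        = (let T = max_degree_among (pa_tree Y n w) ((\<lambda>j. X n j w) ` {1..d})
           in if v \<in> T then 1 / real (card T) else 0)"

definition x_star :: "nat \<Rightarrow> real" where
  "x_star d = (THE x. 0 < x \<and> x \<le> 1 \<and> 1 - (1 - x / 2) ^ d = x)"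

definition c_const :: "nat \<Rightarrow> real" where
  "c_const d = 1 - x_star d / 2"

lemma x_star_unique:
  assumes "d > 2"
  shows "\<exists>!x::real. 0 < x \<and> x \<le> 1 \<and> 1 - (1 - x / 2) ^ d = x"
proof -
  define g :: "real \<Rightarrow> real" where "g y = (\<Sum>i<d. y ^ i)" for y
  have geo: "1 - (1 - x / 2) ^ d = x / 2 * g (1 - x / 2)" for x :: real
    using one_diff_power_eq[of "1 - x / 2" d] by (simp add: g_def)
  have iff: "1 - (1 - x / 2) ^ d = x \<longleftrightarrow> g (1 - x / 2) = 2" if "x > 0" for x :: real
  proof -
    have "x / 2 * G = x \<longleftrightarrow> G = 2" for G :: real using that by (auto simp: field_simps)
    then show ?thesis by (simp only: geo)
  qed
  have strict: "g y < g z" if "0 \<le> y" "y < z" for y z :: real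
  proof -
    have "(\<Sum>i<d. y ^ i) < (\<Sum>i<d. z ^ i)"
    proof (rule sum_strict_mono_ex1)
      show "\<forall>i\<in>{..<d}. y ^ i \<le> z ^ i" using that by (auto intro: power_mono)
      show "\<exists>i\<in>{..<d}. y ^ i < z ^ i"
        using that assms by (intro bexI[of _ 1]) auto
    qed simp
    then show ?thesis by (simp add: g_def)
  qed
  have "g (1/2) \<le> 2"
  proof -
    have "g (1/2) = 2 * (1 - (1/2) ^ d)"
      using one_diff_power_eq[of "1/2 :: real" d] by (simp add: g_def)
    then show ?thesis by simp
  qed
  moreover have g1: "g 1 > 2" using assms by (simp add: g_def)
  moreover have "continuous_on {1/2..1} g"
    unfolding g_def by (intro continuous_intros)
  ultimately obtain y where y: "1/2 \<le> y" "y \<le> 1" "g y = 2"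
    using IVT'[of g "1/2" 2 1] by auto
  have y1: "y < 1" using y g1 by (cases "y = 1") auto
  show ?thesis
  proof (rule ex1I[of _ "2 * (1 - y)"])
    show "0 < 2 * (1 - y) \<and> 2 * (1 - y) \<le> 1 \<and> 1 - (1 - 2 * (1 - y) / 2) ^ d = 2 * (1 - y)"
    proof -
      have "1 - 2 * (1 - y) / 2 = y" by (simp add: field_simps)
      then show ?thesis using y y1 iff[of "2 * (1 - y)"] by (simp only:) simp
    qed
  next
    fix x :: real
    assume x: "0 < x \<and> x \<le> 1 \<and> 1 - (1 - x / 2) ^ d = x"
    then have "g (1 - x / 2) = g y" using iff[of x] y by auto
    then have "1 - x / 2 = y"
      using strict[of "1 - x / 2" y] strict[of y "1 - x / 2"] x y by (cases rule: linorder_cases) auto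
    then show "x = 2 * (1 - y)" by auto
  qed
qed

end

theory Submission
  imports Defs "HOL-Real_Asymp.Real_Asymp"
begin

text \<open>Let \<open>g x = 1 - (1 - x/2)\<^sup>d\<close>, so that a set of top vertices of total weight \<open>x n\<close> catches the new edge with
  probability \<open>g x\<close>. Since \<open>g\<close> is concave and \<open>x\<^sup>*\<close> is its only positive fixed point, \<open>M\<^sub>1(n)/n\<close> is driven to
  \<open>x\<^sup>*\<close>; the degrees behind it grow at the relative rate \<open>g'(x\<^sup>*)/n = \<gamma>/n\<close> with \<open>\<gamma> = c\<^bsup>d-1\<^esup>d/2 < 1\<close>. No persistent
  hub and no almost sure statement is needed: all estimates are one-step recursions
  \<open>e (n+1) \<le> (1 + \<alpha>/n) e n + O(n\<^bsup>\<rho>-1\<^esup>)\<close> for expectations of functions of the degree sequence, which make each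
  exceptional event polynomially small, and the polynomial rate of one estimate absorbs its exceptional event in the next.

  First, \<open>M\<^sub>1(n) \<ge> (x\<^sup>* - \<delta>) n\<close> by negative moments of \<open>M\<^sub>1(n)/n\<close> (ties at the top only help);
  \<open>M\<^sub>2(n) \<le> n\<^bsup>\<gamma>+\<epsilon>\<^esup>\<close> by a small power of a high moment of the degrees other than \<open>M\<^sub>1\<close>, each of which has rate
  at most \<open>g'(M\<^sub>1/n)/n\<close> by concavity; hence the top degree is eventually not tied and \<open>M\<^sub>1(n) \<le> (x\<^sup>* + \<delta>) n\<close>;
  and finally \<open>M\<^sub>k(n) \<ge> n\<^bsup>\<gamma>-\<epsilon>\<^esup>\<close> by a negative moment of \<open>M\<^sub>2, \<dots>, M\<^sub>k\<close>.\<close>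

text \<open>The order of the bounds is forced by what each drift needs. Zero is an unstable fixed
  point of \<open>g\<close>, so a lower bound for M_1/n must first exclude that the top degree stays
  sublinear; a bounded negative moment does this. The degrees behind the top are slowed down by the
  mass above them, so a lower bound for M_1 already suffices to bound M_2 from above. An upper bound
  for M_1 cannot come earlier: tied top vertices are hit with a larger probability than
  \<open>g (M_1/n)\<close>, and ties are excluded only by M_2 being of smaller order than M_1. The
  lower bound for M_k comes last, as it requires the total degree down to rank k to be close to
  \<open>x_star d * n\<close>. That \<gamma> < 1 is concavity once more: at its fixed point
  \<open>g\<close> has a tangent less steep than the chord from the origin, whose slope is 1. All
  expectations are finite sums over the trees possible at time n; conditional expectations serve
  only to find the joint law of the tree and the chosen vertex.\<close>

section \<open>One-step recursions and discrete powers\<close>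

text \<open>Comparison with \<open>K * n powr \<rho>\<close>, whose relative increment is about
  \<open>\<rho> / n\<close>. As \<open>\<rho>\<close> exceeds \<open>\<alpha>\<close>, each step
  leaves room of order \<open>n powr (\<rho> - 1)\<close> for the error term.\<close>

lemma recursion_bound:
  fixes e :: "nat \<Rightarrow> real" and \<alpha> \<beta> \<rho> C :: real
  assumes "\<alpha> < \<rho>" "\<beta> \<le> \<rho> - 1" "C \<ge> 0"
    and "\<forall>\<^sub>F n in sequentially. e (Suc n) \<le> (1 + \<alpha> / real n) * e n + C * real n powr \<beta>"
  shows "\<exists>K>0. \<forall>\<^sub>F n in sequentially. e n \<le> K * real n powr \<rho>"
proof -
  \<comment> \<open>The midpoint splits the gap: \<open>\<rho>\<close> over \<open>\<alpha>'\<close>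
    pays for the higher-order terms of \<open>(1 + 1 / n) powr \<rho>\<close>, and
    \<open>\<alpha>'\<close> over \<open>\<alpha>\<close> for the error term.\<close>
  define \<alpha>' where "\<alpha>' = (\<alpha> + \<rho>) / 2"
  have a': "\<alpha> < \<alpha>'" "\<alpha>' < \<rho>" using assms(1) by (auto simp: \<alpha>'_def)
  have lim: "(\<lambda>n. real n * ((1 + 1 / real n) powr \<rho> - 1)) \<longlonglongrightarrow> \<rho>"
    by real_asymp
  have "\<forall>\<^sub>F n in sequentially. real n * ((1 + 1 / real n) powr \<rho> - 1) > \<alpha>'"
    using order_tendstoD(1)[OF lim a'(2)] .
  moreover have "\<forall>\<^sub>F n in sequentially. 1 + \<alpha> / real n \<ge> 0"
    by real_asymp
  ultimately have "\<forall>\<^sub>F n in sequentially. n \<ge> 1 \<and> real n * ((1 + 1 / real n) powr \<rho> - 1) > \<alpha>' \<and>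
     1 + \<alpha> / real n \<ge> 0 \<and> e (Suc n) \<le> (1 + \<alpha> / real n) * e n + C * real n powr \<beta>"
    using assms(4) eventually_ge_at_top[of 1] by eventually_elim auto
  then obtain N where N: "\<And>n. n \<ge> N \<Longrightarrow> n \<ge> 1 \<and> real n * ((1 + 1 / real n) powr \<rho> - 1) > \<alpha>' \<and>
     1 + \<alpha> / real n \<ge> 0 \<and> e (Suc n) \<le> (1 + \<alpha> / real n) * e n + C * real n powr \<beta>"
    unfolding eventually_sequentially by auto
  \<comment> \<open>The second entry lets the gap absorb \<open>C\<close>, the third starts the
    induction at \<open>N\<close>.\<close>
  define K where "K = max 1 (max (C / (\<alpha>' - \<alpha>)) (e N / real N powr \<rho>))"
  have K: "K \<ge> 1" "C \<le> K * (\<alpha>' - \<alpha>)" 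
  proof -
    have "C / (\<alpha>' - \<alpha>) \<le> K" by (simp add: K_def)
    then show "C \<le> K * (\<alpha>' - \<alpha>)" using a' by (simp add: divide_le_eq)
  qed (simp add: K_def)
  have "e n \<le> K * real n powr \<rho>" if "n \<ge> N" for n
    using that
  proof (induction n rule: dec_induct)
    case base
    have "e N / real N powr \<rho> \<le> K" by (simp add: K_def)
    moreover have "real N powr \<rho> > 0" using N[of N] by simp
    ultimately show ?case by (simp add: divide_le_eq)
  next
    case (step n)
    have n: "n \<ge> 1" and r: "real n * ((1 + 1 / real n) powr \<rho> - 1) > \<alpha>'" 
      and nn: "1 + \<alpha> / real n \<ge> 0"
      and rec: "e (Suc n) \<le> (1 + \<alpha> / real n) * e n + C * real n powr \<beta>"
      using N[of n] step by auto
    have r': "1 + \<alpha>' / real n \<le> (1 + 1 / real n) powr \<rho>"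
      using r n by (simp add: field_simps)
    have b: "real n powr \<beta> \<le> real n powr \<rho> / real n"
      using powr_mono[OF assms(2), of "real n"] n by (simp add: powr_diff)
    have "C * real n powr \<beta> \<le> K * (\<alpha>' - \<alpha>) * (real n powr \<rho> / real n)"
      using b K assms(3) a' by (intro mult_mono) auto
    moreover have "(1 + \<alpha> / real n) * e n \<le> (1 + \<alpha> / real n) * (K * real n powr \<rho>)"
      using nn step by (intro mult_left_mono) auto
    ultimately have "e (Suc n) \<le> (1 + \<alpha>' / real n) * (K * real n powr \<rho>)"
      using rec by (simp add: algebra_simps add_divide_distrib diff_divide_distrib)
    also have "\<dots> \<le> (1 + 1 / real n) powr \<rho> * (K * real n powr \<rho>)"
      using r' K by (intro mult_right_mono) auto
    also have "\<dots> = K * real (Suc n) powr \<rho>"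
    proof -
      have "real (Suc n) = (1 + 1 / real n) * real n" using n by (simp add: field_simps)
      then have "real (Suc n) powr \<rho> = (1 + 1 / real n) powr \<rho> * real n powr \<rho>"
        by (simp only:) (simp add: powr_mult)
      then show ?thesis by simp
    qed
    finally show ?case .
  qed
  then show ?thesis using K by (intro exI[of _ K]) (auto simp: eventually_sequentially)
qed

text \<open>The discrete analogue of \<open>a \<mapsto> a\<^sup>p\<close>, also for negative \<open>p\<close>: if the value \<open>a\<close> moves to
  \<open>a + 1\<close> with probability proportional to \<open>a\<close>, then \<open>rise p\<close> has drift exactly proportional to itself,
  without the error terms that \<open>a\<^sup>p\<close> produces for small \<open>a\<close>.\<close>

definition rise :: "real \<Rightarrow> nat \<Rightarrow> real" where
  "rise p a = (\<Prod>j=1..<a. 1 + p / real j)"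

lemma rise_1 [simp]: "rise p (Suc 0) = 1"
  by (simp add: rise_def)

lemma rise_Suc: "a \<ge> 1 \<Longrightarrow> rise p (Suc a) = rise p a * (1 + p / real a)"
  by (simp add: rise_def)

lemma rise_factor_pos: "p > -1 \<Longrightarrow> j \<ge> 1 \<Longrightarrow> 1 + p / real j > 0"
  by (simp add: field_simps)

lemma rise_pos: "p > -1 \<Longrightarrow> rise p a > 0"
  unfolding rise_def by (intro prod_pos) (auto intro: rise_factor_pos)

lemma rise_antimono:
  assumes "-1 < p" "p \<le> 0" "1 \<le> a" "a \<le> b"
  shows "rise p b \<le> rise p a"
  using assms(4)
proof (induction b rule: dec_induct)
  case (step n)
  have "rise p n * (1 + p / real n) \<le> rise p n * 1"
    using assms step rise_pos[of p n] by (intro mult_left_mono) (auto simp: field_simps)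
  then show ?case using step assms by (simp add: rise_Suc)
qed simp

lemma rise_mono:
  assumes "0 \<le> p" "1 \<le> a" "a \<le> b"
  shows "rise p a \<le> rise p b"
  using assms(3)
proof (induction b rule: dec_induct)
  case (step n)
  have "rise p n * (1 + p / real n) \<ge> rise p n * 1"
    using assms step rise_pos[of p n] by (intro mult_left_mono) auto
  then show ?case using step assms by (simp add: rise_Suc)
qed simp

text \<open>Up to a shift of the index, \<open>rise p\<close> is
  \<open>pochhammer (1 + p) n / fact n\<close>, so the product formula for the reciprocal Gamma
  function gives the limit. The exact constant is what makes sharp thresholds possible in
  \<open>max_degree_lower\<close>.\<close>

lemma rise_asymp:
  assumes "p > -1"
  shows "(\<lambda>a. rise p a * real a powr (-p)) \<longlonglongrightarrow> rGamma (1 + p)"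
proof -
  have eq: "rise p (Suc n) = pochhammer (1 + p) n / fact n" for n
  proof (induction n)
    case (Suc n)
    have "rise p (Suc (Suc n)) = pochhammer (1 + p) n / fact n * (1 + p / real (Suc n))"
      using Suc by (simp add: rise_Suc)
    also have "\<dots> = pochhammer (1 + p) n / fact n * ((1 + p + real n) / real (Suc n))"
      by (simp add: field_simps)
    also have "\<dots> = pochhammer (1 + p) (Suc n) / fact (Suc n)"
      by (simp add: pochhammer_rec' mult_ac del: of_nat_Suc)
    finally show ?case .
  qed simp
  have "(\<lambda>n. rGamma_series (1 + p) n) \<longlonglongrightarrow> rGamma (1 + p)"
    by (rule rGamma_series_LIMSEQ)
  \<comment> \<open>Index shift between \<open>rGamma_series\<close> at \<open>n\<close> and
    \<open>rise\<close> at \<open>Suc n\<close>; the last bracket tends to 1 and is divided out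
    below.\<close>
  moreover have "\<forall>\<^sub>F n in sequentially. rGamma_series (1 + p) n = 
     rise p (Suc n) * real (Suc n) powr (-p) * ((1 + p + real n) / real n * (1 + 1 / real n) powr p)"
    using eventually_gt_at_top[of 0]
  proof eventually_elim
    case (elim n)
    have *: "real (Suc n) = (1 + 1 / real n) * real n" using elim by (simp add: field_simps)
    have split: "real (Suc n) powr (-p) = (1 + 1 / real n) powr (-p) * real n powr (-p)"
      by (simp only: *) (simp add: powr_mult)
    have "1 + 1 / real n > 0" by (simp add: add_pos_nonneg)
    then have "(1 + 1 / real n) powr (-p) * (1 + 1 / real n) powr p = 1"
      by (simp add: powr_add[symmetric])
    then have cancel: "real (Suc n) powr (-p) * (1 + 1 / real n) powr p = real n powr (-p)"
      unfolding split by (simp add: mult_ac)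
    define Z where "Z = exp ((1 + p) * ln (real n))"
    have Z: "Z \<noteq> 0" by (simp add: Z_def)
    have e: "inverse Z = real n powr (-p) / real n"
    proof -
      have "inverse Z = exp (- p * ln (real n) - ln (real n))"
        by (simp add: Z_def exp_minus[symmetric] algebra_simps)
      also have "\<dots> = real n powr (-p) / real n" using elim by (simp add: exp_diff powr_def)
      finally show ?thesis .
    qed
    have "rGamma_series (1 + p) n = pochhammer (1 + p) (Suc n) / (fact n * Z)"
      by (simp add: rGamma_series_def Z_def)
    also have "\<dots> = rise p (Suc n) * (1 + p + real n) * inverse Z"
      by (simp only: eq pochhammer_rec') (simp add: field_simps Z)
    also have "\<dots> = rise p (Suc n) * (1 + p + real n) / real n * 
        (real (Suc n) powr (-p) * (1 + 1 / real n) powr p)"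
      unfolding e cancel by simp
    finally show ?case by simp
  qed
  ultimately have 1: "(\<lambda>n. rise p (Suc n) * real (Suc n) powr (-p) * ((1 + p + real n) / real n * (1 + 1 / real n) powr p))
     \<longlonglongrightarrow> rGamma (1 + p)"
    by (rule Lim_transform_eventually)
  have 2: "(\<lambda>n. (1 + p + real n) / real n * (1 + 1 / real n) powr p) \<longlonglongrightarrow> 1"
    by real_asymp
  have 3: "(\<lambda>n. rise p (Suc n) * real (Suc n) powr (-p) * ((1 + p + real n) / real n * (1 + 1 / real n) powr p) / 
       ((1 + p + real n) / real n * (1 + 1 / real n) powr p)) \<longlonglongrightarrow> rGamma (1 + p) / 1"
    by (intro tendsto_divide 1 2) auto
  have "\<forall>\<^sub>F n in sequentially. (1 + p + real n) / real n * (1 + 1 / real n) powr p \<noteq> 0"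
    using eventually_gt_at_top[of 0]
  proof eventually_elim
    case (elim n)
    then have "1 + 1 / real n > 0" by (simp add: add_pos_pos)
    then show ?case using elim assms by auto
  qed
  then have "\<forall>\<^sub>F n in sequentially. rise p (Suc n) * real (Suc n) powr (-p) * ((1 + p + real n) / real n * (1 + 1 / real n) powr p) / 
       ((1 + p + real n) / real n * (1 + 1 / real n) powr p) = rise p (Suc n) * real (Suc n) powr (-p)"
    by eventually_elim auto
  with 3 have "(\<lambda>n. rise p (Suc n) * real (Suc n) powr (-p)) \<longlonglongrightarrow> rGamma (1 + p) / 1"
    by (rule Lim_transform_eventually)
  then have "(\<lambda>n. rise p (Suc n) * real (Suc n) powr (-p)) \<longlonglongrightarrow> rGamma (1 + p)" by simp
  then show ?thesis by (subst (asm) filterlim_sequentially_Suc)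
qed

text \<open>\<open>1 + p > 0\<close> makes the limit in \<open>rise_asymp\<close> positive; the
  finitely many small \<open>a\<close> only change the constants.\<close>

lemma rise_bounds:
  assumes "p > -1"
  obtains c C where "0 < c" "0 < C" "\<And>a. a \<ge> 1 \<Longrightarrow> c * real a powr p \<le> rise p a"
    "\<And>a. a \<ge> 1 \<Longrightarrow> rise p a \<le> C * real a powr p"
proof -
  define f where "f a = rise p a * real a powr (-p)" for a
  have lim: "f \<longlonglongrightarrow> rGamma (1 + p)" using rise_asymp[OF assms] by (simp add: f_def[abs_def])
  have g: "rGamma (1 + p) > 0"
    using assms by (simp add: rGamma_inverse_Gamma Gamma_real_pos)
  have pos: "f a > 0" if "a \<ge> 1" for a using that rise_pos[OF assms] by (simp add: f_def)
  obtain N where N: "\<And>a. a \<ge> N \<Longrightarrow> f a > rGamma (1 + p) / 2"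
    using order_tendstoD(1)[OF lim, of "rGamma (1+p) / 2"] g unfolding eventually_sequentially by auto
  define c where "c = Min (insert (rGamma (1 + p) / 2) (f ` {1..N}))"
  have c: "c > 0" unfolding c_def using g pos by (subst Min_gr_iff) auto
  have cf: "c \<le> f a" if "a \<ge> 1" for a
  proof (cases "a \<le> N")
    case True
    then show ?thesis unfolding c_def using that by (intro Min_le) auto
  next
    case False
    have "c \<le> rGamma (1 + p) / 2" unfolding c_def by (intro Min_le) auto
    then show ?thesis using N[of a] False by simp
  qed
  have "Bseq f" using lim convergent_imp_Bseq convergentI by blast
  then obtain C where C: "C > 0" "\<And>a. \<bar>f a\<bar> \<le> C" by (auto elim: BseqE)
  have eq: "rise p a = f a * real a powr p" if "a \<ge> 1" for a
    using that by (simp add: f_def powr_minus field_simps)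
  show ?thesis
  proof (rule that[OF c C(1)])
    fix a :: nat assume a: "a \<ge> 1"
    show "c * real a powr p \<le> rise p a" using cf[OF a] by (simp add: eq[OF a] mult_right_mono)
    show "rise p a \<le> C * real a powr p" using C(2)[of a] by (simp add: eq[OF a] mult_right_mono)
  qed
qed

section \<open>Trees and their degree sequences\<close>

text \<open>All values that the tree can take at time \<open>n\<close>; the set is finite, so
  expectations become finite sums. The empty value at time 0 makes membership imply
  \<open>n \<ge> 1\<close>.\<close>

fun trees :: "nat \<Rightarrow> nat set set set" where
  "trees 0 = {}"
| "trees (Suc 0) = {{{1, 2}}}"
| "trees (Suc (Suc n)) = (\<lambda>(E, y). insert {Suc n + 2, y} E) ` (trees (Suc n) \<times> {1..Suc n + 1})"

lemma trees_Suc: "n \<ge> 1 \<Longrightarrow> trees (Suc n) = (\<lambda>(E, y). insert {n + 2, y} E) ` (trees n \<times> {1..n + 1})"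
  by (cases n) simp_all

lemma trees_induct [consumes 1, case_names base step]:
  assumes "E \<in> trees n" "P 1 {{1, 2}}"
    and "\<And>n E y. n \<ge> 1 \<Longrightarrow> E \<in> trees n \<Longrightarrow> P n E \<Longrightarrow> y \<in> {1..n + 1} \<Longrightarrow> P (Suc n) (insert {n + 2, y} E)"
  shows "P n E"
  using assms(1)
proof (induction n arbitrary: E)
  case (Suc n)
  show ?case
  proof (cases "n = 0")
    case True
    then show ?thesis using Suc assms(2) by simp
  next
    case False
    then obtain F y where "F \<in> trees n" "y \<in> {1..n + 1}" "E = insert {n + 2, y} F"
      using Suc.prems by (auto simp: trees_Suc)
    then show ?thesis using assms(3)[of n F y] Suc.IH[of F] False by auto
  qed
qed simp

lemma trees_pos: "E \<in> trees n \<Longrightarrow> n \<ge> 1"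
  by (cases n) auto

lemma insert_in_trees:
  assumes "E \<in> trees n" "y \<in> {1..n + 1}"
  shows "insert {n + 2, y} E \<in> trees (Suc n)"
  unfolding trees_Suc[OF trees_pos[OF assms(1)]]
  by (rule image_eqI[where x = "(E, y)"]) (use assms in auto)

lemma finite_trees [simp]: "finite (trees n)"
  by (induction n rule: trees.induct) auto

lemma Union_tree: "E \<in> trees n \<Longrightarrow> \<Union>E = {1..n + 1}"
proof (induction rule: trees_induct)
  case (step n E y)
  then have "\<Union> (insert {n + 2, y} E) = insert (n + 2) {1..n + 1}" by auto
  also have "\<dots> = {1..Suc n + 1}" by auto
  finally show ?case .
qed auto

lemma finite_tree: "E \<in> trees n \<Longrightarrow> finite E"
  by (induction rule: trees_induct) auto

lemma degree_not_vertex: "v \<notin> \<Union>E \<Longrightarrow> degree_of E v = 0"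
proof -
  assume "v \<notin> \<Union>E"
  then have "{e \<in> E. v \<in> e} = {}" by auto
  then show ?thesis unfolding degree_of_def by (metis card.empty)
qed

text \<open>The edge is new because \<open>n + 2\<close> is not a vertex yet. Nonvertices have
  degree 0, so the formula covers the new leaf as well.\<close>

lemma degree_insert:
  assumes "E \<in> trees n" "y \<in> {1..n + 1}"
  shows "degree_of (insert {n + 2, y} E) v = degree_of E v + of_bool (v = y \<or> v = n + 2)"
proof -
  have "n + 2 \<notin> \<Union>E" by (simp add: Union_tree[OF assms(1)])
  then have new: "{n + 2, y} \<notin> E" by blast
  have fin: "finite E" using finite_tree[OF assms(1)] .
  have "{e \<in> insert {n + 2, y} E. v \<in> e} =
      (if v = y \<or> v = n + 2 then insert {n + 2, y} {e \<in> E. v \<in> e} else {e \<in> E. v \<in> e})"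
    by auto
  then show ?thesis using new fin by (auto simp: degree_of_def)
qed

lemma degree_new: "E \<in> trees n \<Longrightarrow> degree_of E (n + 2) = 0"
  by (intro degree_not_vertex) (simp add: Union_tree)

lemma degree_pos: 
  assumes "E \<in> trees n" "v \<in> {1..n + 1}"
  shows "degree_of E v \<ge> 1"
proof -
  have "v \<in> \<Union>E" using assms by (simp add: Union_tree)
  then have "{e \<in> E. v \<in> e} \<noteq> {}" by auto
  moreover have "finite {e \<in> E. v \<in> e}" using finite_tree[OF assms(1)] by simp
  ultimately show ?thesis by (simp add: degree_of_def Suc_le_eq card_gt_0_iff)
qed

lemma degree_le: "E \<in> trees n \<Longrightarrow> degree_of E v \<le> n"
proof (induction rule: trees_induct)
  case base
  have "card {e \<in> {{1, 2::nat}}. v \<in> e} \<le> card {{1, 2::nat}}" by (intro card_mono) auto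
  then show ?case by (simp add: degree_of_def)
next
  case (step n E y)
  then show ?case by (subst degree_insert) auto
qed

lemma sum_new_vertex:
  fixes f :: "nat \<Rightarrow> 'b::ab_group_add"
  assumes "E \<in> trees n" "y \<in> {1..n + 1}"
  shows "(\<Sum>v\<in>{1..n + 2}. f (degree_of (insert {n + 2, y} E) v)) =
    (\<Sum>v\<in>{1..n + 1}. f (degree_of E v)) + (f (degree_of E y + 1) - f (degree_of E y)) + f 1"
proof -
  have "{1..n + 2} = insert (n + 2) {1..n + 1}" by auto
  then have "(\<Sum>v\<in>{1..n + 2}. f (degree_of (insert {n + 2, y} E) v)) =
     f 1 + (\<Sum>v\<in>{1..n + 1}. f (degree_of (insert {n + 2, y} E) v))"
    using degree_insert[OF assms, of "n + 2"] degree_new[OF assms(1)] by simp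
  also have "(\<Sum>v\<in>{1..n + 1}. f (degree_of (insert {n + 2, y} E) v)) = 
     (\<Sum>v\<in>{1..n + 1}. f (degree_of E v) + (if v = y then f (degree_of E y + 1) - f (degree_of E y) else 0))"
  proof (intro sum.cong refl)
    fix v assume "v \<in> {1..n + 1}"
    then have "v \<noteq> n + 2" by auto
    then show "f (degree_of (insert {n + 2, y} E) v) =
        f (degree_of E v) + (if v = y then f (degree_of E y + 1) - f (degree_of E y) else 0)"
      unfolding degree_insert[OF assms, of v] by (cases "v = y") auto
  qed
  also have "\<dots> = (\<Sum>v\<in>{1..n + 1}. f (degree_of E v)) + (f (degree_of E y + 1) - f (degree_of E y))"
    unfolding sum.distrib using assms(2) by (simp add: sum.delta)
  finally show ?thesis by (simp add: algebra_simps)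
qed

lemma sum_degrees: "E \<in> trees n \<Longrightarrow> (\<Sum>v\<in>{1..n + 1}. degree_of E v) = 2 * n"
proof -
  assume "E \<in> trees n"
  \<comment> \<open>Integers, because \<open>sum_new_vertex\<close> subtracts.\<close>
  then have "(\<Sum>v\<in>{1..n + 1}. int (degree_of E v)) = 2 * int n"
  proof (induction rule: trees_induct)
    case base
    have "{e \<in> {{1, 2::nat}}. v \<in> e} = (if v = 1 \<or> v = 2 then {{1, 2}} else {})" for v by auto
    then have "degree_of {{1, 2::nat}} v = of_bool (v = 1 \<or> v = 2)" for v by (simp add: degree_of_def)
    moreover have "{1..1 + 1} = {1, 2::nat}" by auto
    ultimately show ?case by (simp only:) simp
  next
    case (step n E y)
    then show ?case using sum_new_vertex[OF step(2,3), of int] by simp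
  qed
  then have "int (\<Sum>v\<in>{1..n + 1}. degree_of E v) = int (2 * n)" by (simp only: of_nat_sum of_nat_mult of_nat_numeral)
  then show ?thesis by (simp only: of_nat_eq_iff)
qed

section \<open>Counts and weights above a degree threshold\<close>

text \<open>Threshold counts change by at most one per step at thresholds from 2 on, while the
  sorted list is hard to follow; ranks are read off from them by
  \<open>le_kth_degree_iff\<close>.\<close>

definition num_ge :: "nat set set \<Rightarrow> nat \<Rightarrow> nat" where
  "num_ge E t = card {v \<in> \<Union>E. t \<le> degree_of E v}"

text \<open>Divided by \<open>2 * n\<close>, this is the probability that a single candidate has
  degree at least \<open>t\<close>.\<close>

definition weight_ge :: "nat set set \<Rightarrow> nat \<Rightarrow> nat" where
  "weight_ge E t = (\<Sum>v | v \<in> \<Union>E \<and> t \<le> degree_of E v. degree_of E v)"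

lemma num_ge_antimono: "E \<in> trees n \<Longrightarrow> s \<le> t \<Longrightarrow> num_ge E t \<le> num_ge E s"
  unfolding num_ge_def by (intro card_mono) (auto simp: Union_tree simp del: Union_iff)

lemma num_ge_Suc_0: "E \<in> trees n \<Longrightarrow> num_ge E 1 = n + 1"
proof -
  assume E: "E \<in> trees n"
  have "1 \<le> degree_of E v" if "v \<in> \<Union>E" for v
    using degree_pos[OF E, of v] that unfolding Union_tree[OF E] .
  then have eq: "{v \<in> \<Union>E. 1 \<le> degree_of E v} = {1..n + 1}"
    unfolding Union_tree[OF E] by blast
  show ?thesis unfolding num_ge_def eq by simp
qed

text \<open>From \<open>t = 2\<close> on the new leaf, of degree 1, is not counted, and only a
  vertex passing from \<open>t - 1\<close> to \<open>t\<close> can enter.\<close>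

lemma num_ge_insert:
  assumes "E \<in> trees n" "y \<in> {1..n + 1}" "t \<ge> 2"
  shows "num_ge (insert {n + 2, y} E) t = num_ge E t + of_bool (degree_of E y + 1 = t)"
proof -
  have U: "\<Union>(insert {n + 2, y} E) = insert (n + 2) {1..n + 1}" 
    using Union_tree[OF assms(1)] assms(2) by auto
  have "{v \<in> \<Union>(insert {n + 2, y} E). t \<le> degree_of (insert {n + 2, y} E) v} = 
     (if degree_of E y + 1 = t then insert y {v \<in> \<Union>E. t \<le> degree_of E v} else {v \<in> \<Union>E. t \<le> degree_of E v})"
  proof (rule set_eqI)
    fix v
    consider "v = n + 2" | "v = y" "v \<noteq> n + 2" | "v \<noteq> y" "v \<noteq> n + 2" by blast
    then show "v \<in> {v \<in> \<Union>(insert {n + 2, y} E). t \<le> degree_of (insert {n + 2, y} E) v} \<longleftrightarrow> 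
       v \<in> (if degree_of E y + 1 = t then insert y {v \<in> \<Union>E. t \<le> degree_of E v} else {v \<in> \<Union>E. t \<le> degree_of E v})"
      unfolding U Union_tree[OF assms(1)] mem_Collect_eq degree_insert[OF assms(1,2), of v]
      using assms(2,3) degree_new[OF assms(1)] by cases auto
  qed
  moreover have "degree_of E y + 1 = t \<Longrightarrow> y \<notin> {v \<in> \<Union>E. t \<le> degree_of E v}" by auto
  moreover have "finite {v \<in> \<Union>E. t \<le> degree_of E v}" by (simp add: Union_tree[OF assms(1)])
  ultimately show ?thesis by (simp add: num_ge_def)
qed

text \<open>In an ascending list the entries that are at least \<open>t\<close> form a final
  segment, and the \<open>k\<close>-th largest entry has index \<open>length xs - k\<close>.\<close>

lemma sorted_nth_ge_iff:
  fixes xs :: "nat list"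
  assumes "sorted xs" "1 \<le> k" "k \<le> length xs"
  shows "t \<le> rev xs ! (k - 1) \<longleftrightarrow> k \<le> length (filter (\<lambda>x. t \<le> x) xs)"
proof -
  define i where "i = length xs - k"
  have i: "i < length xs" using assms by (simp add: i_def)
  have eq: "rev xs ! (k - 1) = xs ! i" using assms by (simp add: rev_nth i_def)
  have len: "length (filter (\<lambda>x. t \<le> x) xs) = card {j. j < length xs \<and> t \<le> xs ! j}"
    by (simp add: length_filter_conv_card)
  show ?thesis
  proof
    assume "t \<le> rev xs ! (k - 1)"
    then have "t \<le> xs ! j" if "i \<le> j" "j < length xs" for j
      using eq sorted_nth_mono[OF assms(1) that] by simp
    then have "{i..<length xs} \<subseteq> {j. j < length xs \<and> t \<le> xs ! j}" by auto
    then have "card {i..<length xs} \<le> card {j. j < length xs \<and> t \<le> xs ! j}" by (intro card_mono) auto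
    then show "k \<le> length (filter (\<lambda>x. t \<le> x) xs)" using len assms by (simp add: i_def)
  next
    assume k: "k \<le> length (filter (\<lambda>x. t \<le> x) xs)"
    show "t \<le> rev xs ! (k - 1)"
    proof (rule ccontr)
      assume "\<not> t \<le> rev xs ! (k - 1)"
      then have lt: "xs ! i < t" using eq by simp
      have "{j. j < length xs \<and> t \<le> xs ! j} \<subseteq> {i<..<length xs}"
      proof
        fix j assume j: "j \<in> {j. j < length xs \<and> t \<le> xs ! j}"
        then show "j \<in> {i<..<length xs}" using lt i sorted_nth_mono[OF assms(1), of j i] by (cases "j \<le> i") auto
      qed
      then have "card {j. j < length xs \<and> t \<le> xs ! j} \<le> card {i<..<length xs}" by (intro card_mono) auto
      then show False using k len i assms by (simp add: i_def)
    qed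
  qed
qed

text \<open>The last hypothesis excludes the default value: with fewer than \<open>k\<close>
  vertices, M_k = 1 satisfies \<open>1 \<le> M_k\<close> although only \<open>n + 1 < k\<close>
  vertices are counted.\<close>

lemma le_kth_degree_iff:
  assumes E: "E \<in> trees n" and "k \<ge> 1" and "t \<ge> 2 \<or> k \<le> n + 1"
  shows "t \<le> kth_degree k E \<longleftrightarrow> k \<le> num_ge E t"
proof -
  have card: "card (\<Union>E) = n + 1" by (simp add: Union_tree[OF E])
  show ?thesis
  proof (cases "k \<le> n + 1")
    case True
    define A where "A = image_mset (degree_of E) (mset_set (\<Union>E))"
    define xs where "xs = sorted_list_of_multiset A"
    have ms: "mset xs = A" "sorted xs" by (auto simp: xs_def)
    have "length xs = size A" unfolding ms(1)[symmetric] by simp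
    also have "\<dots> = n + 1" by (simp add: A_def card)
    finally have len: "length xs = n + 1" .
    have "length (filter (\<lambda>x. t \<le> x) xs) = size (mset (filter (\<lambda>x. t \<le> x) xs))"
      by (simp only: size_mset)
    also have "\<dots> = size (filter_mset (\<lambda>x. t \<le> x) A)" by (simp only: mset_filter ms(1))
    also have "\<dots> = num_ge E t"
      unfolding A_def num_ge_def by (simp add: filter_mset_image_mset Union_tree[OF E] filter_mset_mset_set)
    finally have *: "length (filter (\<lambda>x. t \<le> x) xs) = num_ge E t" .
    have "kth_degree k E = rev xs ! (k - 1)"
      using True card by (simp add: kth_degree_def degrees_desc_def xs_def A_def)
    then show ?thesis using sorted_nth_ge_iff[OF ms(2) assms(2), of t] True len * by simp
  next
    case False
    then have "kth_degree k E = 1" by (simp add: kth_degree_def card)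
    moreover have "num_ge E t \<le> n + 1" 
      using num_ge_antimono[OF E, of 1 t] num_ge_Suc_0[OF E] False assms(3) by simp
    ultimately show ?thesis using False assms(3) by auto
  qed
qed

lemma kth_degree_ge_1: 
  assumes E: "E \<in> trees n" and k: "k \<ge> 1"
  shows "kth_degree k E \<ge> 1"
proof (cases "k \<le> n + 1")
  case True
  then show ?thesis using le_kth_degree_iff[OF E k, of 1] num_ge_Suc_0[OF E] by linarith
next
  case False
  moreover have "card (\<Union>E) = n + 1" unfolding Union_tree[OF E] by simp
  ultimately show ?thesis by (simp add: kth_degree_def)
qed

lemma kth_degree_antimono:
  assumes "E \<in> trees n" "1 \<le> i" "i \<le> j"
  shows "kth_degree j E \<le> kth_degree i E"
proof (cases "kth_degree j E \<ge> 2")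
  case True
  then have "j \<le> num_ge E (kth_degree j E)"
    using le_kth_degree_iff[OF assms(1), of j "kth_degree j E"] assms by linarith
  then show ?thesis using le_kth_degree_iff[OF assms(1), of i "kth_degree j E"] assms True by linarith
next
  case False
  then show ?thesis using kth_degree_ge_1[OF assms(1,2)] by linarith
qed

lemma kth_degree_insert_ge:
  assumes E: "E \<in> trees n" and y: "y \<in> {1..n + 1}" and k: "k \<ge> 1"
  shows "kth_degree k E \<le> kth_degree k (insert {n + 2, y} E)"
proof (cases "kth_degree k E \<ge> 2")
  case True
  have "k \<le> num_ge E (kth_degree k E)"
    using le_kth_degree_iff[OF E k, of "kth_degree k E"] True by blast
  also have "\<dots> \<le> num_ge (insert {n + 2, y} E) (kth_degree k E)"
    unfolding num_ge_insert[OF E y True] by simp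
  finally show ?thesis 
    using le_kth_degree_iff[OF insert_in_trees[OF E y] k, of "kth_degree k E"] True by blast
next
  case False
  then show ?thesis using kth_degree_ge_1[OF insert_in_trees[OF E y] k] by linarith
qed

lemma degree_le_max:
  assumes E: "E \<in> trees n"
  shows "degree_of E v \<le> kth_degree 1 E"
proof (cases "degree_of E v \<ge> 2")
  case True
  then have "v \<in> \<Union>E" using degree_not_vertex[of v E] by fastforce
  then have "v \<in> {u \<in> \<Union>E. degree_of E v \<le> degree_of E u}" by blast
  moreover have "finite {u \<in> \<Union>E. degree_of E v \<le> degree_of E u}" unfolding Union_tree[OF E] by simp
  ultimately have "num_ge E (degree_of E v) > 0" unfolding num_ge_def card_gt_0_iff by blast
  then show ?thesis using le_kth_degree_iff[OF E, of 1 "degree_of E v"] True by linarith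
next
  case False
  then show ?thesis using kth_degree_ge_1[OF E, of 1] by linarith
qed

lemma max_degree_attained:
  assumes E: "E \<in> trees n"
  obtains v where "v \<in> {1..n + 1}" "degree_of E v = kth_degree 1 E"
proof -
  have "num_ge E (kth_degree 1 E) \<ge> 1" using le_kth_degree_iff[OF E, of 1 "kth_degree 1 E"] by simp
  then have "card {v \<in> \<Union>E. kth_degree 1 E \<le> degree_of E v} \<noteq> 0" unfolding num_ge_def by linarith
  then have "{v \<in> \<Union>E. kth_degree 1 E \<le> degree_of E v} \<noteq> {}" by (metis card.empty)
  then obtain v where v: "v \<in> \<Union>E" "kth_degree 1 E \<le> degree_of E v" by blast
  show ?thesis 
  proof (rule that[of v])
    show "v \<in> {1..n + 1}" using v(1) unfolding Union_tree[OF E] .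
    show "degree_of E v = kth_degree 1 E" using v(2) degree_le_max[OF E, of v] by linarith
  qed
qed

text \<open>A degree grows by at most one per step, so only a vertex that is already at the top can
  produce a new maximum; which of several tied ones it is does not matter.\<close>

lemma max_degree_insert:
  assumes E: "E \<in> trees n" and y: "y \<in> {1..n + 1}"
  shows "kth_degree 1 (insert {n + 2, y} E) = kth_degree 1 E + of_bool (degree_of E y = kth_degree 1 E)"
proof -
  have E': "insert {n + 2, y} E \<in> trees (Suc n)" using insert_in_trees E y by blast
  obtain v where v: "degree_of E v = kth_degree 1 E" using max_degree_attained[OF E] by blast
  obtain u where u: "degree_of (insert {n + 2, y} E) u = kth_degree 1 (insert {n + 2, y} E)" 
    using max_degree_attained[OF E'] by blast
  have pos: "kth_degree 1 E \<ge> 1" using kth_degree_ge_1[OF E] by simp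
  have lower: "kth_degree 1 E \<le> kth_degree 1 (insert {n + 2, y} E)" 
    using kth_degree_insert_ge[OF E y] by simp
  have upper: "kth_degree 1 (insert {n + 2, y} E) = degree_of E u + of_bool (u = y \<or> u = n + 2)"
    using u degree_insert[OF E y, of u] by simp
  show ?thesis
  proof (cases "degree_of E y = kth_degree 1 E")
    case True
    have "kth_degree 1 E + 1 \<le> kth_degree 1 (insert {n + 2, y} E)"
      using degree_le_max[OF E', of y] degree_insert[OF E y, of y] True by simp
    moreover have "kth_degree 1 (insert {n + 2, y} E) \<le> kth_degree 1 E + 1"
      unfolding upper using degree_le_max[OF E, of u] by (intro add_mono) auto
    ultimately show ?thesis using True by simp
  next
    case False
    have "kth_degree 1 (insert {n + 2, y} E) \<le> kth_degree 1 E"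
    proof (cases "u = n + 2")
      case True
      then show ?thesis unfolding upper using degree_new[OF E] pos by simp
    next
      case un: False
      then show ?thesis unfolding upper using degree_le_max[OF E, of u] False
        by (cases "u = y") auto
    qed
    then show ?thesis using lower False by simp
  qed
qed

lemma max_degree_le: "E \<in> trees n \<Longrightarrow> kth_degree 1 E \<le> n"
  by (metis degree_le max_degree_attained)

lemma weight_ge_1: "E \<in> trees n \<Longrightarrow> weight_ge E 1 = 2 * n"
proof -
  assume E: "E \<in> trees n"
  have "1 \<le> degree_of E v" if "v \<in> \<Union>E" for v
    using degree_pos[OF E, of v] that unfolding Union_tree[OF E] .
  then have eq: "{v \<in> \<Union>E. 1 \<le> degree_of E v} = {1..n + 1}"
    unfolding Union_tree[OF E] by blast
  show ?thesis unfolding weight_ge_def eq by (rule sum_degrees[OF E])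
qed

lemma weight_ge_Suc: 
  assumes E: "E \<in> trees n"
  shows "weight_ge E t = weight_ge E (Suc t) + card {v \<in> {1..n + 1}. degree_of E v = t} * t"
proof -
  have "{v. v \<in> \<Union>E \<and> t \<le> degree_of E v} = {v. v \<in> \<Union>E \<and> Suc t \<le> degree_of E v} \<union> {v \<in> {1..n + 1}. degree_of E v = t}"
    by (auto simp: Union_tree[OF E] simp del: Union_iff)
  then have "weight_ge E t = weight_ge E (Suc t) + (\<Sum>v\<in>{v \<in> {1..n + 1}. degree_of E v = t}. degree_of E v)"
    unfolding weight_ge_def by (simp only:) (subst sum.union_disjoint, auto simp: Union_tree[OF E] simp del: Union_iff)
  then show ?thesis by simp
qed

lemma weight_ge_antimono: "E \<in> trees n \<Longrightarrow> s \<le> t \<Longrightarrow> weight_ge E t \<le> weight_ge E s"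
  unfolding weight_ge_def by (intro sum_mono2) (auto simp: Union_tree simp del: Union_iff)

lemma weight_ge_le: "E \<in> trees n \<Longrightarrow> t \<ge> 1 \<Longrightarrow> weight_ge E t \<le> 2 * n"
  using weight_ge_antimono weight_ge_1 by metis

lemma weight_ge_eq_0: "E \<in> trees n \<Longrightarrow> t > n \<Longrightarrow> weight_ge E t = 0"
proof -
  assume E: "E \<in> trees n" and t: "t > n"
  have "{v. v \<in> \<Union>E \<and> t \<le> degree_of E v} = {}" using degree_le[OF E] t by (auto simp: not_le intro: le_less_trans)
  then show ?thesis unfolding weight_ge_def by (metis sum.empty)
qed

lemma weight_ge_max: "E \<in> trees n \<Longrightarrow> t \<le> kth_degree 1 E \<Longrightarrow> weight_ge E t \<ge> kth_degree 1 E"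
proof -
  assume E: "E \<in> trees n" and t: "t \<le> kth_degree 1 E"
  obtain v where v: "v \<in> {1..n + 1}" "degree_of E v = kth_degree 1 E" using max_degree_attained[OF E] by metis
  then have "(\<Sum>v\<in>{v}. degree_of E v) \<le> weight_ge E t"
    unfolding weight_ge_def using t by (intro sum_mono2) (auto simp: Union_tree[OF E] simp del: Union_iff)
  then show ?thesis using v by simp
qed

text \<open>One vertex carries M_1 and the other \<open>num_ge E t - 1\<close> counted vertices
  carry at most M_2 each; the statement is additive to avoid subtraction of naturals.\<close>

lemma weight_ge_le_kth:
  assumes E: "E \<in> trees n" and t: "kth_degree 2 E < kth_degree 1 E" "t \<le> kth_degree 1 E"
  shows "weight_ge E t + kth_degree 2 E \<le> kth_degree 1 E + num_ge E t * kth_degree 2 E"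
proof -
  have n: "n \<ge> 1" using trees_pos E by auto
  obtain v where v: "v \<in> {1..n + 1}" "degree_of E v = kth_degree 1 E" using max_degree_attained[OF E] by metis
  have other: "degree_of E u \<le> kth_degree 2 E" if "u \<in> {1..n + 1}" "u \<noteq> v" for u
  proof -
    have "{u, v} \<subseteq> {w \<in> \<Union>E. degree_of E u \<le> degree_of E w}"
      using that v degree_le_max[OF E, of u] by (auto simp: Union_tree[OF E] simp del: Union_iff)
    then have "card {u, v} \<le> num_ge E (degree_of E u)"
      unfolding num_ge_def by (intro card_mono) (auto simp: Union_tree[OF E] simp del: Union_iff)
    then show ?thesis using le_kth_degree_iff[OF E, of 2 "degree_of E u"] that n by simp
  qed
  define S where "S = {w. w \<in> \<Union>E \<and> t \<le> degree_of E w}"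
  have S: "finite S" "v \<in> S" using v t by (auto simp: S_def Union_tree[OF E] simp del: Union_iff)
  have "weight_ge E t = degree_of E v + (\<Sum>w\<in>S - {v}. degree_of E w)"
    unfolding weight_ge_def S_def[symmetric] using S by (intro sum.remove)
  also have "(\<Sum>w\<in>S - {v}. degree_of E w) \<le> (\<Sum>w\<in>S - {v}. kth_degree 2 E)"
    by (intro sum_mono other) (auto simp: S_def Union_tree[OF E] simp del: Union_iff)
  also have "\<dots> = (num_ge E t - 1) * kth_degree 2 E"
    using S by (simp add: num_ge_def S_def)
  finally have "weight_ge E t \<le> kth_degree 1 E + (num_ge E t - 1) * kth_degree 2 E" using v by simp
  moreover have "card S > 0" using S by (auto simp: card_gt_0_iff)
  then have "num_ge E t \<ge> 1" unfolding num_ge_def S_def[symmetric] by simp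
  then obtain m where "num_ge E t = Suc m" by (cases "num_ge E t") auto
  ultimately show ?thesis by simp
qed

section \<open>The law of the tree process\<close>

context prob_space
begin

lemma event_of_measurable:
  assumes "Z \<in> M \<rightarrow>\<^sub>M count_space UNIV"
  shows "{w \<in> space M. R (Z w)} \<in> events"
proof -
  have "{w \<in> space M. R (Z w)} = Z -` {z. R z} \<inter> space M" by auto
  then show ?thesis using measurable_sets[OF assms, of "{z. R z}"] by simp
qed

text \<open>Integrates the conditional probability over \<open>A\<close>. The hypotheses of the
  model only enter through this elementary form, on atoms of the tree and of the candidates.\<close>

lemma prob_cond_const:
  assumes G: "subalgebra M G" and A: "A \<in> sets G" and Q: "{w \<in> space M. Q w} \<in> events"
    and c: "AE w in M. w \<in> A \<longrightarrow> cond_prob_given M G Q w = c"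
  shows "measure M {w \<in> A. Q w} = c * measure M A"
proof -
  interpret G: finite_measure_subalgebra M G by unfold_locales (rule G)
  have AM: "A \<in> events" using A G by (auto simp: subalgebra_def)
  then have AS: "A \<subseteq> space M" by (rule sets.sets_into_space)
  have "(\<integral>w\<in>A. indicator {w \<in> space M. Q w} w \<partial>M) = (\<integral>w\<in>A. cond_prob_given M G Q w \<partial>M :: real)"
    unfolding cond_prob_given_def using Q A by (intro G.real_cond_exp_intA) (auto simp: emeasure_eq_measure)
  also have "\<dots> = (\<integral>w\<in>A. c \<partial>M)"
    unfolding set_lebesgue_integral_def
  proof (rule integral_cong_AE)
    show "AE w in M. indicator A w *\<^sub>R cond_prob_given M G Q w = indicator A w *\<^sub>R c"
      using c by eventually_elim (auto simp: indicator_def)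
    have [measurable]: "cond_prob_given M G Q \<in> borel_measurable M"
      unfolding cond_prob_given_def by measurable
    show "(\<lambda>w. indicator A w *\<^sub>R cond_prob_given M G Q w) \<in> borel_measurable M" using AM by measurable
    show "(\<lambda>w. indicator A w *\<^sub>R c) \<in> borel_measurable M" using AM by measurable
  qed
  also have "\<dots> = c * measure M A"
    using AM by (simp add: set_lebesgue_integral_def emeasure_eq_measure)
  also have "(\<integral>w\<in>A. indicator {w \<in> space M. Q w} w \<partial>M) = (\<integral>w. indicator {w \<in> A. Q w} w \<partial>M :: real)"
    unfolding set_lebesgue_integral_def using AS by (intro Bochner_Integration.integral_cong) (auto simp: indicator_def)
  also have "\<dots> = measure M {w \<in> A. Q w}"
  proof -
    have "{w \<in> A. Q w} = A \<inter> {w \<in> space M. Q w}" using AS by auto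
    then have "{w \<in> A. Q w} \<in> events" using AM Q by (metis sets.Int)
    then show ?thesis by (simp add: emeasure_eq_measure)
  qed
  finally show ?thesis .
qed

end

context max_choice_pa
begin

definition law :: "nat \<Rightarrow> nat set set \<Rightarrow> real" where
  "law n E = \<P>(w in M. pa_tree Y n w = E)"

definition joint :: "nat \<Rightarrow> nat set set \<Rightarrow> nat \<Rightarrow> real" where
  "joint n E y = \<P>(w in M. pa_tree Y n w = E \<and> Y n w = y)"

lemma pa_tree_Suc: "n \<ge> 1 \<Longrightarrow> pa_tree Y (Suc n) w = insert {n + 2, Y n w} (pa_tree Y n w)"
  by (cases n) (auto simp: pa_tree_def)

lemma pa_tree_measurable: "pa_tree Y n \<in> M \<rightarrow>\<^sub>M count_space UNIV"
proof (induction n)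
  case 0
  have "pa_tree Y 0 = (\<lambda>w. {})" by (auto simp: pa_tree_def)
  then show ?case by simp
next
  case (Suc n)
  show ?case
  proof (cases "n = 0")
    case True
    have "pa_tree Y 1 = (\<lambda>w. {{1, 2}})" by (auto simp: pa_tree_def)
    then show ?thesis using True by simp
  next
    case False
    then have eq: "pa_tree Y (Suc n) = (\<lambda>w. insert {n + 2, Y n w} (pa_tree Y n w))"
      using pa_tree_Suc by auto
    \<comment> \<open>Pairing with a value in the uncountable discrete space
      \<open>nat set set\<close> is avoided: the value of \<open>Y n\<close>, of which there are
      countably many, is fixed first.\<close>
    have "(\<lambda>w. (\<lambda>E. insert {n + 2, y} E) (pa_tree Y n w)) \<in> M \<rightarrow>\<^sub>M count_space UNIV" for y
      by (rule measurable_compose[OF Suc]) simp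
    moreover have "Y n \<in> M \<rightarrow>\<^sub>M count_space UNIV" using Y_measurable False by simp
    ultimately show ?thesis unfolding eq
      by (rule measurable_compose_countable[of "\<lambda>y w. insert {n + 2, y} (pa_tree Y n w)"])
  qed
qed

lemma tree_event: "{w \<in> space M. R (pa_tree Y n w)} \<in> events"
  by (rule event_of_measurable[OF pa_tree_measurable])

lemma Y_event: "n \<ge> 1 \<Longrightarrow> {w \<in> space M. R (Y n w)} \<in> events"
  by (rule event_of_measurable[OF Y_measurable])

lemma X_event: "n \<ge> 1 \<Longrightarrow> {w \<in> space M. \<forall>j\<in>{1..d}. X n j w = x j} \<in> events"
proof -
  assume n: "n \<ge> 1"
  have "{w \<in> space M. X n j w = x j} \<in> events" if "j \<in> {1..d}" for j
    by (rule event_of_measurable[OF X_measurable[OF n that]])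
  then show ?thesis by (intro sets.sets_Collect_finite_All) auto
qed

lemma subalgebra_edge_sigma: "subalgebra M (edge_sigma M Y n)"
proof -
  have "(\<Union>m\<in>{1..n}. rv_events M (pa_tree Y m)) \<subseteq> events"
    using measurable_sets[OF pa_tree_measurable] by (auto simp: rv_events_def)
  then show ?thesis
    unfolding subalgebra_def edge_sigma_def
    by (auto simp: sets_measure_of_conv space_measure_of_conv intro!: sets.sigma_sets_subset)
qed

lemma subalgebra_choice_sigma:
  assumes "n \<ge> 1"
  shows "subalgebra M (choice_sigma M d X Y n)"
proof -
  have "rv_events M (X n j) \<subseteq> events" if "j \<in> {1..d}" for j
    using measurable_sets[OF X_measurable[OF assms that]] by (auto simp: rv_events_def)
  moreover have "(\<Union>m\<in>{1..n}. rv_events M (pa_tree Y m)) \<subseteq> events"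
    using measurable_sets[OF pa_tree_measurable] by (auto simp: rv_events_def)
  ultimately have "(\<Union>m\<in>{1..n}. rv_events M (pa_tree Y m)) \<union> (\<Union>j\<in>{1..d}. rv_events M (X n j)) \<subseteq> events"
    by blast
  then show ?thesis
    unfolding subalgebra_def choice_sigma_def
    by (auto simp: sets_measure_of_conv space_measure_of_conv intro!: sets.sigma_sets_subset)
qed

lemma level_set_in_rv_events: "{w \<in> space M. Z w = z} \<in> rv_events M Z"
  unfolding rv_events_def by (rule CollectI, rule exI[of _ "{z}"]) auto

lemma rv_events_Pow: "rv_events M Z \<subseteq> Pow (space M)"
  by (auto simp: rv_events_def)

lemma tree_in_edge_sigma:
  assumes "n \<ge> 1"
  shows "{w \<in> space M. pa_tree Y n w = E} \<in> sets (edge_sigma M Y n)"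
proof -
  have "{w \<in> space M. pa_tree Y n w = E} \<in> (\<Union>m\<in>{1..n}. rv_events M (pa_tree Y m))"
    using assms level_set_in_rv_events[of "pa_tree Y n"] by (intro UN_I[of n]) auto
  moreover have "(\<Union>m\<in>{1..n}. rv_events M (pa_tree Y m)) \<subseteq> Pow (space M)"
    by (intro UN_least rv_events_Pow)
  ultimately show ?thesis unfolding edge_sigma_def by (simp add: sets_measure_of sigma_sets.Basic)
qed

lemma choice_in_choice_sigma:
  assumes "n \<ge> 1"
  shows "{w \<in> space M. pa_tree Y n w = E \<and> (\<forall>j\<in>{1..d}. X n j w = x j)} \<in> sets (choice_sigma M d X Y n)"
proof -
  let ?S = "(\<Union>m\<in>{1..n}. rv_events M (pa_tree Y m)) \<union> (\<Union>j\<in>{1..d}. rv_events M (X n j))"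
  have pow: "?S \<subseteq> Pow (space M)" by (intro Un_least UN_least rv_events_Pow)
  have sp: "space (choice_sigma M d X Y n) = space M"
    unfolding choice_sigma_def by (simp add: space_measure_of_conv)
  have basic: "B \<in> sets (choice_sigma M d X Y n)" if "B \<in> ?S" for B
    using that pow unfolding choice_sigma_def by (simp add: sets_measure_of sigma_sets.Basic)
  have 1: "{w \<in> space M. pa_tree Y n w = E} \<in> sets (choice_sigma M d X Y n)"
    using assms level_set_in_rv_events[of "pa_tree Y n"] by (intro basic UnI1 UN_I[of n]) auto
  have 2: "{w \<in> space M. X n j w = x j} \<in> sets (choice_sigma M d X Y n)" if "j \<in> {1..d}" for j
    using that level_set_in_rv_events[of "X n j"] by (intro basic UnI2 UN_I[of j]) auto
  show ?thesis
    using 1 2 unfolding sp[symmetric]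
    by (intro sets.sets_Collect_conj sets.sets_Collect_finite_All) auto
qed

text \<open>On the event that the tree is \<open>E\<close>, the conditional law of the candidate
  vector is a constant product.\<close>

lemma prob_choices:
  assumes n: "n \<ge> 1"
  shows "\<P>(w in M. pa_tree Y n w = E \<and> (\<forall>j\<in>{1..d}. X n j w = x j)) =
    law n E * (\<Prod>j\<in>{1..d}. real (degree_of E (x j)) / (2 * real n))"
proof -
  let ?A = "{w \<in> space M. pa_tree Y n w = E}"
  have "AE w in M. \<forall>j\<in>{1..d}. cond_prob_given M (edge_sigma M Y n) (\<lambda>w. X n j w = x j) w
        = real (degree_of (pa_tree Y n w) (x j)) / (2 * real n)"
    using X_law[OF n] by (subst AE_finite_all[OF finite_atLeastAtMost]) blast
  then have ae: "AE w in M. w \<in> ?A \<longrightarrow> cond_prob_given M (edge_sigma M Y n) (\<lambda>w. \<forall>j\<in>{1..d}. X n j w = x j) w =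
     (\<Prod>j\<in>{1..d}. real (degree_of E (x j)) / (2 * real n))"
    using X_cond_indep[OF n, of x] by eventually_elim (auto intro!: prod.cong)
  have "measure M {w \<in> ?A. \<forall>j\<in>{1..d}. X n j w = x j} = 
     (\<Prod>j\<in>{1..d}. real (degree_of E (x j)) / (2 * real n)) * measure M ?A"
    by (rule prob_cond_const[OF subalgebra_edge_sigma tree_in_edge_sigma[OF n] X_event[OF n] ae])
  then show ?thesis by (simp add: law_def mult.commute conj_assoc)
qed

lemma prob_choices_Y:
  assumes n: "n \<ge> 1"
  defines "T \<equiv> (\<lambda>E x. max_degree_among E (x ` {1..d}))"
  shows "\<P>(w in M. (pa_tree Y n w = E \<and> (\<forall>j\<in>{1..d}. X n j w = x j)) \<and> Y n w = v) =
    (if v \<in> T E x then 1 / real (card (T E x)) else 0) * \<P>(w in M. pa_tree Y n w = E \<and> (\<forall>j\<in>{1..d}. X n j w = x j))"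
proof -
  let ?A = "{w \<in> space M. pa_tree Y n w = E \<and> (\<forall>j\<in>{1..d}. X n j w = x j)}"
  have "(\<lambda>j. X n j w) ` {1..d} = x ` {1..d}" if "w \<in> ?A" for w
    using that by (intro image_cong) auto
  then have "AE w in M. w \<in> ?A \<longrightarrow> cond_prob_given M (choice_sigma M d X Y n) (\<lambda>w. Y n w = v) w =
     (if v \<in> T E x then 1 / real (card (T E x)) else 0)"
    using Y_law[OF n, of v] unfolding Let_def T_def by eventually_elim simp
  then have "measure M {w \<in> ?A. Y n w = v} = (if v \<in> T E x then 1 / real (card (T E x)) else 0) * measure M ?A"
    by (rule prob_cond_const[OF subalgebra_choice_sigma[OF n] choice_in_choice_sigma[OF n] Y_event[OF n]])
  then show ?thesis by (simp add: conj_assoc)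
qed

definition choices :: "nat \<Rightarrow> nat set set \<Rightarrow> (nat \<Rightarrow> nat) \<Rightarrow> 'w \<Rightarrow> bool" where
  "choices n E x w \<longleftrightarrow> pa_tree Y n w = E \<and> (\<forall>j\<in>{1..d}. X n j w = x j)"

lemma choices_event: "n \<ge> 1 \<Longrightarrow> {w \<in> space M. choices n E x w} \<in> events"
  unfolding choices_def by (intro sets.sets_Collect_conj tree_event X_event)

lemma ex1_choices:
  assumes "pa_tree Y n w = E" "\<forall>j\<in>{1..d}. X n j w \<in> B"
  shows "\<exists>!x. x \<in> PiE {1..d} (\<lambda>_. B) \<and> choices n E x w"
proof (rule ex1I[of _ "restrict (\<lambda>j. X n j w) {1..d}"])
  have "restrict (\<lambda>j. X n j w) {1..d} \<in> PiE {1..d} (\<lambda>_. B)"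
    unfolding restrict_PiE_iff using assms(2) by blast
  moreover have "choices n E (restrict (\<lambda>j. X n j w) {1..d}) w"
    unfolding choices_def using assms(1) by simp
  ultimately show "restrict (\<lambda>j. X n j w) {1..d} \<in> PiE {1..d} (\<lambda>_. B) \<and> choices n E (restrict (\<lambda>j. X n j w) {1..d}) w"
    by blast
next
  fix x assume x: "x \<in> PiE {1..d} (\<lambda>_. B) \<and> choices n E x w"
  show "x = restrict (\<lambda>j. X n j w) {1..d}"
  proof (rule ext)
    fix j
    show "x j = restrict (\<lambda>j. X n j w) {1..d} j"
    proof (cases "j \<in> {1..d}")
      case True
      then show ?thesis using x unfolding choices_def by simp
    next
      case False
      show ?thesis using PiE_arb[OF conjunct1[OF x] False] False by (auto simp: restrict_def)
    qed
  qed
qed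

text \<open>Distributivity turns the sum of products over all \<open>d\<close>-tuples from
  \<open>B\<close> into the \<open>d\<close>-th power of the mass of \<open>B\<close>. It is applied
  to all vertices and to the vertices below a threshold.\<close>

lemma sum_prob_choices:
  assumes n: "n \<ge> 1" and B: "finite B"
  shows "(\<Sum>x\<in>PiE {1..d} (\<lambda>_. B). \<P>(w in M. choices n E x w)) = 
    law n E * (real (\<Sum>v\<in>B. degree_of E v) / (2 * real n)) ^ d"
proof -
  have "(\<Sum>x\<in>PiE {1..d} (\<lambda>_. B). \<P>(w in M. choices n E x w)) = 
     law n E * (\<Sum>x\<in>PiE {1..d} (\<lambda>_. B). \<Prod>j\<in>{1..d}. real (degree_of E (x j)) / (2 * real n))"
    unfolding choices_def prob_choices[OF n] sum_distrib_left ..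
  also have "(\<Sum>x\<in>PiE {1..d} (\<lambda>_. B). \<Prod>j\<in>{1..d}. real (degree_of E (x j)) / (2 * real n)) =
      (\<Prod>j\<in>{1..d}. \<Sum>v\<in>B. real (degree_of E v) / (2 * real n))"
    using B by (intro prod_sum_PiE[symmetric]) auto
  also have "\<dots> = (real (\<Sum>v\<in>B. degree_of E v) / (2 * real n)) ^ d"
    by (simp add: sum_divide_distrib)
  finally show ?thesis .
qed

text \<open>The candidates are arbitrary naturals a priori. The degrees sum to \<open>2 * n\<close>,
  so the tuples of vertices already carry the whole probability of the tree.\<close>

lemma AE_choices_vertices:
  assumes E: "E \<in> trees n"
  shows "AE w in M. pa_tree Y n w = E \<longrightarrow> (\<forall>j\<in>{1..d}. X n j w \<in> {1..n + 1})"
proof -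
  have n: "n \<ge> 1" using trees_pos[OF E] .
  let ?Q = "\<lambda>w. pa_tree Y n w = E \<and> (\<forall>j\<in>{1..d}. X n j w \<in> {1..n + 1})"
  have Xe: "{w \<in> space M. X n j w \<in> {1..n + 1}} \<in> events" if "j \<in> {1..d}" for j
    by (rule event_of_measurable[OF X_measurable[OF n that]])
  have Q: "{w \<in> space M. ?Q w} \<in> events"
    by (intro sets.sets_Collect_conj tree_event sets.sets_Collect_finite_All[OF Xe] finite_atLeastAtMost)
  have "\<P>(w in M. ?Q w) = (\<Sum>x\<in>PiE {1..d} (\<lambda>_. {1..n + 1}). \<P>(w in M. choices n E x w))"
  proof (rule prob_sum[OF _ choices_event[OF n] Q])
    show "finite (PiE {1..d} (\<lambda>_. {1..n + 1}))" by (intro finite_PiE) auto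
    show "AE w in M. (\<forall>x\<in>PiE {1..d} (\<lambda>_. {1..n + 1}). choices n E x w \<longrightarrow> ?Q w) \<and>
        (?Q w \<longrightarrow> (\<exists>!x\<in>PiE {1..d} (\<lambda>_. {1..n + 1}). choices n E x w))"
    proof (rule AE_I2, intro conjI impI ballI)
      fix w x assume x: "x \<in> PiE {1..d} (\<lambda>_. {1..n + 1})" "choices n E x w"
      show "pa_tree Y n w = E" using x(2) by (simp add: choices_def)
      fix j assume j: "j \<in> {1..d}"
      show "X n j w \<in> {1..n + 1}" using PiE_mem[OF x(1) j] x(2) j by (simp add: choices_def)
    next
      fix w assume "?Q w"
      then show "\<exists>!x\<in>PiE {1..d} (\<lambda>_. {1..n + 1}). choices n E x w" 
        by (elim conjE) (rule ex1_choices)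
    qed
  qed
  also have "\<dots> = law n E"
    unfolding sum_prob_choices[OF n finite_atLeastAtMost] sum_degrees[OF E] using n by simp
  finally have eq: "\<P>(w in M. ?Q w) = law n E" .
  define A where "A = {w \<in> space M. pa_tree Y n w = E}"
  define B where "B = {w \<in> space M. ?Q w}"
  have AB: "A \<in> events" "B \<in> events" "B \<subseteq> A" "measure M B = measure M A"
  proof -
    show "A \<in> events" unfolding A_def by (rule tree_event)
    show "B \<in> events" unfolding B_def by (rule Q)
    show "B \<subseteq> A" unfolding A_def B_def by blast
    show "measure M B = measure M A" using eq unfolding A_def B_def law_def .
  qed
  have "measure M (A - B) = 0" using finite_measure_Diff[OF AB(1,2,3)] AB(4) by simp
  then have "emeasure M (A - B) = 0" by (simp add: emeasure_eq_measure)
  then have "A - B \<in> null_sets M" using AB by (intro null_setsI) auto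
  then have "AE w in M. w \<notin> A - B" by (rule AE_not_in)
  then show ?thesis using AE_space unfolding A_def B_def
    by eventually_elim blast
qed

text \<open>The set \<open>T\<close> of candidates of largest degree lies entirely above the
  threshold or entirely below it, so the fraction \<open>card (S \<inter> T) / card T\<close> coming
  from the tie-breaking is 1 or 0.\<close>

lemma prob_choices_Y_in:
  assumes E: "E \<in> trees n" and x: "x \<in> PiE {1..d} (\<lambda>_. {1..n + 1})" and d: "d \<ge> 1"
  shows "\<P>(w in M. choices n E x w \<and> Y n w \<in> {v \<in> {1..n + 1}. t \<le> degree_of E v}) =
    (if \<exists>j\<in>{1..d}. t \<le> degree_of E (x j) then \<P>(w in M. choices n E x w) else 0)"
proof -
  have n: "n \<ge> 1" using trees_pos[OF E] .
  define S where "S = {v \<in> {1..n + 1}. t \<le> degree_of E v}"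
  define T where "T = max_degree_among E (x ` {1..d})"
  have T: "finite T" "T \<noteq> {}" "T \<subseteq> {1..n + 1}"
  proof -
    show "finite T" by (simp add: T_def max_degree_among_def)
    obtain v where v: "v \<in> x ` {1..d}" "\<And>u. u \<in> x ` {1..d} \<Longrightarrow> degree_of E u \<le> degree_of E v"
    proof -
      have "degree_of E ` x ` {1..d} \<noteq> {}" using d by auto
      then have "Max (degree_of E ` x ` {1..d}) \<in> degree_of E ` x ` {1..d}" by (intro Max_in) auto
      then obtain v where v: "Max (degree_of E ` x ` {1..d}) = degree_of E v" "v \<in> x ` {1..d}" by (rule imageE)
      show ?thesis
      proof (rule that[OF v(2)])
        fix u assume "u \<in> x ` {1..d}"
        then show "degree_of E u \<le> degree_of E v" unfolding v(1)[symmetric] by (intro Max_ge) simp_all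
      qed
    qed
    have "v \<in> T" unfolding T_def max_degree_among_def using v by blast
    then show "T \<noteq> {}" by blast
    have "x ` {1..d} \<subseteq> {1..n + 1}" using PiE_mem[OF x] by blast
    then show "T \<subseteq> {1..n + 1}" unfolding T_def max_degree_among_def by blast
  qed
  have "\<P>(w in M. choices n E x w \<and> Y n w \<in> S) = (\<Sum>v\<in>S. \<P>(w in M. choices n E x w \<and> Y n w = v))"
    using n by (intro prob_sum sets.sets_Collect_conj choices_event Y_event) (auto simp: S_def)
  also have "\<dots> = (\<Sum>v\<in>S. (if v \<in> T then 1 / real (card T) else 0) * \<P>(w in M. choices n E x w))"
    unfolding choices_def T_def prob_choices_Y[OF n] ..
  also have "\<dots> = (\<Sum>v\<in>S. if v \<in> T then 1 / real (card T) else 0) * \<P>(w in M. choices n E x w)"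
    by (simp add: sum_distrib_right)
  also have "(\<Sum>v\<in>S. if v \<in> T then 1 / real (card T) else 0) = real (card (S \<inter> T)) / real (card T)"
    by (simp add: sum.inter_restrict[symmetric] S_def)
  also have "real (card (S \<inter> T)) / real (card T) = (if \<exists>j\<in>{1..d}. t \<le> degree_of E (x j) then 1 else 0)"
  proof (cases "\<exists>j\<in>{1..d}. t \<le> degree_of E (x j)")
    case True
    then obtain j where j: "j \<in> {1..d}" "t \<le> degree_of E (x j)" by blast
    have "T \<subseteq> S"
    proof
      fix v assume v: "v \<in> T"
      then have "degree_of E (x j) \<le> degree_of E v"
        unfolding T_def max_degree_among_def using j(1) by blast
      then show "v \<in> S" using T(3) v j(2) unfolding S_def by fastforce
    qed
    then have "S \<inter> T = T" by blast
    moreover have "card T > 0" using T by (simp add: card_gt_0_iff)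
    ultimately show ?thesis using True by simp
  next
    case False
    have "v \<notin> S" if "v \<in> T" for v
    proof -
      have "v \<in> x ` {1..d}" using that unfolding T_def max_degree_among_def by blast
      then show ?thesis using False unfolding S_def by blast
    qed
    then have "S \<inter> T = {}" by blast
    then show ?thesis using False by (simp only: if_False card.empty of_nat_0 div_0)
  qed
  finally show ?thesis unfolding S_def by simp
qed

text \<open>Complementary event: the chosen vertex is below the threshold exactly when all
  \<open>d\<close> candidates are.\<close>

lemma sum_joint_ge:
  assumes E: "E \<in> trees n" and d: "d \<ge> 1"
  shows "(\<Sum>y\<in>{v \<in> {1..n + 1}. t \<le> degree_of E v}. joint n E y) = 
     law n E * (1 - (1 - real (weight_ge E t) / (2 * real n)) ^ d)"
proof -
  have n: "n \<ge> 1" using trees_pos[OF E] .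
  define S where "S = {v \<in> {1..n + 1}. t \<le> degree_of E v}"
  let ?P = "PiE {1..d} (\<lambda>_. {1..n + 1})"
  let ?N = "PiE {1..d} (\<lambda>_. {1..n + 1} - S)"
  have "(\<Sum>y\<in>S. joint n E y) = \<P>(w in M. pa_tree Y n w = E \<and> Y n w \<in> S)"
    unfolding joint_def using n
    by (intro prob_sum[symmetric] sets.sets_Collect_conj tree_event Y_event) (auto simp: S_def)
  also have "\<dots> = (\<Sum>x\<in>?P. \<P>(w in M. choices n E x w \<and> Y n w \<in> S))"
  proof (intro prob_sum sets.sets_Collect_conj tree_event Y_event choices_event n)
    show "finite ?P" by (intro finite_PiE) auto
    show "AE w in M. (\<forall>x\<in>?P. choices n E x w \<and> Y n w \<in> S \<longrightarrow> pa_tree Y n w = E \<and> Y n w \<in> S) \<and>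
        (pa_tree Y n w = E \<and> Y n w \<in> S \<longrightarrow> (\<exists>!x\<in>?P. choices n E x w \<and> Y n w \<in> S))"
      using AE_choices_vertices[OF E]
    proof eventually_elim
      case (elim w)
      have "\<exists>!x\<in>?P. choices n E x w" if "pa_tree Y n w = E"
        by (rule ex1_choices[OF that]) (use elim that in blast)
      moreover have "pa_tree Y n w = E" if "choices n E x w" for x
        using that by (simp only: choices_def)
      ultimately show ?case by blast
    qed
  qed
  also have "\<dots> = (\<Sum>x\<in>?P. if \<exists>j\<in>{1..d}. t \<le> degree_of E (x j) then \<P>(w in M. choices n E x w) else 0)"
    unfolding S_def using prob_choices_Y_in[OF E _ d] by (intro sum.cong) auto
  also have "\<dots> = (\<Sum>x\<in>?P. \<P>(w in M. choices n E x w) - (if x \<in> ?N then \<P>(w in M. choices n E x w) else 0))"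
  proof (intro sum.cong refl)
    fix x assume x: "x \<in> ?P"
    have "x \<in> ?N \<longleftrightarrow> \<not> (\<exists>j\<in>{1..d}. t \<le> degree_of E (x j))"
      using x by (auto simp: PiE_iff S_def)
    then show "(if \<exists>j\<in>{1..d}. t \<le> degree_of E (x j) then \<P>(w in M. choices n E x w) else 0) =
       \<P>(w in M. choices n E x w) - (if x \<in> ?N then \<P>(w in M. choices n E x w) else 0)" by auto
  qed
  also have "\<dots> = (\<Sum>x\<in>?P. \<P>(w in M. choices n E x w)) - (\<Sum>x\<in>?P \<inter> ?N. \<P>(w in M. choices n E x w))"
    unfolding sum_subtractf by (subst sum.inter_restrict) (auto intro!: finite_PiE)
  also have "?P \<inter> ?N = ?N" by (auto simp: PiE_iff)
  also have "(\<Sum>x\<in>?P. \<P>(w in M. choices n E x w)) = law n E"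
    unfolding sum_prob_choices[OF n finite_atLeastAtMost] sum_degrees[OF E] using n by simp
  also have "(\<Sum>x\<in>?N. \<P>(w in M. choices n E x w)) = 
      law n E * (real (\<Sum>v\<in>{1..n + 1} - S. degree_of E v) / (2 * real n)) ^ d"
    by (rule sum_prob_choices[OF n]) auto
  also have "real (\<Sum>v\<in>{1..n + 1} - S. degree_of E v) / (2 * real n) = 1 - real (weight_ge E t) / (2 * real n)"
  proof -
    have "weight_ge E t = (\<Sum>v\<in>S. degree_of E v)"
      unfolding weight_ge_def S_def Union_tree[OF E] ..
    moreover have "(\<Sum>v\<in>{1..n + 1}. degree_of E v) = (\<Sum>v\<in>{1..n + 1} - S. degree_of E v) + (\<Sum>v\<in>S. degree_of E v)"
      by (rule sum.subset_diff) (auto simp: S_def)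
    ultimately have "(\<Sum>v\<in>{1..n + 1} - S. degree_of E v) + weight_ge E t = 2 * n"
      unfolding sum_degrees[OF E] by linarith
    then have "real (\<Sum>v\<in>{1..n + 1} - S. degree_of E v) = 2 * real n - real (weight_ge E t)"
      by linarith
    then show ?thesis using n by (simp add: diff_divide_distrib)
  qed
  finally show ?thesis unfolding S_def by (simp add: algebra_simps)
qed

lemma joint_nonneg: "joint n E y \<ge> 0" and law_nonneg: "law n E \<ge> 0"
  by (auto simp: joint_def law_def)

lemma sum_joint: 
  assumes E: "E \<in> trees n" and d: "d \<ge> 1"
  shows "(\<Sum>y\<in>{1..n + 1}. joint n E y) = law n E"
proof -
  have n: "n \<ge> 1" using trees_pos[OF E] .
  have "{v \<in> {1..n + 1}. 1 \<le> degree_of E v} = {1..n + 1}" using degree_pos[OF E] by blast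
  then have "(\<Sum>y\<in>{1..n + 1}. joint n E y) = law n E * (1 - (1 - real (2 * n) / (2 * real n)) ^ d)"
    using sum_joint_ge[OF E d, of 1] unfolding weight_ge_1[OF E] by (simp only:)
  also have "1 - real (2 * n) / (2 * real n) = 0" using n by simp
  finally show ?thesis using d by (simp add: power_0_left)
qed

lemma joint_event: "n \<ge> 1 \<Longrightarrow> {w \<in> space M. pa_tree Y n w = E \<and> Y n w = y} \<in> events"
  by (intro sets.sets_Collect_conj tree_event Y_event)

text \<open>\<open>total\<close> is a hypothesis because it is proved by induction from the very
  step formula that depends on it; \<open>sum_law\<close> closes the circle.\<close>

lemma AE_tree_vertex:
  assumes n: "n \<ge> 1" and total: "(\<Sum>E\<in>trees n. law n E) = 1" and d: "d \<ge> 1"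
  shows "AE w in M. pa_tree Y n w \<in> trees n \<and> Y n w \<in> {1..n + 1}"
proof -
  let ?Q = "\<lambda>w. pa_tree Y n w \<in> trees n \<and> Y n w \<in> {1..n + 1}"
  have Q: "{w \<in> space M. ?Q w} \<in> events"
    using n by (intro sets.sets_Collect_conj tree_event Y_event)
  have "\<P>(w in M. ?Q w) = (\<Sum>z\<in>trees n \<times> {1..n + 1}. \<P>(w in M. pa_tree Y n w = fst z \<and> Y n w = snd z))"
  proof (rule prob_sum[OF _ joint_event[OF n] Q])
    have "\<exists>!z\<in>trees n \<times> {1..n + 1}. pa_tree Y n w = fst z \<and> Y n w = snd z" if "?Q w" for w
      by (rule ex1I[of _ "(pa_tree Y n w, Y n w)"]) (use that in \<open>simp_all add: prod_eq_iff\<close>)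
    then show "AE w in M. (\<forall>z\<in>trees n \<times> {1..n + 1}. pa_tree Y n w = fst z \<and> Y n w = snd z \<longrightarrow> ?Q w) \<and>
       (?Q w \<longrightarrow> (\<exists>!z\<in>trees n \<times> {1..n + 1}. pa_tree Y n w = fst z \<and> Y n w = snd z))"
      by (intro AE_I2 conjI ballI impI) (simp_all add: mem_Times_iff)
  qed simp
  also have "\<dots> = (\<Sum>E\<in>trees n. \<Sum>y\<in>{1..n + 1}. joint n E y)"
    unfolding joint_def sum.cartesian_product by (simp add: case_prod_unfold)
  also have "\<dots> = (\<Sum>E\<in>trees n. law n E)" by (intro sum.cong refl sum_joint d)
  also have "\<dots> = 1" by (rule total)
  finally have "\<P>(w in M. ?Q w) = 1" .
  then show ?thesis using prob_Collect_eq_1[OF Q] by blast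
qed

text \<open>The expectation of \<open>\<phi>\<close> at the random tree, as a finite sum that needs
  no integrability.\<close>

definition tree_mean :: "nat \<Rightarrow> (nat set set \<Rightarrow> real) \<Rightarrow> real" where
  "tree_mean n \<phi> = (\<Sum>E\<in>trees n. law n E * \<phi> E)"

lemma law_Suc:
  assumes n: "n \<ge> 1" and total: "(\<Sum>E\<in>trees n. law n E) = 1" and d: "d \<ge> 1"
  shows "law (Suc n) F = (\<Sum>E\<in>trees n. \<Sum>y\<in>{1..n + 1}. joint n E y * of_bool (insert {n + 2, y} E = F))"
proof -
  have "law (Suc n) F = (\<Sum>z\<in>trees n \<times> {1..n + 1}. 
      \<P>(w in M. (pa_tree Y n w = fst z \<and> Y n w = snd z) \<and> pa_tree Y (Suc n) w = F))"
    unfolding law_def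
  proof (rule prob_sum)
    show "AE w in M. (\<forall>z\<in>trees n \<times> {1..n + 1}. (pa_tree Y n w = fst z \<and> Y n w = snd z) \<and> pa_tree Y (Suc n) w = F \<longrightarrow> pa_tree Y (Suc n) w = F) \<and>
       (pa_tree Y (Suc n) w = F \<longrightarrow> (\<exists>!z\<in>trees n \<times> {1..n + 1}. (pa_tree Y n w = fst z \<and> Y n w = snd z) \<and> pa_tree Y (Suc n) w = F))"
      using AE_tree_vertex[OF assms]
    proof eventually_elim
      case (elim w)
      have "\<exists>!z\<in>trees n \<times> {1..n + 1}. (pa_tree Y n w = fst z \<and> Y n w = snd z) \<and> pa_tree Y (Suc n) w = F"
        if F: "pa_tree Y (Suc n) w = F"
      proof (rule ex1I[of _ "(pa_tree Y n w, Y n w)"])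
        show "(pa_tree Y n w, Y n w) \<in> trees n \<times> {1..n + 1} \<and>
            (pa_tree Y n w = fst (pa_tree Y n w, Y n w) \<and> Y n w = snd (pa_tree Y n w, Y n w)) \<and> pa_tree Y (Suc n) w = F"
          using elim F by simp
      next
        fix z assume "z \<in> trees n \<times> {1..n + 1} \<and> (pa_tree Y n w = fst z \<and> Y n w = snd z) \<and> pa_tree Y (Suc n) w = F"
        then show "z = (pa_tree Y n w, Y n w)" by (simp only: prod.collapse)
      qed
      then show ?case by blast
    qed
    show "{w \<in> space M. (pa_tree Y n w = fst z \<and> Y n w = snd z) \<and> pa_tree Y (Suc n) w = F} \<in> events" for z
      by (intro sets.sets_Collect_conj tree_event Y_event n)
    show "{w \<in> space M. pa_tree Y (Suc n) w = F} \<in> events" by (rule tree_event)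
  qed simp
  also have "\<dots> = (\<Sum>z\<in>trees n \<times> {1..n + 1}. joint n (fst z) (snd z) * of_bool (insert {n + 2, snd z} (fst z) = F))"
  proof (intro sum.cong refl)
    fix z
    have "{w \<in> space M. (pa_tree Y n w = fst z \<and> Y n w = snd z) \<and> pa_tree Y (Suc n) w = F} =
       (if insert {n + 2, snd z} (fst z) = F then {w \<in> space M. pa_tree Y n w = fst z \<and> Y n w = snd z} else {})"
    proof (cases "insert {n + 2, snd z} (fst z) = F")
      case True
      then have "pa_tree Y (Suc n) w = F" if "pa_tree Y n w = fst z \<and> Y n w = snd z" for w
        unfolding pa_tree_Suc[OF n] using that by simp
      then have "{w \<in> space M. (pa_tree Y n w = fst z \<and> Y n w = snd z) \<and> pa_tree Y (Suc n) w = F} =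
         {w \<in> space M. pa_tree Y n w = fst z \<and> Y n w = snd z}" by blast
      then show ?thesis using True by (simp only: simp_thms if_True)
    next
      case False
      then have "pa_tree Y (Suc n) w \<noteq> F" if "pa_tree Y n w = fst z \<and> Y n w = snd z" for w
        unfolding pa_tree_Suc[OF n] using that by simp
      then have "{w \<in> space M. (pa_tree Y n w = fst z \<and> Y n w = snd z) \<and> pa_tree Y (Suc n) w = F} = {}" by blast
      then show ?thesis using False by (simp only: if_False)
    qed
    then show "\<P>(w in M. (pa_tree Y n w = fst z \<and> Y n w = snd z) \<and> pa_tree Y (Suc n) w = F) = 
       joint n (fst z) (snd z) * of_bool (insert {n + 2, snd z} (fst z) = F)"
      by (simp add: joint_def)
  qed
  also have "\<dots> = (\<Sum>E\<in>trees n. \<Sum>y\<in>{1..n + 1}. joint n E y * of_bool (insert {n + 2, y} E = F))"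
    unfolding sum.cartesian_product by (simp add: case_prod_unfold)
  finally show ?thesis .
qed

lemma tree_mean_Suc_aux:
  assumes n: "n \<ge> 1" and total: "(\<Sum>E\<in>trees n. law n E) = 1" and d: "d \<ge> 1"
  shows "tree_mean (Suc n) \<phi> = (\<Sum>E\<in>trees n. \<Sum>y\<in>{1..n + 1}. joint n E y * \<phi> (insert {n + 2, y} E))"
proof -
  have "tree_mean (Suc n) \<phi> = (\<Sum>F\<in>trees (Suc n). \<Sum>E\<in>trees n. \<Sum>y\<in>{1..n + 1}. 
     joint n E y * (of_bool (insert {n + 2, y} E = F) * \<phi> F))"
    unfolding tree_mean_def law_Suc[OF assms] sum_distrib_right mult.assoc ..
  also have "\<dots> = (\<Sum>E\<in>trees n. \<Sum>y\<in>{1..n + 1}. \<Sum>F\<in>trees (Suc n). 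
     joint n E y * (of_bool (insert {n + 2, y} E = F) * \<phi> F))"
    by (subst sum.swap, intro sum.cong refl sum.swap)
  also have "\<dots> = (\<Sum>E\<in>trees n. \<Sum>y\<in>{1..n + 1}. joint n E y * \<phi> (insert {n + 2, y} E))"
  proof (intro sum.cong refl)
    fix E y assume "E \<in> trees n" "y \<in> {1..n + 1}"
    then have mem: "insert {n + 2, y} E \<in> trees (Suc n)" by (rule insert_in_trees)
    have "(\<Sum>F\<in>trees (Suc n). joint n E y * (of_bool (insert {n + 2, y} E = F) * \<phi> F)) =
       (\<Sum>F\<in>trees (Suc n). if F = insert {n + 2, y} E then joint n E y * \<phi> F else 0)"
      by (intro sum.cong refl) auto
    then show "(\<Sum>F\<in>trees (Suc n). joint n E y * (of_bool (insert {n + 2, y} E = F) * \<phi> F)) =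
       joint n E y * \<phi> (insert {n + 2, y} E)" using mem by simp
  qed
  finally show ?thesis .
qed

lemma sum_law:
  assumes "n \<ge> 1" and d: "d \<ge> 1"
  shows "(\<Sum>E\<in>trees n. law n E) = 1"
  using assms(1)
proof (induction n rule: dec_induct)
  case base
  have "pa_tree Y 1 w = {{1, 2}}" for w by (simp add: pa_tree_def)
  then show ?case by (simp add: law_def prob_space)
next
  case (step n)
  have "(\<Sum>E\<in>trees (Suc n). law (Suc n) E) = tree_mean (Suc n) (\<lambda>_. 1)" by (simp add: tree_mean_def)
  also have "\<dots> = (\<Sum>E\<in>trees n. \<Sum>y\<in>{1..n + 1}. joint n E y)"
    using tree_mean_Suc_aux[OF step(1,3) d, of "\<lambda>_. 1"] by simp
  also have "\<dots> = (\<Sum>E\<in>trees n. law n E)" by (intro sum.cong refl sum_joint d)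
  finally show ?case using step by simp
qed

lemmas tree_mean_Suc = tree_mean_Suc_aux[OF _ sum_law]

lemma prob_eq_tree_mean:
  assumes n: "n \<ge> 1" and d: "d \<ge> 1"
  shows "\<P>(w in M. R (pa_tree Y n w)) = tree_mean n (\<lambda>E. of_bool (R E))"
proof -
  have "\<P>(w in M. R (pa_tree Y n w)) = (\<Sum>E\<in>{E \<in> trees n. R E}. \<P>(w in M. pa_tree Y n w = E))"
  proof (intro prob_sum tree_event)
    show "AE w in M. (\<forall>E\<in>{E \<in> trees n. R E}. pa_tree Y n w = E \<longrightarrow> R (pa_tree Y n w)) \<and>
       (R (pa_tree Y n w) \<longrightarrow> (\<exists>!E\<in>{E \<in> trees n. R E}. pa_tree Y n w = E))"
      using AE_tree_vertex[OF n sum_law[OF n d] d] by eventually_elim auto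
  qed auto
  also have "\<dots> = tree_mean n (\<lambda>E. of_bool (R E))"
    unfolding tree_mean_def law_def by (simp add: sum.inter_filter if_distrib of_bool_def cong: if_cong)
  finally show ?thesis .
qed

end

section \<open>The selection function, its chords and its derivative\<close>

text \<open>Weighted inequality of arithmetic and geometric means for \<open>1 + x\<close> and
  1.\<close>

lemma one_plus_powr_le:
  fixes x q :: real
  assumes "x \<ge> 0" "0 < q" "q < 1"
  shows "(1 + x) powr q \<le> 1 + q * x"
  using Youngs_inequality_0[of q "1 - q" "1 + x" 1] assms by (simp add: algebra_simps)

lemma powr_add_le:
  fixes y z \<theta> :: real
  assumes "y > 0" "z \<ge> 0" "0 < \<theta>" "\<theta> < 1"
  shows "(y + z) powr \<theta> \<le> y powr \<theta> + \<theta> * y powr \<theta> / y * z"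
proof -
  have "y + z = y * (1 + z / y)" using assms(1) by (simp add: distrib_left)
  then have "(y + z) powr \<theta> = (y * (1 + z / y)) powr \<theta>" by simp
  also have "\<dots> = y powr \<theta> * (1 + z / y) powr \<theta>" using assms by (simp add: powr_mult)
  also have "\<dots> \<le> y powr \<theta> * (1 + \<theta> * (z / y))"
    using assms by (intro mult_left_mono one_plus_powr_le) auto
  finally show ?thesis by (simp add: algebra_simps)
qed

lemma Suc_powr_le:
  assumes "n \<ge> 1" "0 < q" "q < 1"
  shows "real (Suc n) powr q \<le> real n powr q * (1 + q / real n)"
  using powr_add_le[of "real n" 1 q] assms by (simp add: algebra_simps)

text \<open>The chance that one of \<open>d\<close> independent draws hits a set of mass
  \<open>x\<close>. A total degree of \<open>x * n\<close> has mass \<open>x / 2\<close>, so the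
  function \<open>g\<close> is \<open>pick d (x / 2)\<close>.\<close>

definition pick :: "nat \<Rightarrow> real \<Rightarrow> real" where
  "pick d x = 1 - (1 - x) ^ d"

text \<open>Takes the place of the mean value theorem: in the factorisation of
  \<open>a ^ d - b ^ d\<close> every summand lies between \<open>b ^ (d - 1)\<close> and
  \<open>a ^ (d - 1)\<close>.\<close>

lemma power_diff_bounds:
  fixes a b :: real
  assumes "0 \<le> b" "b \<le> a" "d \<ge> 1"
  shows "real d * b ^ (d - 1) * (a - b) \<le> a ^ d - b ^ d" "a ^ d - b ^ d \<le> real d * a ^ (d - 1) * (a - b)"
proof -
  obtain m where d: "d = Suc m" using assms(3) by (cases d) auto
  have eq: "a ^ d - b ^ d = (a - b) * (\<Sum>p<d. a ^ p * b ^ (m - p))" unfolding d by (rule diff_power_eq_sum)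
  have terms: "b ^ m \<le> a ^ p * b ^ (m - p)" "a ^ p * b ^ (m - p) \<le> a ^ m" if "p < d" for p
  proof -
    have p: "p + (m - p) = m" using that d by simp
    have "b ^ p * b ^ (m - p) \<le> a ^ p * b ^ (m - p)" using assms by (intro mult_right_mono power_mono) auto
    then show "b ^ m \<le> a ^ p * b ^ (m - p)" unfolding power_add[symmetric] p .
    have "a ^ p * b ^ (m - p) \<le> a ^ p * a ^ (m - p)" using assms by (intro mult_left_mono power_mono) auto
    then show "a ^ p * b ^ (m - p) \<le> a ^ m" unfolding power_add[symmetric] p .
  qed
  have "(\<Sum>p<d. b ^ m) \<le> (\<Sum>p<d. a ^ p * b ^ (m - p))" using terms by (intro sum_mono) auto
  then have "(a - b) * (real d * b ^ m) \<le> a ^ d - b ^ d"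
    unfolding eq using assms by (intro mult_left_mono) auto
  then show "real d * b ^ (d - 1) * (a - b) \<le> a ^ d - b ^ d" by (simp add: d mult_ac)
  have "(\<Sum>p<d. a ^ p * b ^ (m - p)) \<le> (\<Sum>p<d. a ^ m)" using terms by (intro sum_mono) auto
  then have "a ^ d - b ^ d \<le> (a - b) * (real d * a ^ m)"
    unfolding eq using assms by (intro mult_left_mono) auto
  then show "a ^ d - b ^ d \<le> real d * a ^ (d - 1) * (a - b)" by (simp add: d mult_ac)
qed

text \<open>Concavity in the form used below: a difference quotient lies between the derivatives at
  the two end points.\<close>

lemma pick_bounds:
  assumes "u \<le> v" "v \<le> 1" "d \<ge> 1"
  shows "real d * (1 - v) ^ (d - 1) * (v - u) \<le> pick d v - pick d u"
    and "pick d v - pick d u \<le> real d * (1 - u) ^ (d - 1) * (v - u)"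
  using power_diff_bounds[of "1 - v" "1 - u" d] assms by (auto simp: pick_def)

lemma pick_mono: "u \<le> v \<Longrightarrow> v \<le> 1 \<Longrightarrow> pick d u \<le> pick d v"
  unfolding pick_def using power_mono[of "1 - v" "1 - u" d] by simp

lemma pick_0 [simp]: "pick d 0 = 0"
  by (simp add: pick_def)

lemma pick_1 [simp]: "d \<ge> 1 \<Longrightarrow> pick d 1 = 1"
  by (simp add: pick_def power_0_left)

text \<open>The chord slope \<open>g x / x\<close>, written as a geometric sum so that it also makes
  sense at 0. A positive \<open>x\<close> is a fixed point of \<open>g\<close> iff its slope is
  1.\<close>

definition slope :: "nat \<Rightarrow> real \<Rightarrow> real" where
  "slope d x = (\<Sum>i<d. (1 - x / 2) ^ i) / 2"

lemma pick_eq_slope: "pick d (x / 2) = x * slope d x"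
  using one_diff_power_eq[of "1 - x / 2" d] by (simp add: pick_def slope_def)

lemma slope_less:
  assumes "x < y" "y \<le> 2" "d > 2"
  shows "slope d y < slope d x"
proof -
  have "(\<Sum>i<d. (1 - y / 2) ^ i) < (\<Sum>i<d. (1 - x / 2) ^ i)"
  proof (rule sum_strict_mono_ex1)
    show "\<forall>i\<in>{..<d}. (1 - y / 2) ^ i \<le> (1 - x / 2) ^ i" using assms by (auto intro!: power_mono)
    show "\<exists>i\<in>{..<d}. (1 - y / 2) ^ i < (1 - x / 2) ^ i" using assms by (intro bexI[of _ 1]) auto
  qed simp
  then show ?thesis by (simp add: slope_def)
qed

lemma slope_mono: "x \<le> y \<Longrightarrow> y \<le> 2 \<Longrightarrow> d > 2 \<Longrightarrow> slope d y \<le> slope d x"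
  using slope_less[of x y d] by (cases "x = y") auto

lemma slope_ge_half: "d > 2 \<Longrightarrow> x \<le> 2 \<Longrightarrow> slope d x \<ge> 1 / 2"
proof -
  assume d: "d > 2" and x: "x \<le> 2"
  have "(\<Sum>i\<in>{0}. (1 - x / 2) ^ i) \<le> (\<Sum>i<d. (1 - x / 2) ^ i)"
    using d x by (intro sum_mono2) auto
  then show ?thesis by (simp add: slope_def)
qed

lemma x_star_props:
  assumes "d > 2"
  shows "0 < x_star d" "x_star d \<le> 1" "slope d (x_star d) = 1"
proof -
  have *: "0 < x_star d \<and> x_star d \<le> 1 \<and> 1 - (1 - x_star d / 2) ^ d = x_star d"
    unfolding x_star_def by (rule theI'[OF x_star_unique[OF assms]])
  then show "0 < x_star d" "x_star d \<le> 1" by auto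
  have "x_star d * slope d (x_star d) = x_star d"
    using * pick_eq_slope[of d "x_star d"] by (simp add: pick_def)
  then show "slope d (x_star d) = 1" using * by simp
qed

text \<open>The derivative of \<open>g\<close>; the factor 1/2 comes from passing from degrees to
  masses.\<close>

definition rate :: "nat \<Rightarrow> real \<Rightarrow> real" where
  "rate d x = real d / 2 * (1 - x / 2) ^ (d - 1)"

definition growth_exponent :: "nat \<Rightarrow> real" where
  "growth_exponent d = c_const d ^ (d - 1) * real d / 2"

lemma rate_x_star: "rate d (x_star d) = growth_exponent d"
  by (simp add: rate_def growth_exponent_def c_const_def)

text \<open>Tangent against chord: \<open>d * c ^ (d - 1)\<close> replaces each term of the sum of
  the \<open>c ^ i\<close> by the smallest one, and that sum is 2 by the fixed point
  equation.\<close>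

lemma growth_exponent_bounds:
  assumes "d > 2"
  shows "0 < growth_exponent d" "growth_exponent d < 1"
proof -
  define c where "c = c_const d"
  have c: "1 / 2 \<le> c" "c < 1" using x_star_props[OF assms] by (auto simp: c_def c_const_def)
  show "0 < growth_exponent d" using c assms by (simp add: growth_exponent_def c_def[symmetric])
  have "(\<Sum>i<d. c ^ (d - 1)) < (\<Sum>i<d. c ^ i)"
  proof (rule sum_strict_mono_ex1)
    show "\<forall>i\<in>{..<d}. c ^ (d - 1) \<le> c ^ i" using c by (auto intro!: power_decreasing)
    have "c ^ (d - 1) < c ^ 0" using c assms by (intro power_strict_decreasing) auto
    then show "\<exists>i\<in>{..<d}. c ^ (d - 1) < c ^ i" using assms by (intro bexI[of _ 0]) auto
  qed simp
  also have "(\<Sum>i<d. c ^ i) = 2"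
    using x_star_props(3)[OF assms] by (simp add: slope_def c_def c_const_def)
  finally show "growth_exponent d < 1" by (simp add: growth_exponent_def c_def[symmetric] mult.commute)
qed

lemma rate_near_x_star:
  assumes "d > 2" "\<epsilon> > 0"
  obtains \<delta> where "\<delta> > 0" "\<And>x. \<bar>x - x_star d\<bar> < \<delta> \<Longrightarrow> \<bar>rate d x - growth_exponent d\<bar> < \<epsilon>"
proof -
  have "isCont (rate d) (x_star d)" unfolding rate_def by (intro continuous_intros) simp_all
  then have "\<forall>\<^sub>F x in nhds (x_star d). dist (rate d x) (rate d (x_star d)) < \<epsilon>"
    unfolding continuous_at_imp_continuous_on isCont_def tendsto_at_iff_tendsto_nhds
    using assms(2) by (auto dest: tendstoD)
  then show ?thesis
    unfolding eventually_nhds_metric rate_x_star dist_real_def using that by blast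
qed

section \<open>Attachment probabilities, means and polynomially small events\<close>

context max_choice_pa
begin

text \<open>Given that the tree at time \<open>n\<close> is \<open>E\<close>, the probability that the new vertex is attached to a vertex
  of degree exactly \<open>t\<close>. The maximal candidate has degree at least \<open>t\<close> iff some candidate has, so the
  tie-breaking rule does not enter.\<close>

definition attach_prob :: "nat \<Rightarrow> nat set set \<Rightarrow> nat \<Rightarrow> real" where
  "attach_prob n E t = pick d (real (weight_ge E t) / (2 * real n)) - pick d (real (weight_ge E (Suc t)) / (2 * real n))"

lemma weight_ge_ratio: 
  assumes "E \<in> trees n" "t \<ge> 1"
  shows "real (weight_ge E t) / (2 * real n) \<le> 1"
proof -
  have "n \<ge> 1" using trees_pos assms(1) .
  moreover have "real (weight_ge E t) \<le> 2 * real n" using weight_ge_le[OF assms] by linarith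
  ultimately show ?thesis by (simp add: divide_le_eq)
qed

lemma attach_prob_nonneg:
  assumes E: "E \<in> trees n" and t: "t \<ge> 1"
  shows "attach_prob n E t \<ge> 0"
proof -
  have "real (weight_ge E (Suc t)) / (2 * real n) \<le> real (weight_ge E t) / (2 * real n)"
    using weight_ge_antimono[OF E, of t "Suc t"] by (intro divide_right_mono) auto
  then show ?thesis unfolding attach_prob_def using pick_mono weight_ge_ratio[OF E t] by simp
qed

lemma sum_attach_prob:
  assumes E: "E \<in> trees n" and d: "d \<ge> 1"
  shows "(\<Sum>t\<in>{1..n}. attach_prob n E t) = 1"
proof -
  have n: "n \<ge> 1" using trees_pos E .
  define f where "f t = pick d (real (weight_ge E t) / (2 * real n))" for t
  have "(\<Sum>t\<in>{1..n}. attach_prob n E t) = - (\<Sum>t\<in>{1..n}. f (Suc t) - f t)"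
    unfolding sum_negf[symmetric] attach_prob_def f_def by simp
  also have "(\<Sum>t\<in>{1..n}. f (Suc t) - f t) = f (Suc n) - f 1" using n by (intro sum_Suc_diff) simp
  also have "f (Suc n) = 0" unfolding f_def using weight_ge_eq_0[OF E, of "Suc n"] by simp
  also have "f 1 = 1" unfolding f_def weight_ge_1[OF E] using n d by simp
  finally show ?thesis by simp
qed

lemma attach_prob_max:
  assumes E: "E \<in> trees n"
  shows "attach_prob n E (kth_degree 1 E) = pick d (real (weight_ge E (kth_degree 1 E)) / (2 * real n))"
proof -
  have "{v. v \<in> \<Union>E \<and> Suc (kth_degree 1 E) \<le> degree_of E v} = {}"
    using degree_le_max[OF E] not_less_eq_eq by blast
  then have "weight_ge E (Suc (kth_degree 1 E)) = 0" unfolding weight_ge_def by (metis sum.empty)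
  then show ?thesis by (simp add: attach_prob_def)
qed

lemma attach_prob_max_ge:
  assumes E: "E \<in> trees n"
  shows "pick d (real (kth_degree 1 E) / (2 * real n)) \<le> attach_prob n E (kth_degree 1 E)"
  unfolding attach_prob_max[OF E]
proof (rule pick_mono)
  show "real (kth_degree 1 E) / (2 * real n) \<le> real (weight_ge E (kth_degree 1 E)) / (2 * real n)"
    using weight_ge_max[OF E order_refl] by (intro divide_right_mono) auto
  show "real (weight_ge E (kth_degree 1 E)) / (2 * real n) \<le> 1"
    using kth_degree_ge_1[OF E] by (intro weight_ge_ratio[OF E]) simp
qed

lemma sum_attach_prob_max:
  assumes E: "E \<in> trees n" and d: "d \<ge> 1"
  shows "(\<Sum>t\<in>{1..n}. attach_prob n E t * (if t = kth_degree 1 E then A else B)) =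
    attach_prob n E (kth_degree 1 E) * A + (1 - attach_prob n E (kth_degree 1 E)) * B"
proof -
  have M: "kth_degree 1 E \<in> {1..n}" using kth_degree_ge_1[OF E, of 1] max_degree_le[OF E] by simp
  have "(\<Sum>t\<in>{1..n}. attach_prob n E t * (if t = kth_degree 1 E then A else B)) =
     (\<Sum>t\<in>{1..n}. attach_prob n E t * B + (if t = kth_degree 1 E then attach_prob n E t * (A - B) else 0))"
    by (intro sum.cong refl) (simp add: algebra_simps)
  also have "\<dots> = (\<Sum>t\<in>{1..n}. attach_prob n E t) * B + attach_prob n E (kth_degree 1 E) * (A - B)"
    unfolding sum.distrib sum_distrib_right using M by (simp add: sum.delta')
  finally show ?thesis unfolding sum_attach_prob[OF E d] by (simp add: algebra_simps)
qed

lemma attach_prob_max_le_1: 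
  assumes E: "E \<in> trees n" and d: "d \<ge> 1"
  shows "attach_prob n E (kth_degree 1 E) \<le> 1"
  unfolding attach_prob_max[OF E] pick_def
  using weight_ge_ratio[OF E kth_degree_ge_1[OF E]] by simp

lemma sum_joint_eq:
  assumes E: "E \<in> trees n" and d: "d \<ge> 1"
  shows "(\<Sum>y\<in>{v \<in> {1..n + 1}. degree_of E v = t}. joint n E y) = law n E * attach_prob n E t"
proof -
  have "{v \<in> {1..n + 1}. t \<le> degree_of E v} = {v \<in> {1..n + 1}. degree_of E v = t} \<union> {v \<in> {1..n + 1}. Suc t \<le> degree_of E v}"
    by (auto simp: not_less_eq_eq[symmetric])
  then have "(\<Sum>y\<in>{v \<in> {1..n + 1}. t \<le> degree_of E v}. joint n E y) =
     (\<Sum>y\<in>{v \<in> {1..n + 1}. degree_of E v = t}. joint n E y) + (\<Sum>y\<in>{v \<in> {1..n + 1}. Suc t \<le> degree_of E v}. joint n E y)"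
    by (simp only:) (intro sum.union_disjoint, auto)
  then show ?thesis unfolding sum_joint_ge[OF E d] attach_prob_def pick_def by (simp add: algebra_simps)
qed

lemma tree_mean_mono: "(\<And>E. E \<in> trees n \<Longrightarrow> f E \<le> g E) \<Longrightarrow> tree_mean n f \<le> tree_mean n g"
  unfolding tree_mean_def by (intro sum_mono mult_left_mono law_nonneg)

lemma tree_mean_add: "tree_mean n (\<lambda>E. f E + g E) = tree_mean n f + tree_mean n g"
  unfolding tree_mean_def by (simp add: algebra_simps sum.distrib)

lemma tree_mean_cmult: "tree_mean n (\<lambda>E. c * f E) = c * tree_mean n f"
  unfolding tree_mean_def by (simp add: sum_distrib_left mult_ac)

lemma tree_mean_nonneg: "(\<And>E. E \<in> trees n \<Longrightarrow> f E \<ge> 0) \<Longrightarrow> tree_mean n f \<ge> 0"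
  unfolding tree_mean_def by (intro sum_nonneg mult_nonneg_nonneg law_nonneg)

lemma tree_mean_const: "n \<ge> 1 \<Longrightarrow> d \<ge> 1 \<Longrightarrow> tree_mean n (\<lambda>_. c) = c"
  unfolding tree_mean_def using sum_law[of n] by (simp add: sum_distrib_right[symmetric])

text \<open>The template of every recursion below: once the new value of a functional is bounded by
  a function \<open>F\<close> of the old tree and the degree of the chosen vertex alone, averaging
  over \<open>joint\<close> becomes averaging over \<open>attach_prob\<close>.\<close>

lemma tree_mean_Suc_le:
  assumes n: "n \<ge> 1" and d: "d \<ge> 1"
    and step: "\<And>E y. E \<in> trees n \<Longrightarrow> y \<in> {1..n + 1} \<Longrightarrow> \<phi> (insert {n + 2, y} E) \<le> F E (degree_of E y)"
    and mean: "\<And>E. E \<in> trees n \<Longrightarrow> (\<Sum>t\<in>{1..n}. attach_prob n E t * F E t) \<le> R E"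
  shows "tree_mean (Suc n) \<phi> \<le> tree_mean n R"
proof -
  have "(\<Sum>y\<in>{1..n + 1}. joint n E y * \<phi> (insert {n + 2, y} E)) \<le> law n E * R E" if E: "E \<in> trees n" for E
  proof -
    have "(\<Sum>y\<in>{1..n + 1}. joint n E y * \<phi> (insert {n + 2, y} E)) \<le> 
       (\<Sum>y\<in>{1..n + 1}. joint n E y * F E (degree_of E y))"
      by (intro sum_mono mult_left_mono step E joint_nonneg)
    also have "\<dots> = (\<Sum>t\<in>{1..n}. \<Sum>y\<in>{v \<in> {1..n + 1}. degree_of E v = t}. joint n E y * F E (degree_of E y))"
    proof (rule sum.group[symmetric])
      show "degree_of E ` {1..n + 1} \<subseteq> {1..n}"
      proof
        fix t assume "t \<in> degree_of E ` {1..n + 1}"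
        then obtain v where "t = degree_of E v" "v \<in> {1..n + 1}" by (rule imageE)
        then show "t \<in> {1..n}" using degree_pos[OF E] degree_le[OF E] by simp
      qed
    qed simp_all
    also have "\<dots> = (\<Sum>t\<in>{1..n}. (\<Sum>y\<in>{v \<in> {1..n + 1}. degree_of E v = t}. joint n E y) * F E t)"
      unfolding sum_distrib_right by (intro sum.cong refl) simp
    also have "\<dots> = law n E * (\<Sum>t\<in>{1..n}. attach_prob n E t * F E t)"
      unfolding sum_joint_eq[OF E d] sum_distrib_left mult.assoc ..
    also have "\<dots> \<le> law n E * R E" by (intro mult_left_mono mean E law_nonneg)
    finally show ?thesis .
  qed
  then show ?thesis unfolding tree_mean_Suc[OF n n d d] tree_mean_def[of n R] by (intro sum_mono)
qed

lemma markov: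
  assumes "c > 0" "\<And>E. E \<in> trees n \<Longrightarrow> 0 \<le> \<phi> E" "\<And>E. E \<in> trees n \<Longrightarrow> A E \<Longrightarrow> c \<le> \<phi> E"
  shows "tree_mean n (\<lambda>E. of_bool (A E)) \<le> tree_mean n \<phi> / c"
proof -
  have "tree_mean n (\<lambda>E. of_bool (A E)) \<le> tree_mean n (\<lambda>E. 1 / c * \<phi> E)"
  proof (rule tree_mean_mono)
    fix E assume E: "E \<in> trees n"
    show "of_bool (A E) \<le> 1 / c * \<phi> E" using assms(1) assms(2)[OF E] assms(3)[OF E] by (cases "A E") auto
  qed
  then show ?thesis unfolding tree_mean_cmult by simp
qed

definition poly_small :: "(nat \<Rightarrow> nat set set \<Rightarrow> bool) \<Rightarrow> bool" where
  "poly_small A \<longleftrightarrow> (\<exists>\<rho><0. \<exists>K>0. \<forall>\<^sub>F n in sequentially. tree_mean n (\<lambda>E. of_bool (A n E)) \<le> K * real n powr \<rho>)"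

lemma poly_small_mono:
  assumes "poly_small B" "\<forall>\<^sub>F n in sequentially. \<forall>E\<in>trees n. A n E \<longrightarrow> B n E"
  shows "poly_small A"
proof -
  obtain \<rho> K where r: "\<rho> < 0" "K > 0" "\<forall>\<^sub>F n in sequentially. tree_mean n (\<lambda>E. of_bool (B n E)) \<le> K * real n powr \<rho>"
    using assms(1) unfolding poly_small_def by blast
  have "\<forall>\<^sub>F n in sequentially. tree_mean n (\<lambda>E. of_bool (A n E)) \<le> K * real n powr \<rho>"
    using r(3) assms(2)
  proof eventually_elim
    case (elim n)
    have "tree_mean n (\<lambda>E. of_bool (A n E)) \<le> tree_mean n (\<lambda>E. of_bool (B n E))"
      using elim(2) by (intro tree_mean_mono) auto
    then show ?case using elim(1) by simp
  qed
  then show ?thesis unfolding poly_small_def using r by blast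
qed

lemma poly_small_disj:
  assumes "poly_small A" "poly_small B"
  shows "poly_small (\<lambda>n E. A n E \<or> B n E)"
proof -
  obtain \<rho> K where r: "\<rho> < 0" "K > 0" "\<forall>\<^sub>F n in sequentially. tree_mean n (\<lambda>E. of_bool (A n E)) \<le> K * real n powr \<rho>"
    using assms(1) unfolding poly_small_def by blast
  obtain \<sigma> L where s: "\<sigma> < 0" "L > 0" "\<forall>\<^sub>F n in sequentially. tree_mean n (\<lambda>E. of_bool (B n E)) \<le> L * real n powr \<sigma>"
    using assms(2) unfolding poly_small_def by blast
  have "\<forall>\<^sub>F n in sequentially. tree_mean n (\<lambda>E. of_bool (A n E \<or> B n E)) \<le> (K + L) * real n powr (max \<rho> \<sigma>)"
    using r(3) s(3) eventually_ge_at_top[of 1]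
  proof eventually_elim
    case (elim n)
    have "tree_mean n (\<lambda>E. of_bool (A n E \<or> B n E)) \<le> tree_mean n (\<lambda>E. of_bool (A n E) + of_bool (B n E))"
      by (intro tree_mean_mono) auto
    also have "\<dots> \<le> K * real n powr \<rho> + L * real n powr \<sigma>" unfolding tree_mean_add using elim by simp
    also have "\<dots> \<le> K * real n powr (max \<rho> \<sigma>) + L * real n powr (max \<rho> \<sigma>)"
      using elim r s by (intro add_mono mult_left_mono powr_mono) auto
    finally show ?case by (simp add: algebra_simps)
  qed
  moreover have "max \<rho> \<sigma> < 0" "K + L > 0" using r s by auto
  ultimately show ?thesis unfolding poly_small_def by blast
qed

lemma poly_small_tendsto:
  assumes "poly_small A"
  shows "(\<lambda>n. tree_mean n (\<lambda>E. of_bool (A n E))) \<longlonglongrightarrow> 0"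
proof -
  obtain \<rho> K where r: "\<rho> < 0" "K > 0" "\<forall>\<^sub>F n in sequentially. tree_mean n (\<lambda>E. of_bool (A n E)) \<le> K * real n powr \<rho>"
    using assms(1) unfolding poly_small_def by blast
  have lim: "(\<lambda>n. K * real n powr \<rho>) \<longlonglongrightarrow> 0" using r by real_asymp
  show ?thesis
    by (rule tendsto_sandwich[OF _ r(3) tendsto_const lim]) (intro always_eventually allI tree_mean_nonneg, simp)
qed

lemma poly_small_if_moment:
  assumes e: "\<forall>\<^sub>F n in sequentially. tree_mean n (\<phi> n) \<le> K * real n powr \<rho>" and K: "K > 0" and c: "c > 0" and \<rho>: "\<rho> < \<sigma>"
    and nonneg: "\<And>n E. E \<in> trees n \<Longrightarrow> 0 \<le> \<phi> n E"
    and A: "\<forall>\<^sub>F n in sequentially. \<forall>E\<in>trees n. A n E \<longrightarrow> c * real n powr \<sigma> \<le> \<phi> n E"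
  shows "poly_small A"
proof -
  have "\<forall>\<^sub>F n in sequentially. tree_mean n (\<lambda>E. of_bool (A n E)) \<le> K / c * real n powr (\<rho> - \<sigma>)"
    using e A eventually_ge_at_top[of 1]
  proof eventually_elim
    case (elim n)
    have "tree_mean n (\<lambda>E. of_bool (A n E)) \<le> tree_mean n (\<phi> n) / (c * real n powr \<sigma>)"
      using elim c by (intro markov nonneg) auto
    also have "\<dots> \<le> K * real n powr \<rho> / (c * real n powr \<sigma>)"
      using elim c by (intro divide_right_mono) auto
    also have "\<dots> = K / c * real n powr (\<rho> - \<sigma>)" by (simp add: powr_diff)
    finally show ?case .
  qed
  moreover have "\<rho> - \<sigma> < 0" "K / c > 0" using assms by auto
  ultimately show ?thesis unfolding poly_small_def by blast
qed

end

section \<open>The highest degree from below\<close>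

lemma rise_drift:
  fixes r \<eta> q :: real
  assumes q: "0 < q" "q < 1" and M: "1 \<le> M" "M \<le> n" and r: "r \<le> 1"
  defines "h \<equiv> rise (- q)"
  shows "0 \<le> r \<Longrightarrow> real (Suc n) powr q * (r * h (M + 1) + (1 - r) * h M) \<le> real n powr q * h M * (1 + q / real n)"
    and "0 \<le> \<eta> \<Longrightarrow> real M / real n * (1 + \<eta>) \<le> r \<Longrightarrow>
      real (Suc n) powr q * (r * h (M + 1) + (1 - r) * h M) \<le> real n powr q * h M * (1 - q * \<eta> / real n)"
proof -
  have n: "n \<ge> 1" using M by simp
  have h: "h M > 0" using q by (simp add: h_def rise_pos)
  have eq: "r * h (M + 1) + (1 - r) * h M = h M * (1 - r * q / real M)"
    using M by (simp add: h_def rise_Suc algebra_simps)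
  have "r * q \<le> 1 * q" using q r by (intro mult_right_mono) auto
  then have "r * q \<le> 1" using q by linarith
  then have "r * q \<le> real M" using M by linarith
  then have pos: "1 - r * q / real M \<ge> 0" using M by (simp add: divide_le_eq)
  have A: "real (Suc n) powr q * (r * h (M + 1) + (1 - r) * h M) \<le> 
      real n powr q * (1 + q / real n) * (h M * (1 - r * q / real M))"
    unfolding eq using Suc_powr_le[OF n q] pos h by (intro mult_right_mono mult_nonneg_nonneg) auto
  show "real (Suc n) powr q * (r * h (M + 1) + (1 - r) * h M) \<le> real n powr q * h M * (1 + q / real n)"
    if "0 \<le> r"
  proof -
    have "h M * (1 - r * q / real M) \<le> h M * 1" using h q that by (intro mult_left_mono) auto
    then have "real n powr q * (1 + q / real n) * (h M * (1 - r * q / real M)) \<le> 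
       real n powr q * (1 + q / real n) * h M"
      using q by (intro mult_left_mono) auto
    then show ?thesis using A by (simp add: mult_ac)
  qed
  show "real (Suc n) powr q * (r * h (M + 1) + (1 - r) * h M) \<le> real n powr q * h M * (1 - q * \<eta> / real n)"
    if eta: "0 \<le> \<eta>" "real M / real n * (1 + \<eta>) \<le> r"
  proof -
    have "(1 + \<eta>) / real n \<le> r / real M" using eta(2) M n by (simp add: field_simps)
    then have "q * ((1 + \<eta>) / real n) \<le> q * (r / real M)" using q by (intro mult_left_mono) auto
    then have "1 - r * q / real M \<le> 1 - q * (1 + \<eta>) / real n" by (simp add: mult_ac)
    then have "(1 + q / real n) * (1 - r * q / real M) \<le> (1 + q / real n) * (1 - q * (1 + \<eta>) / real n)"
      using q by (intro mult_left_mono) auto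
    also have "\<dots> = 1 - q * \<eta> / real n - q / real n * (q * (1 + \<eta>) / real n)"
      by (simp add: algebra_simps add_divide_distrib)
    also have "\<dots> \<le> 1 - q * \<eta> / real n" using q eta(1) by simp
    finally have "real n powr q * h M * ((1 + q / real n) * (1 - r * q / real M)) \<le> real n powr q * h M * (1 - q * \<eta> / real n)"
      using h by (intro mult_left_mono) auto
    then show ?thesis using A by (simp add: mult_ac)
  qed
qed

text \<open>Taylor bound: the squared positive part is differentiable with derivative
  \<open>2 * max 0 y\<close>, and this derivative has Lipschitz constant 2.\<close>

lemma pos_part_square_le:
  fixes x y :: real
  shows "(max 0 x)\<^sup>2 \<le> (max 0 y)\<^sup>2 + 2 * max 0 y * (x - y) + (x - y)\<^sup>2"
proof (cases "y \<ge> 0")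
  case True
  have "(max 0 x)\<^sup>2 \<le> x\<^sup>2" by (simp add: max_def)
  also have "x\<^sup>2 = y\<^sup>2 + 2 * y * (x - y) + (x - y)\<^sup>2" by (simp add: power2_eq_square algebra_simps)
  finally show ?thesis using True by (simp add: max_def)
next
  case False
  then have "max 0 x \<le> \<bar>x - y\<bar>" by simp
  then have "(max 0 x)\<^sup>2 \<le> \<bar>x - y\<bar>\<^sup>2" by (intro power_mono) auto
  then show ?thesis using False by (simp add: max_def)
qed

lemma pos_part_square_mean:
  fixes r y x0 x1 v :: real
  assumes "0 \<le> r" "r \<le> 1"
  defines "v \<equiv> max 0 y"
  shows "r * (max 0 x1)\<^sup>2 + (1 - r) * (max 0 x0)\<^sup>2 \<le> 
    v\<^sup>2 + 2 * v * (r * (x1 - y) + (1 - r) * (x0 - y)) + (r * (x1 - y)\<^sup>2 + (1 - r) * (x0 - y)\<^sup>2)"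
proof -
  have "r * (max 0 x1)\<^sup>2 + (1 - r) * (max 0 x0)\<^sup>2 \<le> 
     r * (v\<^sup>2 + 2 * v * (x1 - y) + (x1 - y)\<^sup>2) + (1 - r) * (v\<^sup>2 + 2 * v * (x0 - y) + (x0 - y)\<^sup>2)"
    unfolding v_def using assms by (intro add_mono mult_left_mono pos_part_square_le) auto
  then show ?thesis by (simp add: algebra_simps)
qed

lemma convex_weight_mono:
  fixes r s A B :: real
  assumes "r \<le> s" "A \<le> B"
  shows "s * A + (1 - s) * B \<le> r * A + (1 - r) * B"
proof -
  have "(s - r) * A \<le> (s - r) * B" using assms by (intro mult_left_mono) auto
  then show ?thesis by (simp add: algebra_simps)
qed

context max_choice_pa
begin

abbreviation "D1 \<equiv> kth_degree 1"

lemma D1_bounds: "E \<in> trees n \<Longrightarrow> 1 \<le> D1 E \<and> D1 E \<le> n"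
  using kth_degree_ge_1[of E n 1] max_degree_le[of E n] by simp

text \<open>Concavity: to the left of \<open>b\<close> the graph of \<open>g\<close> lies above the
  chord to \<open>b\<close>. For \<open>b < x_star d\<close> this chord has slope above 1, which
  drives a small M_1/n upwards.\<close>

lemma max_selection_lower:
  assumes d: "d > 2" and E: "E \<in> trees n" and b: "b \<le> 2" "real (D1 E) \<le> b * real n"
  shows "real (D1 E) / real n * slope d b \<le> pick d (real (D1 E) / (2 * real n))"
proof -
  have n: "n \<ge> 1" using trees_pos E .
  have "real (D1 E) / real n \<le> b" using b n by (simp add: divide_le_eq)
  then have "slope d b \<le> slope d (real (D1 E) / real n)" using b d by (intro slope_mono) auto
  then have "real (D1 E) / real n * slope d b \<le> real (D1 E) / real n * slope d (real (D1 E) / real n)"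
    by (intro mult_left_mono) auto
  also have "\<dots> = pick d (real (D1 E) / real n / 2)" unfolding pick_eq_slope ..
  finally show ?thesis by (simp add: mult.commute)
qed

lemma pick_D1_bounds:
  assumes d: "d \<ge> 1" and E: "E \<in> trees n"
  shows "0 \<le> pick d (real (D1 E) / (2 * real n))" "pick d (real (D1 E) / (2 * real n)) \<le> 1"
    "pick d (real (D1 E) / (2 * real n)) \<le> real d * real (D1 E) / real n"
proof -
  have n: "n \<ge> 1" using trees_pos E .
  have M: "real (D1 E) \<le> real n" using D1_bounds[OF E] by simp
  then have x: "0 \<le> real (D1 E) / (2 * real n)" "real (D1 E) / (2 * real n) \<le> 1" using n by (auto simp: divide_le_eq)
  show "0 \<le> pick d (real (D1 E) / (2 * real n))" using pick_mono[OF x, of d] by simp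
  show "pick d (real (D1 E) / (2 * real n)) \<le> 1" unfolding pick_def using x by simp
  have "pick d (real (D1 E) / (2 * real n)) \<le> real d * (real (D1 E) / (2 * real n))"
    using pick_bounds(2)[OF x d] by simp
  also have "\<dots> \<le> real d * real (D1 E) / real n" using n by (simp add: field_simps)
  finally show "pick d (real (D1 E) / (2 * real n)) \<le> real d * real (D1 E) / real n" .
qed

text \<open>The functional is comparable to (n / M_1)^q. While M_1 is at most \<open>b * n\<close>
  it contracts; beyond that it is bounded by a constant, which enters the recursion as an error of
  order 1/n. A negative \<open>\<alpha>\<close> then yields boundedness.\<close>

lemma max_degree_moment_bounded:
  assumes d: "d > 2" and q: "0 < q" "q < 1"
  shows "\<exists>K>0. \<forall>\<^sub>F n in sequentially. tree_mean n (\<lambda>E. real n powr q * rise (- q) (D1 E)) \<le> K"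
proof -
  define h where "h = rise (- q)"
  define b where "b = x_star d / 2"
  have b: "0 < b" "b < x_star d" "b \<le> 2" using x_star_props[OF d] by (auto simp: b_def)
  define \<eta> where "\<eta> = slope d b - 1"
  have \<eta>: "\<eta> > 0" using slope_less[of b "x_star d" d] x_star_props[OF d] b d by (simp add: \<eta>_def)
  obtain c C where C: "0 < c" "0 < C" "\<And>a. a \<ge> 1 \<Longrightarrow> c * real a powr (-q) \<le> h a" "\<And>a. a \<ge> 1 \<Longrightarrow> h a \<le> C * real a powr (-q)"
    using rise_bounds[of "-q"] q unfolding h_def by auto
  \<comment> \<open>The crude growth \<open>q / n\<close> and the claimed contraction
    \<open>- q * \<eta> / n\<close> differ by \<open>q * (1 + \<eta>) / n\<close>; the last factor
    bounds the functional when M_1 exceeds \<open>b * n\<close>.\<close>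
  define K where "K = q * (1 + \<eta>) * (C * b powr (-q))"
  have K: "K \<ge> 0" using C q \<eta> by (simp add: K_def)
  define e where "e n = tree_mean n (\<lambda>E. real n powr q * h (D1 E))" for n
  have rec: "e (Suc n) \<le> (1 + (- (q * \<eta>)) / real n) * e n + K * real n powr (-1)" if n: "n \<ge> 1" for n
  proof -
    define W where "W E = real n powr q * h (D1 E)" for E
    have "e (Suc n) \<le> tree_mean n (\<lambda>E. (1 - q * \<eta> / real n) * W E + K / real n)"
      unfolding e_def
    proof (rule tree_mean_Suc_le[where F = "\<lambda>E t. real (Suc n) powr q * (if t = D1 E then h (D1 E + 1) else h (D1 E))"])
      show "n \<ge> 1" "d \<ge> 1" using n d by auto
      fix E y assume E: "E \<in> trees n" and y: "y \<in> {1..n + 1}"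
      show "real (Suc n) powr q * h (D1 (insert {n + 2, y} E)) \<le> 
         real (Suc n) powr q * (if degree_of E y = D1 E then h (D1 E + 1) else h (D1 E))"
        unfolding max_degree_insert[OF E y] by simp
    next
      fix E assume E: "E \<in> trees n"
      define r where "r = attach_prob n E (D1 E)"
      have M: "1 \<le> D1 E" "D1 E \<le> n" using D1_bounds[OF E] by auto
      have hpos: "h (D1 E) > 0" using q by (simp add: h_def rise_pos)
      have r: "0 \<le> r" "r \<le> 1" "pick d (real (D1 E) / (2 * real n)) \<le> r"
        using attach_prob_nonneg[OF E M(1)] attach_prob_max_le_1[OF E] attach_prob_max_ge[OF E] d by (auto simp: r_def)
      have "(\<Sum>t\<in>{1..n}. attach_prob n E t * (real (Suc n) powr q * (if t = D1 E then h (D1 E + 1) else h (D1 E)))) =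
         real (Suc n) powr q * (\<Sum>t\<in>{1..n}. attach_prob n E t * (if t = D1 E then h (D1 E + 1) else h (D1 E)))"
        by (simp add: sum_distrib_left mult_ac)
      also have "\<dots> = real (Suc n) powr q * (r * h (D1 E + 1) + (1 - r) * h (D1 E))"
        using sum_attach_prob_max[OF E] d by (simp add: r_def)
      also have "\<dots> \<le> (1 - q * \<eta> / real n) * W E + K / real n"
      proof (cases "real (D1 E) \<le> b * real n")
        case True
        have "real (D1 E) / real n * (1 + \<eta>) \<le> r"
          using max_selection_lower[OF d E b(3) True] r(3) by (simp add: \<eta>_def)
        then have "real (Suc n) powr q * (r * h (D1 E + 1) + (1 - r) * h (D1 E)) \<le> real n powr q * h (D1 E) * (1 - q * \<eta> / real n)"
          unfolding h_def using \<eta> by (intro rise_drift(2)[OF q M r(2)]) auto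
        then show ?thesis using K by (simp add: W_def mult_ac add_increasing2)
      next
        case False
        have "real n powr q * h (D1 E) \<le> real n powr q * (C * real (D1 E) powr (-q))"
          using C(4)[OF M(1)] by (intro mult_left_mono) auto
        also have "real (D1 E) powr (-q) \<le> (b * real n) powr (-q)"
          using False b n q by (intro powr_mono2') auto
        then have "real n powr q * (C * real (D1 E) powr (-q)) \<le> real n powr q * (C * (b * real n) powr (-q))"
          using C by (intro mult_left_mono) auto
        also have "\<dots> = C * b powr (-q)" using b n by (simp add: powr_mult powr_minus field_simps)
        finally have W: "W E \<le> C * b powr (-q)" unfolding W_def .
        have "real (Suc n) powr q * (r * h (D1 E + 1) + (1 - r) * h (D1 E)) \<le> W E * (1 + q / real n)"
          unfolding h_def W_def using r by (intro rise_drift(1)[OF q M r(2)])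
        also have "\<dots> = (1 - q * \<eta> / real n) * W E + (q * (1 + \<eta>) / real n) * W E"
          by (simp add: algebra_simps add_divide_distrib)
        also have "(q * (1 + \<eta>) / real n) * W E \<le> (q * (1 + \<eta>) / real n) * (C * b powr (-q))"
          using W q \<eta> by (intro mult_left_mono) auto
        finally show ?thesis by (simp add: K_def)
      qed
      finally show "(\<Sum>t\<in>{1..n}. attach_prob n E t * (real (Suc n) powr q * (if t = D1 E then h (D1 E + 1) else h (D1 E)))) \<le>
        (1 - q * \<eta> / real n) * W E + K / real n" .
    qed
    also have "\<dots> = (1 - q * \<eta> / real n) * e n + K / real n"
      unfolding tree_mean_add tree_mean_cmult e_def W_def using tree_mean_const[OF n, of "K / real n"] d by simp
    finally show ?thesis using n by (simp add: powr_minus divide_inverse)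
  qed
  have "\<exists>K>0. \<forall>\<^sub>F n in sequentially. e n \<le> K * real n powr 0"
  proof (rule recursion_bound[of "- (q * \<eta>)" 0 "-1" K])
    show "\<forall>\<^sub>F n in sequentially. e (Suc n) \<le> (1 + (- (q * \<eta>)) / real n) * e n + K * real n powr (-1)"
      using eventually_ge_at_top[of 1] by eventually_elim (rule rec)
  qed (use q \<eta> K in auto)
  then obtain K' where K': "K' > 0" "\<forall>\<^sub>F n in sequentially. e n \<le> K' * real n powr 0" by blast
  have "\<forall>\<^sub>F n in sequentially. e n \<le> K'"
    using K'(2) eventually_ge_at_top[of 1] by eventually_elim simp
  then show ?thesis unfolding e_def h_def using K'(1) by blast
qed

text \<open>An exact limit, because two thresholds \<open>b' * n\<close> and \<open>b * n\<close>
  that may be arbitrarily close have to be told apart; bounds up to constants would not do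
  this.\<close>

lemma rise_scaled_limit:
  assumes "a > 0" "0 < q" "q < 1"
  shows "(\<lambda>n. real n powr q * rise (- q) (nat \<lceil>a * real n\<rceil>)) \<longlonglongrightarrow> rGamma (1 - q) * a powr (- q)"
proof -
  define f where "f n = nat \<lceil>a * real n\<rceil>" for n
  have f: "real (f n) = real_of_int \<lceil>a * real n\<rceil>" for n using assms by (simp add: f_def)
  have top: "filterlim f at_top sequentially"
  proof -
    have "filterlim (\<lambda>n. real (f n)) at_top sequentially"
    proof (rule filterlim_at_top_mono)
      show "filterlim (\<lambda>n. a * real n) at_top sequentially" using assms by real_asymp
      show "\<forall>\<^sub>F n in sequentially. a * real n \<le> real (f n)" unfolding f by simp
    qed
    then show ?thesis by (simp add: filterlim_sequentially_iff_filterlim_real)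
  qed
  have "(\<lambda>m. rise (-q) m * real m powr (- (-q))) \<longlonglongrightarrow> rGamma (1 + (-q))" using assms by (intro rise_asymp) simp
  then have 1: "(\<lambda>n. rise (-q) (f n) * real (f n) powr q) \<longlonglongrightarrow> rGamma (1 - q)"
    using filterlim_compose[OF _ top] by simp
  have "(\<lambda>n. real n / real_of_int \<lceil>a * real n\<rceil>) \<longlonglongrightarrow> inverse a"
    using assms by real_asymp
  then have "(\<lambda>n. real n / real_of_int \<lceil>a * real n\<rceil>) \<longlonglongrightarrow> 1 / a"
    by (simp only: inverse_eq_divide)
  then have "(\<lambda>n. real n / real (f n)) \<longlonglongrightarrow> 1 / a" unfolding f .
  then have "(\<lambda>n. (real n / real (f n)) powr q) \<longlonglongrightarrow> (1 / a) powr q"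
    using assms by (intro tendsto_powr tendsto_const) auto
  then have "(\<lambda>n. rise (-q) (f n) * real (f n) powr q * (real n / real (f n)) powr q) \<longlonglongrightarrow> rGamma (1 - q) * (1 / a) powr q"
    by (rule tendsto_mult[OF 1])
  moreover have "\<forall>\<^sub>F n in sequentially. rise (-q) (f n) * real (f n) powr q * (real n / real (f n)) powr q = 
      real n powr q * rise (- q) (f n)"
    using eventually_compose_filterlim[OF eventually_ge_at_top[of 1] top] 
    by eventually_elim (simp add: powr_divide)
  ultimately have "(\<lambda>n. real n powr q * rise (- q) (f n)) \<longlonglongrightarrow> rGamma (1 - q) * (1 / a) powr q"
    by (rule Lim_transform_eventually)
  moreover have "(1 / a) powr q = a powr (- q)" using assms by (simp only: powr_divide powr_minus_divide powr_one_eq_one)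
  ultimately show ?thesis unfolding f_def by simp
qed

text \<open>Second moment of \<open>(W - w)\<^sup>+\<close> with \<open>W = n\<^sup>p rise (-p) D1 \<sim> (n / D1)\<^sup>p\<close>: above the threshold \<open>w\<close> the
  drift of \<open>W\<close> is at most \<open>- p \<eta> W / n\<close>, and the variance is summable by the bound on a negative moment of
  \<open>D1\<close>. The exponents only have to satisfy \<open>2 p < 3 / 4 < 1\<close>.\<close>

lemma max_degree_lower:
  assumes d: "d > 2" and b': "0 < b'" "b' < x_star d"
  shows "poly_small (\<lambda>n E. real (D1 E) < b' * real n)"
proof -
  define b where "b = (b' + x_star d) / 2"
  have b: "0 < b" "b' < b" "b < x_star d" "b \<le> 2" using x_star_props[OF d] b' by (auto simp: b_def)
  define \<eta> where "\<eta> = slope d b - 1"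
  have \<eta>: "\<eta> > 0" using slope_less[of b "x_star d" d] x_star_props[OF d] b d by (simp add: \<eta>_def)
  define p :: real where "p = 1 / 4"
  have p: "0 < p" "p < 1" by (auto simp: p_def)
  define h where "h = rise (- p)"
  define h3 where "h3 = rise (- (3 / 4))"
  obtain c C where C: "0 < c" "0 < C" "\<And>a. a \<ge> 1 \<Longrightarrow> c * real a powr (-p) \<le> h a" "\<And>a. a \<ge> 1 \<Longrightarrow> h a \<le> C * real a powr (-p)"
    using rise_bounds[of "-p"] p unfolding h_def by auto
  obtain c3 C3 where c3: "0 < c3" "0 < C3" "\<And>a. a \<ge> 1 \<Longrightarrow> c3 * real a powr (-(3/4)) \<le> h3 a" "\<And>a. a \<ge> 1 \<Longrightarrow> h3 a \<le> C3 * real a powr (-(3/4))"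
    using rise_bounds[of "-(3/4)"] unfolding h3_def by auto
  obtain K3 where K3: "K3 > 0" "\<forall>\<^sub>F n in sequentially. tree_mean n (\<lambda>E. real n powr (3/4) * h3 (D1 E)) \<le> K3"
    using max_degree_moment_bounded[OF d, of "3/4"] unfolding h3_def by auto
  define \<kappa> where "\<kappa> = rGamma (1 - p)"
  have \<kappa>: "\<kappa> > 0" using p by (simp add: \<kappa>_def rGamma_inverse_Gamma Gamma_real_pos)
  have "b powr (-p) < b' powr (-p)" using b b' p by (intro powr_less_mono2_neg) auto
  then have "\<kappa> * b powr (-p) < \<kappa> * b' powr (-p)" using \<kappa> by simp
  \<comment> \<open>Both lie strictly between the limits of \<open>W\<close> along M_1 = b n and M_1
    = b' n. For large \<open>n\<close>, \<open>W > w\<close> forces M_1 to be at most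
    \<open>b * n\<close>, where the drift is favourable, and M_1 < b' n forces
    \<open>W > w'\<close>.\<close>
  then obtain w w' where w: "\<kappa> * b powr (-p) < w" "w < w'" "w' < \<kappa> * b' powr (-p)" using dense by meson
  have w0: "w > 0" using w(1) \<kappa> by (smt (verit) mult_nonneg_nonneg powr_ge_zero)
  have lim: "(\<lambda>n. real n powr p * h (nat \<lceil>a * real n\<rceil>)) \<longlonglongrightarrow> \<kappa> * a powr (-p)" if "a > 0" for a
    unfolding h_def \<kappa>_def using rise_scaled_limit[OF that p] .
  have upper: "\<forall>\<^sub>F n in sequentially. real n powr p * h (nat \<lceil>b * real n\<rceil>) < w"
    using order_tendstoD(2)[OF lim[OF b(1)] w(1)] .
  have lower: "\<forall>\<^sub>F n in sequentially. real n powr p * h (nat \<lceil>b' * real n\<rceil>) > w'"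
    using order_tendstoD(1)[OF lim[OF b'(1)] w(3)] .
  have hpos: "h a > 0" for a using p by (simp add: h_def rise_pos)
  have hmono: "h a' \<le> h a" if "1 \<le> a" "a \<le> a'" for a a'
    unfolding h_def using p that by (intro rise_antimono) auto
  define W where "W n E = real n powr p * h (D1 E)" for n E
  define V where "V n E = max 0 (W n E - w)" for n E
  define e where "e n = tree_mean n (\<lambda>E. (V n E)\<^sup>2)" for n
  define D where "D = (real d + 1) * C\<^sup>2 / c3"
  have Dpos: "D \<ge> 0" using c3 C by (simp add: D_def)
  have step: "e (Suc n) \<le> (1 + (- (2 * p * \<eta>)) / real n) * e n + D * K3 * real n powr (-(5/4))"
    if n: "n \<ge> 1" and up: "real n powr p * h (nat \<lceil>b * real n\<rceil>) < w"
      and K3n: "tree_mean n (\<lambda>E. real n powr (3/4) * h3 (D1 E)) \<le> K3" for n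
  proof -
    have "e (Suc n) \<le> tree_mean n (\<lambda>E. (1 - 2 * p * \<eta> / real n) * (V n E)\<^sup>2 + D * real n powr (-(5/4)) * (real n powr (3/4) * h3 (D1 E)))"
      unfolding e_def
    proof (rule tree_mean_Suc_le[where F = "\<lambda>E t. if t = D1 E then (max 0 (real (Suc n) powr p * h (D1 E + 1) - w))\<^sup>2
         else (max 0 (real (Suc n) powr p * h (D1 E) - w))\<^sup>2"])
      show "n \<ge> 1" "d \<ge> 1" using n d by auto
      fix E y assume E: "E \<in> trees n" and y: "y \<in> {1..n + 1}"
      show "(V (Suc n) (insert {n + 2, y} E))\<^sup>2 \<le> (if degree_of E y = D1 E then (max 0 (real (Suc n) powr p * h (D1 E + 1) - w))\<^sup>2
         else (max 0 (real (Suc n) powr p * h (D1 E) - w))\<^sup>2)"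
        unfolding V_def W_def max_degree_insert[OF E y] by simp
    next
      fix E assume E: "E \<in> trees n"
      define m where "m = D1 E"
      have M: "1 \<le> m" "m \<le> n" using D1_bounds[OF E] by (auto simp: m_def)
      define r where "r = pick d (real m / (2 * real n))"
      have r: "0 \<le> r" "r \<le> 1" "r \<le> real d * real m / real n" "r \<le> attach_prob n E m"
        using pick_D1_bounds[OF _ E] attach_prob_max_ge[OF E] d by (auto simp: r_def m_def)
      define x where "x = W n E"
      define x1 where "x1 = real (Suc n) powr p * h (m + 1)"
      define x0 where "x0 = real (Suc n) powr p * h m"
      define v where "v = V n E"
      have xpos: "x > 0" using hpos n by (simp add: x_def W_def)
      have vx: "0 \<le> v" "v \<le> x" using w0 xpos by (auto simp: v_def V_def x_def)
      have x_eq: "x = real n powr p * h m" by (simp add: x_def W_def m_def)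
      have "h (m + 1) \<le> h m" using M by (intro hmono) auto
      then have x10: "x1 \<le> x0" unfolding x1_def x0_def by (intro mult_left_mono) auto
      \<comment> \<open>Lowering the selection probability to that of a single top vertex moves
        weight to the larger value. Afterwards \<open>r \<le> d * m / n\<close>, which can fail when
        many vertices are tied and which the variance bound needs.\<close>
      have "(max 0 (x1 - w))\<^sup>2 \<le> (max 0 (x0 - w))\<^sup>2" using x10 by (intro power_mono) auto
      then have "attach_prob n E m * (max 0 (x1 - w))\<^sup>2 + (1 - attach_prob n E m) * (max 0 (x0 - w))\<^sup>2 \<le> 
          r * (max 0 (x1 - w))\<^sup>2 + (1 - r) * (max 0 (x0 - w))\<^sup>2"
        by (rule convex_weight_mono[OF r(4)])
      also have "\<dots> \<le> v\<^sup>2 + 2 * v * (r * (x1 - w - (x - w)) + (1 - r) * (x0 - w - (x - w))) + 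
          (r * (x1 - w - (x - w))\<^sup>2 + (1 - r) * (x0 - w - (x - w))\<^sup>2)"
        unfolding v_def V_def x_def by (rule pos_part_square_mean[OF r(1,2)])
      also have "\<dots> = v\<^sup>2 + 2 * v * (r * x1 + (1 - r) * x0 - x) + (r * (x1 - x)\<^sup>2 + (1 - r) * (x0 - x)\<^sup>2)"
        by (simp add: algebra_simps)
      also have "\<dots> \<le> v\<^sup>2 + - (2 * p * \<eta> / real n) * v\<^sup>2 + D * real n powr (-(5/4)) * (real n powr (3/4) * h3 m)"
      proof (intro add_mono order_refl)
        show "2 * v * (r * x1 + (1 - r) * x0 - x) \<le> - (2 * p * \<eta> / real n) * v\<^sup>2"
        proof (cases "v = 0")
          case False
          then have "w < x" by (auto simp: v_def V_def x_def)
          have "real m \<le> b * real n"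
          proof (rule ccontr)
            assume "\<not> real m \<le> b * real n"
            then have "nat \<lceil>b * real n\<rceil> \<le> m" by linarith
            moreover have "1 \<le> nat \<lceil>b * real n\<rceil>" using b n by (simp add: Suc_le_eq)
            ultimately have "h m \<le> h (nat \<lceil>b * real n\<rceil>)" by (intro hmono)
            then have "x \<le> real n powr p * h (nat \<lceil>b * real n\<rceil>)" unfolding x_eq by (intro mult_left_mono) auto
            then show False using up \<open>w < x\<close> by linarith
          qed
          then have "real m / real n * (1 + \<eta>) \<le> r"
            using max_selection_lower[OF d E b(4)] by (simp add: \<eta>_def r_def m_def)
          then have "real (Suc n) powr p * (r * h (m + 1) + (1 - r) * h m) \<le> real n powr p * h m * (1 - p * \<eta> / real n)"
            unfolding h_def using \<eta> by (intro rise_drift(2)[OF p M r(2)]) auto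
          then have "r * x1 + (1 - r) * x0 - x \<le> - (p * \<eta> / real n) * x"
            unfolding x1_def x0_def x_eq by (simp add: algebra_simps)
          then have "2 * v * (r * x1 + (1 - r) * x0 - x) \<le> 2 * v * (- (p * \<eta> / real n) * x)"
            using vx by (intro mult_left_mono) auto
          also have "\<dots> = - (2 * p * \<eta> / real n) * (v * x)" by simp
          also have "\<dots> \<le> - (2 * p * \<eta> / real n) * (v * v)"
            using vx p \<eta> by (intro mult_left_mono_neg mult_left_mono) auto
          finally show ?thesis by (simp add: power2_eq_square)
        qed simp
      next
        have x0: "x \<le> x0" "x0 - x \<le> x / real n"
        proof -
          have "real n powr p \<le> real (Suc n) powr p" using p by (intro powr_mono2) auto
          then show "x \<le> x0" unfolding x_eq x0_def using hpos[of m] by (intro mult_right_mono) auto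
          have "real (Suc n) powr p * h m \<le> real n powr p * (1 + p / real n) * h m"
            using Suc_powr_le[OF n p] hpos[of m] by (intro mult_right_mono) auto
          then have "x0 - x \<le> p * (x / real n)" unfolding x_eq x0_def by (simp add: algebra_simps)
          also have "\<dots> \<le> 1 * (x / real n)" using p xpos by (intro mult_right_mono) auto
          finally show "x0 - x \<le> x / real n" by simp
        qed
        have nm: "x / real n \<le> x / real m" using M xpos n by (intro divide_left_mono) auto
        have x1: "\<bar>x1 - x\<bar> \<le> x / real m"
        proof -
          have "real n powr p * h (m + 1) \<le> x1"
            unfolding x1_def using p hpos[of "m + 1"] by (intro mult_right_mono powr_mono2) auto
          moreover have hs: "h (m + 1) = h m * (1 - p / real m)" using M by (simp add: h_def rise_Suc)
          have "real n powr p * h (m + 1) = x - p * (x / real m)" unfolding x_eq hs by (simp add: algebra_simps)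
          moreover have "p * (x / real m) \<le> 1 * (x / real m)" using p xpos by (intro mult_right_mono) auto
          ultimately have "x - x / real m \<le> x1" by simp
          then show ?thesis using x10 x0 nm by (simp add: abs_le_iff)
        qed
        \<comment> \<open>A jump of relative size \<open>1 / m\<close> occurs with probability of
          order \<open>m / n\<close>, so it contributes only
          \<open>x\<^sup>2 / (n * m)\<close>.\<close>
        have "r * (x1 - x)\<^sup>2 \<le> (real d * real m / real n) * (x / real m)\<^sup>2"
          using r x1 xpos power_mono[OF x1, of 2] by (intro mult_mono) auto
        also have "\<dots> = real d * (x\<^sup>2 / (real n * real m))" using M n by (simp add: power2_eq_square field_simps)
        finally have v1: "r * (x1 - x)\<^sup>2 \<le> real d * (x\<^sup>2 / (real n * real m))" .
        have "(x0 - x)\<^sup>2 \<le> (x / real n)\<^sup>2" using x0 by (intro power_mono) auto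
        also have "\<dots> = x / real n * (x / real n)" by (simp add: power2_eq_square)
        also have "\<dots> \<le> x / real n * (x / real m)" using nm xpos by (intro mult_left_mono) auto
        finally have "(x0 - x)\<^sup>2 \<le> x\<^sup>2 / (real n * real m)" by (simp add: power2_eq_square)
        moreover have "(1 - r) * (x0 - x)\<^sup>2 \<le> 1 * (x0 - x)\<^sup>2" using r by (intro mult_right_mono) auto
        ultimately have v0: "(1 - r) * (x0 - x)\<^sup>2 \<le> x\<^sup>2 / (real n * real m)" by simp
        have x2: "x\<^sup>2 \<le> C\<^sup>2 * real n powr (1/2) * real m powr (-(1/2))"
        proof -
          have "x \<le> real n powr p * (C * real m powr (-p))"
            unfolding x_eq using C(4)[OF M(1)] by (intro mult_left_mono) auto
          then have "x\<^sup>2 \<le> (real n powr p * (C * real m powr (-p)))\<^sup>2" using xpos by (intro power_mono) auto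
          also have "\<dots> = C\<^sup>2 * (real n powr p)\<^sup>2 * (real m powr (-p))\<^sup>2" by (simp add: power_mult_distrib mult_ac)
          also have "(real n powr p)\<^sup>2 = real n powr (1/2)" by (simp add: power2_eq_square powr_add[symmetric] p_def)
          also have "(real m powr (-p))\<^sup>2 = real m powr (-(1/2))" by (simp add: power2_eq_square powr_add[symmetric] p_def)
          finally show ?thesis .
        qed
        \<comment> \<open>The exponent 3/2 is weakened to 3/4 because negative moments are available
          only below order 1. The power -1/2 of \<open>n\<close> then splits into 3/4, which belongs
          to the bounded moment, and -5/4, which is below -1.\<close>
        have m34: "real m powr (-(1/2)) / real m \<le> h3 m / c3"
        proof -
          have "real m powr (-(1/2)) / real m = real m powr (-(3/2))"
            using M powr_diff[of "real m" "-(1/2)" 1] by simp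
          also have "\<dots> \<le> real m powr (-(3/4))" using M by (intro powr_mono) auto
          also have "\<dots> \<le> h3 m / c3" using c3(3)[OF M(1)] c3(1) by (simp add: field_simps)
          finally show ?thesis .
        qed
        have "r * (x1 - x)\<^sup>2 + (1 - r) * (x0 - x)\<^sup>2 \<le> (real d + 1) * (x\<^sup>2 / (real n * real m))"
          using v1 v0 unfolding distrib_right by linarith
        also have "\<dots> \<le> (real d + 1) * (C\<^sup>2 * real n powr (1/2) * real m powr (-(1/2)) / (real n * real m))"
          using x2 by (intro mult_left_mono divide_right_mono) auto
        also have "\<dots> = (real d + 1) * C\<^sup>2 * (real n powr (1/2) / real n) * (real m powr (-(1/2)) / real m)"
          by simp
        also have "\<dots> \<le> (real d + 1) * C\<^sup>2 * (real n powr (1/2) / real n) * (h3 m / c3)"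
          using m34 by (intro mult_left_mono) auto
        also have "real n powr (1/2) / real n = real n powr (-(5/4)) * real n powr (3/4)"
          using n powr_diff[of "real n" "1/2" 1] by (simp add: powr_add[symmetric])
        finally show "r * (x1 - x)\<^sup>2 + (1 - r) * (x0 - x)\<^sup>2 \<le> D * real n powr (-(5/4)) * (real n powr (3/4) * h3 m)"
          by (simp add: D_def mult_ac)
      qed
      finally have bound: "attach_prob n E m * (max 0 (x1 - w))\<^sup>2 + (1 - attach_prob n E m) * (max 0 (x0 - w))\<^sup>2 \<le> 
          (1 - 2 * p * \<eta> / real n) * v\<^sup>2 + D * real n powr (-(5/4)) * (real n powr (3/4) * h3 m)"
        by (simp add: algebra_simps)
      have "d \<ge> 1" using d by simp
      then show "(\<Sum>t\<in>{1..n}. attach_prob n E t * (if t = D1 E then (max 0 (real (Suc n) powr p * h (D1 E + 1) - w))\<^sup>2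
         else (max 0 (real (Suc n) powr p * h (D1 E) - w))\<^sup>2)) \<le> 
         (1 - 2 * p * \<eta> / real n) * (V n E)\<^sup>2 + D * real n powr (-(5/4)) * (real n powr (3/4) * h3 (D1 E))"
        unfolding sum_attach_prob_max[OF E \<open>d \<ge> 1\<close>] using bound unfolding x1_def x0_def v_def m_def by simp
    qed
    also have "\<dots> = (1 - 2 * p * \<eta> / real n) * e n + D * real n powr (-(5/4)) * tree_mean n (\<lambda>E. real n powr (3/4) * h3 (D1 E))"
      unfolding tree_mean_add tree_mean_cmult e_def ..
    also have "\<dots> \<le> (1 - 2 * p * \<eta> / real n) * e n + D * real n powr (-(5/4)) * K3"
      using Dpos K3n by (intro add_left_mono mult_left_mono) auto
    finally show ?thesis by (simp add: mult_ac)
  qed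
  \<comment> \<open>Strictly above the contraction exponent \<open>- 2 * p * \<eta>\<close>, and at
    least -1/4 to accommodate the error exponent -5/4.\<close>
  define \<rho> where "\<rho> = max (- (p * \<eta>)) (- (1 / 4))"
  have \<rho>: "\<rho> < 0" using p \<eta> by (simp add: \<rho>_def)
  have "\<exists>K>0. \<forall>\<^sub>F n in sequentially. e n \<le> K * real n powr \<rho>"
  proof (rule recursion_bound[of "- (2 * p * \<eta>)" \<rho> "-(5/4)" "D * K3"])
    have "- (2 * p * \<eta>) < - (p * \<eta>)" using p \<eta> by simp
    then show "- (2 * p * \<eta>) < \<rho>" unfolding \<rho>_def by linarith
    show "\<forall>\<^sub>F n in sequentially. e (Suc n) \<le> (1 + (- (2 * p * \<eta>)) / real n) * e n + D * K3 * real n powr (-(5/4))"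
      using eventually_ge_at_top[of 1] upper K3(2) by eventually_elim (rule step)
  qed (use Dpos K3 in \<open>auto simp: \<rho>_def\<close>)
  then obtain K where K: "K > 0" "\<forall>\<^sub>F n in sequentially. e n \<le> K * real n powr \<rho>" by blast
  show ?thesis
  proof (rule poly_small_if_moment[OF K(2)[unfolded e_def] K(1) _ \<rho>])
    show "(w' - w)\<^sup>2 > 0" using w by simp
    show "\<forall>\<^sub>F n in sequentially. \<forall>E\<in>trees n. real (D1 E) < b' * real n \<longrightarrow> (w' - w)\<^sup>2 * real n powr 0 \<le> (V n E)\<^sup>2"
      using lower eventually_ge_at_top[of 1]
    proof eventually_elim
      case (elim n)
      show ?case
      proof (intro ballI impI)
        fix E assume E: "E \<in> trees n" and less: "real (D1 E) < b' * real n"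
        have "D1 E \<le> nat \<lceil>b' * real n\<rceil>" using less by linarith
        then have "h (nat \<lceil>b' * real n\<rceil>) \<le> h (D1 E)" using D1_bounds[OF E] by (intro hmono) auto
        then have "real n powr p * h (nat \<lceil>b' * real n\<rceil>) \<le> W n E" unfolding W_def by (intro mult_left_mono) auto
        then have "w' - w \<le> V n E" using elim by (simp add: V_def)
        then have "(w' - w)\<^sup>2 \<le> (V n E)\<^sup>2" using w by (intro power_mono) auto
        then show "(w' - w)\<^sup>2 * real n powr 0 \<le> (V n E)\<^sup>2" using elim by simp
      qed
    qed
  qed simp
qed

end

section \<open>The second highest degree from above\<close>

lemma rise_diff: "a \<ge> 1 \<Longrightarrow> rise p (a + 1) - rise p a = rise p a * p / real a"
  by (simp add: rise_Suc algebra_simps)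

lemma rise_ge_1: "0 \<le> p \<Longrightarrow> 1 \<le> a \<Longrightarrow> 1 \<le> rise p a"
  using rise_mono[of p 1 a] by simp

definition degree_count :: "nat set set \<Rightarrow> nat \<Rightarrow> nat" where
  "degree_count E t = card {v \<in> \<Union>E. degree_of E v = t}"

text \<open>The top degree is removed as a value, not as a vertex: when one of several vertices of maximal degree
  is chosen, the new top value absorbs the increment and the rest is unchanged.\<close>

definition rest_moment :: "real \<Rightarrow> nat set set \<Rightarrow> real" where
  "rest_moment p E = (\<Sum>v\<in>\<Union>E. rise p (degree_of E v)) - rise p (kth_degree 1 E)"

lemma weight_ge_degree_count:
  "E \<in> trees n \<Longrightarrow> weight_ge E t = weight_ge E (Suc t) + degree_count E t * t"
  using weight_ge_Suc[of E n t] by (simp only: degree_count_def Union_tree)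

lemma rest_moment_insert:
  assumes E: "E \<in> trees n" and y: "y \<in> {1..n + 1}"
  shows "rest_moment p (insert {n + 2, y} E) = rest_moment p E + 1 + 
    (if degree_of E y = kth_degree 1 E then 0 else rise p (degree_of E y) * p / real (degree_of E y))"
proof -
  have E': "insert {n + 2, y} E \<in> trees (Suc n)" by (rule insert_in_trees[OF E y])
  have U': "\<Union>(insert {n + 2, y} E) = {1..n + 2}" unfolding Union_tree[OF E'] by simp
  have dy: "degree_of E y \<ge> 1" using degree_pos[OF E y] .
  have S: "(\<Sum>v\<in>\<Union>(insert {n + 2, y} E). rise p (degree_of (insert {n + 2, y} E) v)) =
     (\<Sum>v\<in>\<Union>E. rise p (degree_of E v)) + (rise p (degree_of E y + 1) - rise p (degree_of E y)) + rise p 1"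
    unfolding U' Union_tree[OF E] by (rule sum_new_vertex[OF E y])
  show ?thesis
  proof (cases "degree_of E y = kth_degree 1 E")
    case True
    then show ?thesis unfolding rest_moment_def S max_degree_insert[OF E y] by simp
  next
    case False
    then have "kth_degree 1 (insert {n + 2, y} E) = kth_degree 1 E" unfolding max_degree_insert[OF E y] by simp
    then show ?thesis unfolding rest_moment_def S using False rise_diff[OF dy, of p] by simp
  qed
qed

lemma rest_moment_eq:
  assumes E: "E \<in> trees n"
  obtains u where "u \<in> {1..n + 1}" "degree_of E u = kth_degree 1 E"
    "rest_moment p E = (\<Sum>v\<in>{1..n + 1} - {u}. rise p (degree_of E v))"
proof -
  obtain u where u: "u \<in> {1..n + 1}" "degree_of E u = kth_degree 1 E" using max_degree_attained[OF E] by blast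
  have "(\<Sum>v\<in>{1..n + 1}. rise p (degree_of E v)) = rise p (degree_of E u) + (\<Sum>v\<in>{1..n + 1} - {u}. rise p (degree_of E v))"
    using u(1) by (intro sum.remove) auto
  then have "rest_moment p E = (\<Sum>v\<in>{1..n + 1} - {u}. rise p (degree_of E v))"
    unfolding rest_moment_def Union_tree[OF E] u(2) by simp
  then show ?thesis using that u by blast
qed

text \<open>Makes the constant 1 that each new leaf adds a relative change of at most 1/n.\<close>

lemma rest_moment_ge_n:
  assumes E: "E \<in> trees n" and p: "p \<ge> 0"
  shows "real n \<le> rest_moment p E"
proof -
  obtain u where u: "u \<in> {1..n + 1}" "rest_moment p E = (\<Sum>v\<in>{1..n + 1} - {u}. rise p (degree_of E v))"
    using rest_moment_eq[OF E] by metis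
  have "(\<Sum>v\<in>{1..n + 1} - {u}. 1) \<le> (\<Sum>v\<in>{1..n + 1} - {u}. rise p (degree_of E v))"
    using p degree_pos[OF E] by (intro sum_mono rise_ge_1) auto
  moreover have "card ({1..n + 1} - {u}) = n" using u(1) by simp
  ultimately show ?thesis unfolding u(2) by simp
qed

text \<open>At least two vertices have degree M_2 or more, and only one of them can be the removed
  top vertex.\<close>

lemma rest_moment_ge_second:
  assumes E: "E \<in> trees n" and p: "p \<ge> 0"
  shows "rise p (kth_degree 2 E) \<le> rest_moment p E"
proof -
  have n: "n \<ge> 1" using trees_pos E .
  obtain u where u: "u \<in> {1..n + 1}" "rest_moment p E = (\<Sum>v\<in>{1..n + 1} - {u}. rise p (degree_of E v))"
    using rest_moment_eq[OF E] by metis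
  have "2 \<le> num_ge E (kth_degree 2 E)" using le_kth_degree_iff[OF E, of 2 "kth_degree 2 E"] n by simp
  then have card2: "2 \<le> card {v \<in> {1..n + 1}. kth_degree 2 E \<le> degree_of E v}"
    unfolding num_ge_def Union_tree[OF E] .
  have "\<not> {v \<in> {1..n + 1}. kth_degree 2 E \<le> degree_of E v} \<subseteq> {u}"
  proof
    assume "{v \<in> {1..n + 1}. kth_degree 2 E \<le> degree_of E v} \<subseteq> {u}"
    then have "card {v \<in> {1..n + 1}. kth_degree 2 E \<le> degree_of E v} \<le> card {u}" by (intro card_mono) simp_all
    then show False using card2 by simp
  qed
  then obtain v where v: "v \<in> {1..n + 1}" "v \<noteq> u" "kth_degree 2 E \<le> degree_of E v" by blast
  have "rise p (kth_degree 2 E) \<le> rise p (degree_of E v)"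
    using kth_degree_ge_1[OF E, of 2] v p by (intro rise_mono) auto
  also have "\<dots> = (\<Sum>v\<in>{v}. rise p (degree_of E v))" by simp
  also have "\<dots> \<le> (\<Sum>v\<in>{1..n + 1} - {u}. rise p (degree_of E v))"
    using v p by (intro sum_mono2) (auto intro!: less_imp_le rise_pos)
  finally show ?thesis unfolding u(2) .
qed

lemma sum_degree_count:
  assumes E: "E \<in> trees n"
  shows "(\<Sum>t\<in>{1..n}. real (degree_count E t) * f t) = (\<Sum>v\<in>\<Union>E. f (degree_of E v))"
proof -
  have "(\<Sum>v\<in>{1..n + 1}. f (degree_of E v)) = (\<Sum>t\<in>{1..n}. \<Sum>v\<in>{v \<in> {1..n + 1}. degree_of E v = t}. f (degree_of E v))"
  proof (rule sum.group[symmetric])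
    show "degree_of E ` {1..n + 1} \<subseteq> {1..n}"
    proof
      fix t assume "t \<in> degree_of E ` {1..n + 1}"
      then obtain v where "t = degree_of E v" "v \<in> {1..n + 1}" by (rule imageE)
      then show "t \<in> {1..n}" using degree_pos[OF E] degree_le[OF E] by simp
    qed
  qed simp_all
  also have "\<dots> = (\<Sum>t\<in>{1..n}. real (degree_count E t) * f t)"
    unfolding degree_count_def Union_tree[OF E] by (intro sum.cong refl) simp
  finally show ?thesis unfolding Union_tree[OF E] by simp
qed

text \<open>The top value is dropped with its full multiplicity on the left, but only once in
  \<open>rest_moment\<close>.\<close>

lemma degree_count_rest:
  assumes E: "E \<in> trees n" and p: "p \<ge> 0"
  shows "(\<Sum>t\<in>{1..n}. if t = kth_degree 1 E then 0 else real (degree_count E t) * rise p t) \<le> rest_moment p E"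
proof -
  define M where "M = kth_degree 1 E"
  have M: "M \<in> {1..n}" using kth_degree_ge_1[OF E, of 1] max_degree_le[OF E] by (simp add: M_def)
  obtain u where u: "u \<in> {1..n + 1}" "degree_of E u = M" using max_degree_attained[OF E] unfolding M_def by blast
  have "{v \<in> {1..n + 1}. degree_of E v = M} \<noteq> {}" using u by blast
  then have "card {v \<in> {1..n + 1}. degree_of E v = M} > 0" unfolding card_gt_0_iff by simp
  then have c: "real (degree_count E M) \<ge> 1" unfolding degree_count_def Union_tree[OF E] by linarith
  have "(\<Sum>t\<in>{1..n}. if t = M then 0 else real (degree_count E t) * rise p t) =
     (\<Sum>t\<in>{1..n}. real (degree_count E t) * rise p t - (if t = M then real (degree_count E t) * rise p t else 0))"
    by (intro sum.cong refl) simp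
  also have "\<dots> = (\<Sum>v\<in>\<Union>E. rise p (degree_of E v)) - real (degree_count E M) * rise p M"
    unfolding sum_subtractf sum_degree_count[OF E] using M by (simp add: sum.delta)
  also have "\<dots> \<le> (\<Sum>v\<in>\<Union>E. rise p (degree_of E v)) - 1 * rise p M"
    using c p rise_pos[of p M] by (intro diff_left_mono mult_right_mono) auto
  finally show ?thesis unfolding rest_moment_def M_def by simp
qed

text \<open>A crude deterministic bound of order \<open>n powr (p + 1)\<close>, for use on the event
  that the top degree is too small.\<close>

lemma rest_moment_le:
  assumes E: "E \<in> trees n" and p: "p \<ge> 0"
  shows "rest_moment p E \<le> 2 * real n * rise p n"
proof -
  have n: "n \<ge> 1" using trees_pos E .
  have "rest_moment p E \<le> (\<Sum>v\<in>{1..n + 1}. rise p (degree_of E v))"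
    unfolding rest_moment_def Union_tree[OF E] using rise_pos[of p "kth_degree 1 E"] p by simp
  also have "\<dots> \<le> (\<Sum>v\<in>{1..n + 1}. rise p n)"
    using p degree_pos[OF E] degree_le[OF E] by (intro sum_mono rise_mono) auto
  also have "\<dots> = real (n + 1) * rise p n" by simp
  also have "\<dots> \<le> 2 * real n * rise p n" using n p rise_pos[of p n] by (intro mult_right_mono) auto
  finally show ?thesis .
qed

context max_choice_pa
begin

text \<open>The vertices of degree \<open>t\<close> below the top occupy an interval of masses that
  begins after the top vertex, hence at \<open>b / 2\<close> or later, where concavity bounds the
  derivative of \<open>pick\<close> by its value at \<open>b / 2\<close>.\<close>

lemma attach_prob_le:
  assumes d: "d > 2" and E: "E \<in> trees n" and t: "1 \<le> t" "t \<noteq> D1 E" and b: "b * real n \<le> real (D1 E)" "b \<le> 2"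
  shows "attach_prob n E t \<le> real (degree_count E t) * real t / real n * rate d b"
proof (cases "t < D1 E")
  case True
  have n: "n \<ge> 1" using trees_pos E .
  define u where "u = real (weight_ge E (Suc t)) / (2 * real n)"
  have w: "real (weight_ge E t) / (2 * real n) = u + real (degree_count E t) * real t / (2 * real n)"
    unfolding weight_ge_degree_count[OF E, of t] u_def by (simp add: add_divide_distrib)
  have "b * real n \<le> real (weight_ge E (Suc t))" using b weight_ge_max[OF E, of "Suc t"] True by linarith
  then have "b / 2 \<le> u" using n by (simp add: u_def field_simps)
  moreover have "u \<le> 1" unfolding u_def by (rule weight_ge_ratio[OF E]) simp
  ultimately have pw: "(1 - u) ^ (d - 1) \<le> (1 - b / 2) ^ (d - 1)" by (intro power_mono) auto
  have "attach_prob n E t \<le> real d * (1 - u) ^ (d - 1) * (u + real (degree_count E t) * real t / (2 * real n) - u)"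
    unfolding attach_prob_def u_def[symmetric] w using weight_ge_ratio[OF E t(1)] d unfolding w
    by (intro pick_bounds(2)) auto
  also have "\<dots> \<le> real d * (1 - b / 2) ^ (d - 1) * (u + real (degree_count E t) * real t / (2 * real n) - u)"
    using pw by (intro mult_right_mono mult_left_mono) auto
  also have "\<dots> = real (degree_count E t) * real t / real n * rate d b"
    by (simp add: rate_def mult_ac)
  finally show ?thesis .
next
  case False
  then have "D1 E < t" using t by simp
  then have "{v \<in> \<Union>E. degree_of E v = t} = {}" using degree_le_max[OF E] by (blast dest: leD)
  then have c: "degree_count E t = 0" unfolding degree_count_def by (metis card.empty)
  then have "weight_ge E t = weight_ge E (Suc t)" using weight_ge_degree_count[OF E, of t] by simp
  then show ?thesis unfolding attach_prob_def c by simp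
qed

text \<open>The event that the top degree is too small has only polynomially small probability, so the rest moment (which can be of order
  \<open>n\<^sup>p\<close>) is tamed by a small power \<open>\<theta>\<close>; a large \<open>p\<close> makes the additive cost \<open>1\<close> in
  \<open>\<theta> * (p * rate d b + 1)\<close> negligible.\<close>

lemma second_degree_upper:
  assumes d: "d > 2" and \<epsilon>: "\<epsilon> > 0"
  shows "poly_small (\<lambda>n E. real n powr (growth_exponent d + \<epsilon>) \<le> real (kth_degree 2 E))"
proof -
  obtain \<delta> where \<delta>: "\<delta> > 0" "\<And>x. \<bar>x - x_star d\<bar> < \<delta> \<Longrightarrow> \<bar>rate d x - growth_exponent d\<bar> < \<epsilon> / 2"
    using rate_near_x_star[OF d, of "\<epsilon> / 2"] \<epsilon> by auto
  note xs = x_star_props[OF d]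
  define b where "b = max (x_star d / 2) (x_star d - \<delta> / 2)"
  have b: "0 < b" "b < x_star d" "b \<le> 2" "\<bar>b - x_star d\<bar> < \<delta>"
    using xs \<delta>(1) by (auto simp: b_def max_def abs_if)
  have rb: "rate d b < growth_exponent d + \<epsilon> / 2" using \<delta>(2)[OF b(4)] by linarith
  have rb0: "0 \<le> rate d b" using b by (simp add: rate_def)
  obtain \<rho>1 K1 where r1: "\<rho>1 < 0" "K1 > 0" "\<forall>\<^sub>F n in sequentially. tree_mean n (\<lambda>E. of_bool (real (D1 E) < b * real n)) \<le> K1 * real n powr \<rho>1"
    using max_degree_lower[OF d b(1,2)] unfolding poly_small_def by blast
  \<comment> \<open>Then \<open>p * \<epsilon> / 2 = 3\<close>, more than the additive loss 2 in
    \<open>\<rho>\<close> below.\<close>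
  define p where "p = 6 / \<epsilon>"
  have p: "p > 0" using \<epsilon> by (simp add: p_def)
  \<comment> \<open>On the bad event the functional is at most of order
    \<open>n powr (\<theta> * (p + 1))\<close>; with the second bound, the probability of order
    \<open>n powr \<rho>1\<close> compensates this. The 1/2 keeps \<open>\<theta>\<close> below
    1.\<close>
  define \<theta> where "\<theta> = min (1 / 2) (- \<rho>1 / (p + 1))"
  have "- \<rho>1 / (p + 1) > 0" using r1(1) p by (intro divide_pos_pos) auto
  then have \<theta>: "0 < \<theta>" "\<theta> < 1" "\<theta> \<le> - \<rho>1 / (p + 1)" unfolding \<theta>_def by linarith+
  have \<theta>p: "\<theta> * (p + 1) + \<rho>1 \<le> 0" using \<theta>(3) p by (simp add: field_simps)
  obtain c C where C: "0 < c" "0 < C" "\<And>a. a \<ge> 1 \<Longrightarrow> c * real a powr p \<le> rise p a" "\<And>a. a \<ge> 1 \<Longrightarrow> rise p a \<le> C * real a powr p"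
    using rise_bounds[of p] p by auto
  \<comment> \<open>\<open>p * rate d b\<close> comes from the existing degrees, the 1 from the new
    leaf.\<close>
  define \<alpha> where "\<alpha> = \<theta> * (p * rate d b + 1)"
  define e where "e n = tree_mean n (\<lambda>E. rest_moment p E powr \<theta>)" for n
  define D where "D = \<theta> * p * real d * (2 * C) powr \<theta>"
  have D: "D \<ge> 0" using \<theta> p C by (simp add: D_def)
  have step: "e (Suc n) \<le> (1 + \<alpha> / real n) * e n + D * K1 * real n powr (-1)"
    if n: "n \<ge> 1" and bad: "tree_mean n (\<lambda>E. of_bool (real (D1 E) < b * real n)) \<le> K1 * real n powr \<rho>1" for n
  proof -
    have d1: "d \<ge> 1" using d by simp
    have "e (Suc n) \<le> tree_mean n (\<lambda>E. (1 + \<alpha> / real n) * rest_moment p E powr \<theta> + 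
        D * real n powr (\<theta> * (p + 1)) / real n * of_bool (real (D1 E) < b * real n))"
      unfolding e_def
    proof (rule tree_mean_Suc_le[where F = "\<lambda>E t. rest_moment p E powr \<theta> + \<theta> * rest_moment p E powr \<theta> / rest_moment p E *
           (1 + (if t = D1 E then 0 else rise p t * p / real t))", OF n d1])
      fix E y assume E: "E \<in> trees n" and y: "y \<in> {1..n + 1}"
      have pos: "rest_moment p E > 0" using rest_moment_ge_n[OF E, of p] p n by simp
      have "0 \<le> 1 + (if degree_of E y = D1 E then 0 else rise p (degree_of E y) * p / real (degree_of E y))"
        using p rise_pos[of p "degree_of E y"] by simp
      then show "rest_moment p (insert {n + 2, y} E) powr \<theta> \<le> rest_moment p E powr \<theta> + \<theta> * rest_moment p E powr \<theta> / rest_moment p E *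
           (1 + (if degree_of E y = D1 E then 0 else rise p (degree_of E y) * p / real (degree_of E y)))"
        unfolding rest_moment_insert[OF E y] add.assoc using pos \<theta> by (intro powr_add_le) auto
    next
      fix E assume E: "E \<in> trees n"
      define \<Phi> where "\<Phi> = rest_moment p E"
      define A where "A = \<Phi> powr \<theta>"
      have \<Phi>: "\<Phi> \<ge> real n" "\<Phi> > 0" using rest_moment_ge_n[OF E, of p] p n by (auto simp: \<Phi>_def)
      have A: "A > 0" using \<Phi> by (simp add: A_def)
      \<comment> \<open>\<open>attach_prob_le\<close> accepts any \<open>b'\<close> with
        \<open>b' * n\<close> at most M_1; 0 is the trivial choice on the bad event, with rate
        \<open>d / 2\<close>.\<close>
      define b' where "b' = (if real (D1 E) < b * real n then 0 else b)"
      have b': "b' * real n \<le> real (D1 E)" "b' \<le> 2" using b by (auto simp: b'_def)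
      define g where "g = rate d b'"
      have g0: "g \<ge> 0" using b' by (simp add: g_def rate_def)
      have "(\<Sum>t\<in>{1..n}. attach_prob n E t * (if t = D1 E then 0 else rise p t * p / real t)) \<le> 
          (\<Sum>t\<in>{1..n}. p * g / real n * (if t = D1 E then 0 else real (degree_count E t) * rise p t))"
      proof (rule sum_mono)
        fix t assume t: "t \<in> {1..n}"
        show "attach_prob n E t * (if t = D1 E then 0 else rise p t * p / real t) \<le> 
          p * g / real n * (if t = D1 E then 0 else real (degree_count E t) * rise p t)"
        proof (cases "t = D1 E")
          case False
          have "attach_prob n E t \<le> real (degree_count E t) * real t / real n * g"
            unfolding g_def using t False b' by (intro attach_prob_le[OF d E]) auto
          then have "attach_prob n E t * (rise p t * p / real t) \<le> real (degree_count E t) * real t / real n * g * (rise p t * p / real t)"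
            using p rise_pos[of p t] by (intro mult_right_mono) auto
          also have "\<dots> = p * g / real n * (real (degree_count E t) * rise p t)" using t by simp
          finally show ?thesis using False by simp
        qed simp
      qed
      also have "\<dots> \<le> p * g / real n * \<Phi>"
        unfolding sum_distrib_left[symmetric] \<Phi>_def
        using p g0 by (intro mult_left_mono degree_count_rest[OF E]) auto
      finally have S: "(\<Sum>t\<in>{1..n}. attach_prob n E t * (if t = D1 E then 0 else rise p t * p / real t)) \<le> p * g / real n * \<Phi>" .
      have "(\<Sum>t\<in>{1..n}. attach_prob n E t * (A + \<theta> * A / \<Phi> * (1 + (if t = D1 E then 0 else rise p t * p / real t)))) =
         (\<Sum>t\<in>{1..n}. attach_prob n E t * (A + \<theta> * A / \<Phi>) + \<theta> * A / \<Phi> * (attach_prob n E t * (if t = D1 E then 0 else rise p t * p / real t)))"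
        by (intro sum.cong refl) (simp only: algebra_simps)
      also have "\<dots> = A + \<theta> * A / \<Phi> + \<theta> * A / \<Phi> * (\<Sum>t\<in>{1..n}. attach_prob n E t * (if t = D1 E then 0 else rise p t * p / real t))"
        unfolding sum.distrib sum_distrib_right[symmetric] sum_distrib_left[symmetric] sum_attach_prob[OF E d1] by simp
      also have "\<dots> \<le> A + \<theta> * A / real n + \<theta> * A / \<Phi> * (p * g / real n * \<Phi>)"
        using S \<Phi> A \<theta> n by (intro add_mono mult_left_mono divide_left_mono order_refl) auto
      also have "\<theta> * A / \<Phi> * (p * g / real n * \<Phi>) = \<theta> * A * p * g / real n" using \<Phi> by simp
      also have "A + \<theta> * A / real n + \<theta> * A * p * g / real n = A * (1 + \<theta> * (p * g + 1) / real n)"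
        by (simp add: algebra_simps add_divide_distrib)
      also have "\<dots> \<le> (1 + \<alpha> / real n) * A + D * real n powr (\<theta> * (p + 1)) / real n * of_bool (real (D1 E) < b * real n)"
      proof (cases "real (D1 E) < b * real n")
        case False
        then show ?thesis by (simp add: g_def b'_def \<alpha>_def mult.commute)
      next
        case True
        have g: "g \<le> real d" using True by (simp add: g_def b'_def rate_def)
        have "\<Phi> \<le> 2 * real n * rise p n" unfolding \<Phi>_def using p by (intro rest_moment_le[OF E]) auto
        also have "\<dots> \<le> 2 * real n * (C * real n powr p)" using C(4)[OF n] by (intro mult_left_mono) auto
        also have "\<dots> = 2 * C * real n powr (p + 1)" using n by (simp add: powr_add)
        finally have "A \<le> (2 * C * real n powr (p + 1)) powr \<theta>" unfolding A_def using \<Phi> \<theta> by (intro powr_mono2) auto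
        also have "\<dots> = (2 * C) powr \<theta> * real n powr (\<theta> * (p + 1))" using C by (simp add: powr_mult powr_powr mult.commute)
        finally have A2: "A \<le> (2 * C) powr \<theta> * real n powr (\<theta> * (p + 1))" .
        have "A * (1 + \<theta> * (p * g + 1) / real n) = (1 + \<theta> * (0 + 1) / real n) * A + \<theta> * p * g / real n * A"
          by (simp add: algebra_simps add_divide_distrib)
        also have "\<dots> \<le> (1 + \<alpha> / real n) * A + \<theta> * p * real d / real n * ((2 * C) powr \<theta> * real n powr (\<theta> * (p + 1)))"
          unfolding \<alpha>_def using A A2 g g0 \<theta> p rb0
          by (intro add_mono mult_mono mult_right_mono divide_right_mono mult_left_mono) auto
        also have "\<dots> = (1 + \<alpha> / real n) * A + D * real n powr (\<theta> * (p + 1)) / real n * of_bool (real (D1 E) < b * real n)"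
          using True by (simp add: D_def mult_ac)
        finally show ?thesis .
      qed
      finally show "(\<Sum>t\<in>{1..n}. attach_prob n E t * (rest_moment p E powr \<theta> + \<theta> * rest_moment p E powr \<theta> / rest_moment p E *
           (1 + (if t = D1 E then 0 else rise p t * p / real t)))) \<le> 
         (1 + \<alpha> / real n) * rest_moment p E powr \<theta> + D * real n powr (\<theta> * (p + 1)) / real n * of_bool (real (D1 E) < b * real n)"
        unfolding A_def \<Phi>_def .
    qed
    also have "\<dots> = (1 + \<alpha> / real n) * e n + D * real n powr (\<theta> * (p + 1)) / real n * tree_mean n (\<lambda>E. of_bool (real (D1 E) < b * real n))"
      unfolding tree_mean_add tree_mean_cmult e_def ..
    also have "\<dots> \<le> (1 + \<alpha> / real n) * e n + D * real n powr (\<theta> * (p + 1)) / real n * (K1 * real n powr \<rho>1)"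
      using bad D by (intro add_left_mono mult_left_mono) auto
    also have "D * real n powr (\<theta> * (p + 1)) / real n * (K1 * real n powr \<rho>1) = D * K1 / real n * real n powr (\<theta> * (p + 1) + \<rho>1)"
      by (simp add: powr_add)
    also have "\<dots> \<le> D * K1 / real n * real n powr 0"
      using n \<theta>p D r1 by (intro mult_left_mono powr_mono) auto
    also have "\<dots> = D * K1 * real n powr (-1)" using n by (simp add: powr_minus divide_inverse)
    finally show ?thesis by simp
  qed
  \<comment> \<open>Equals \<open>\<alpha> + \<theta>\<close>, which provides the strict gap for the
    recursion.\<close>
  define \<rho> where "\<rho> = \<theta> * (p * rate d b + 2)"
  have \<rho>: "\<rho> \<ge> 0" using \<theta> p rb0 by (simp add: \<rho>_def)
  have "\<exists>K>0. \<forall>\<^sub>F n in sequentially. e n \<le> K * real n powr \<rho>"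
  proof (rule recursion_bound[of \<alpha> \<rho> "-1" "D * K1"])
    show "\<alpha> < \<rho>" using \<theta>(1) by (simp add: \<alpha>_def \<rho>_def)
    show "\<forall>\<^sub>F n in sequentially. e (Suc n) \<le> (1 + \<alpha> / real n) * e n + D * K1 * real n powr (-1)"
      using eventually_ge_at_top[of 1] r1(3) by eventually_elim (rule step)
  qed (use D r1 \<rho> in auto)
  then obtain K where K: "K > 0" "\<forall>\<^sub>F n in sequentially. e n \<le> K * real n powr \<rho>" by blast
  define \<sigma> where "\<sigma> = \<theta> * (p * (growth_exponent d + \<epsilon>))"
  have "p * rate d b + 2 < p * (growth_exponent d + \<epsilon> / 2) + 3" using rb p by (simp add: mult_less_cancel_left_pos add_less_le_mono)
  also have "\<dots> = p * (growth_exponent d + \<epsilon>)" using \<epsilon> by (simp add: p_def field_simps)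
  finally have less: "\<rho> < \<sigma>" unfolding \<rho>_def \<sigma>_def using \<theta>(1) by simp
  show ?thesis
  proof (rule poly_small_if_moment[OF K(2)[unfolded e_def] K(1) _ less])
    show "c powr \<theta> > 0" using C by simp
    show "\<forall>\<^sub>F n in sequentially. \<forall>E\<in>trees n. real n powr (growth_exponent d + \<epsilon>) \<le> real (kth_degree 2 E) \<longrightarrow> 
        c powr \<theta> * real n powr \<sigma> \<le> rest_moment p E powr \<theta>"
    proof (intro always_eventually allI ballI impI)
      fix n E assume E: "E \<in> trees n" and ge: "real n powr (growth_exponent d + \<epsilon>) \<le> real (kth_degree 2 E)"
      have "c * (real n powr (growth_exponent d + \<epsilon>)) powr p \<le> c * real (kth_degree 2 E) powr p"
        using ge C p by (intro mult_left_mono powr_mono2) auto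
      also have "\<dots> \<le> rise p (kth_degree 2 E)" using C(3) kth_degree_ge_1[OF E, of 2] by simp
      also have "\<dots> \<le> rest_moment p E" using p by (intro rest_moment_ge_second[OF E]) simp
      finally have "(c * (real n powr (growth_exponent d + \<epsilon>)) powr p) powr \<theta> \<le> rest_moment p E powr \<theta>"
        using C \<theta> by (intro powr_mono2) auto
      then show "c powr \<theta> * real n powr \<sigma> \<le> rest_moment p E powr \<theta>"
        using C by (simp add: powr_mult powr_powr \<sigma>_def mult_ac)
    qed
  qed simp
qed

end

section \<open>The remaining bounds\<close>

text \<open>Equal degrees occupy consecutive ranks starting right after
  \<open>num_ge E (Suc t)\<close>; this block may extend beyond rank \<open>k\<close>, where it is
  cut off.\<close>

lemma card_rank_eq:
  assumes E: "E \<in> trees n" and k: "k \<le> n" and t: "t \<ge> 1"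
  shows "card {i \<in> {2..k}. kth_degree i E = t} \<le> min k (num_ge E t) - num_ge E (Suc t)"
proof -
  have "{i \<in> {2..k}. kth_degree i E = t} \<subseteq> {num_ge E (Suc t)<..min k (num_ge E t)}"
  proof
    fix i assume "i \<in> {i \<in> {2..k}. kth_degree i E = t}"
    then have i: "2 \<le> i" "i \<le> k" "kth_degree i E = t" by auto
    have "i \<le> num_ge E t" using le_kth_degree_iff[OF E, of i t] i k by simp
    moreover have "\<not> i \<le> num_ge E (Suc t)" using le_kth_degree_iff[OF E, of i "Suc t"] i k by simp
    ultimately show "i \<in> {num_ge E (Suc t)<..min k (num_ge E t)}" using i by simp
  qed
  then have "card {i \<in> {2..k}. kth_degree i E = t} \<le> card {num_ge E (Suc t)<..min k (num_ge E t)}"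
    by (intro card_mono) auto
  then show ?thesis by simp
qed

lemma num_ge_degree_count:
  assumes E: "E \<in> trees n"
  shows "num_ge E t = num_ge E (Suc t) + degree_count E t"
proof -
  have "{v \<in> {1..n + 1}. t \<le> degree_of E v} = {v \<in> {1..n + 1}. Suc t \<le> degree_of E v} \<union> {v \<in> {1..n + 1}. degree_of E v = t}"
    by (auto simp: not_less_eq_eq[symmetric])
  then show ?thesis unfolding num_ge_def degree_count_def Union_tree[OF E]
    by (simp only:) (subst card_Un_disjoint, auto)
qed

text \<open>\<open>j\<close> is the first rank of the block of degree \<open>t\<close>: after the
  step exactly \<open>j\<close> vertices have degree above \<open>t\<close>. The strict top keeps
  this rank away from 1.\<close>

lemma kth_degree_insert_max_rank:
  assumes E: "E \<in> trees n" and y: "y \<in> {1..n + 1}" 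
    and i: "2 \<le> i" "i \<le> k" "kth_degree i E = degree_of E y" and k: "k \<le> n" and top: "kth_degree 2 E < kth_degree 1 E"
  obtains j where "2 \<le> j" "j \<le> k" "kth_degree j E = degree_of E y" 
    "degree_of E y + 1 \<le> kth_degree j (insert {n + 2, y} E)"
proof -
  define t where "t = degree_of E y"
  define j where "j = num_ge E (Suc t) + 1"
  have t1: "t \<ge> 1" using degree_pos[OF E y] by (simp add: t_def)
  have E': "insert {n + 2, y} E \<in> trees (Suc n)" by (rule insert_in_trees[OF E y])
  have "t \<le> kth_degree 2 E" using kth_degree_antimono[OF E, of 2 i] i by (simp add: t_def)
  then have "1 \<le> num_ge E (Suc t)" using le_kth_degree_iff[OF E, of 1 "Suc t"] top by simp
  then have j2: "2 \<le> j" by (simp add: j_def)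
  have "\<not> i \<le> num_ge E (Suc t)" using le_kth_degree_iff[OF E, of i "Suc t"] i k by (simp add: t_def)
  then have ji: "j \<le> i" by (simp add: j_def)
  have "t \<le> kth_degree j E" using kth_degree_antimono[OF E, of j i] i ji j2 by (simp add: t_def)
  moreover have "\<not> Suc t \<le> kth_degree j E"
    using le_kth_degree_iff[OF E, of j "Suc t"] j2 t1 by (simp add: j_def)
  ultimately have jt: "kth_degree j E = t" by simp
  have "num_ge (insert {n + 2, y} E) (Suc t) = j"
    using num_ge_insert[OF E y, of "Suc t"] t1 by (simp add: j_def t_def)
  then have "Suc t \<le> kth_degree j (insert {n + 2, y} E)"
    using le_kth_degree_iff[OF E', of j "Suc t"] j2 t1 by simp
  then show ?thesis using that[of j] j2 ji i jt by (simp add: t_def)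
qed

context max_choice_pa
begin

lemma top_degree_unique_weight:
  assumes E: "E \<in> trees n" and top: "kth_degree 2 E < D1 E"
  shows "weight_ge E (D1 E) = D1 E"
proof -
  have n: "n \<ge> 1" using trees_pos E .
  have "\<not> 2 \<le> num_ge E (D1 E)" using le_kth_degree_iff[OF E, of 2 "D1 E"] top n by simp
  then have "num_ge E (D1 E) * kth_degree 2 E \<le> 1 * kth_degree 2 E" by (intro mult_right_mono) auto
  then have "weight_ge E (D1 E) \<le> D1 E" using weight_ge_le_kth[OF E top order_refl] by linarith
  then show ?thesis using weight_ge_max[OF E order_refl] by simp
qed

text \<open>Since the growth exponent is below 1, an exponent halfway between it and 1 is still
  sublinear.\<close>

lemma second_degree_sublinear:
  assumes d: "d > 2" and a: "a > 0"
  shows "poly_small (\<lambda>n E. a * real n < real (kth_degree 2 E))"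
proof -
  define \<epsilon> where "\<epsilon> = (1 - growth_exponent d) / 2"
  have "growth_exponent d < 1" by (rule growth_exponent_bounds(2)[OF d])
  then have e: "\<epsilon> > 0" "growth_exponent d + \<epsilon> < 1" by (auto simp: \<epsilon>_def algebra_simps add_divide_distrib diff_divide_distrib)
  define q where "q = growth_exponent d + \<epsilon>"
  have "\<forall>\<^sub>F n in sequentially. real n powr q \<le> a * real n"
    using e(2) a unfolding q_def[symmetric] by real_asymp
  then have "\<forall>\<^sub>F n in sequentially. \<forall>E\<in>trees n. a * real n < real (kth_degree 2 E) \<longrightarrow> real n powr q \<le> real (kth_degree 2 E)"
    by eventually_elim auto
  then show ?thesis unfolding q_def by (rule poly_small_mono[OF second_degree_upper[OF d e(1)]])
qed

lemma top_degree_not_unique_poly_small: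
  assumes d: "d > 2"
  shows "poly_small (\<lambda>n E. \<not> kth_degree 2 E < D1 E)"
proof -
  define a where "a = x_star d / 2"
  have a: "0 < a" "a < x_star d" using x_star_props[OF d] by (auto simp: a_def)
  have "poly_small (\<lambda>n E. real (D1 E) < a * real n \<or> a / 2 * real n < real (kth_degree 2 E))"
    using a by (intro poly_small_disj max_degree_lower[OF d] second_degree_sublinear[OF d]) auto
  moreover have "\<forall>\<^sub>F n in sequentially. \<forall>E\<in>trees n. \<not> kth_degree 2 E < D1 E \<longrightarrow> 
      real (D1 E) < a * real n \<or> a / 2 * real n < real (kth_degree 2 E)"
    using eventually_ge_at_top[of 1]
  proof eventually_elim
    case (elim n)
    then have "a / 2 * real n < a * real n" using a by simp
    then show ?case by (auto simp: not_less)
  qed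
  ultimately show ?thesis by (rule poly_small_mono)
qed

section \<open>The highest degree from above\<close>

text \<open>Second moment of the excess of M_1/n over \<open>b0\<close>. With a unique top vertex
  the selection probability is exactly \<open>x * slope d x\<close>, and the slope beyond
  \<open>b0\<close> is at most \<open>1 - \<eta>\<close>. Here M_1/n has increments of order 1/n, so
  no negative moments are involved.\<close>

lemma max_degree_upper:
  assumes d: "d > 2" and b: "x_star d < b" "b \<le> 2"
  shows "poly_small (\<lambda>n E. b * real n < real (D1 E))"
proof -
  define b0 where "b0 = (x_star d + b) / 2"
  have b0: "x_star d < b0" "b0 < b" "b0 \<le> 2" "0 < b0" using b x_star_props[OF d] by (auto simp: b0_def)
  define \<eta> where "\<eta> = 1 - slope d b0"
  have \<eta>: "0 < \<eta>" "\<eta> \<le> 1" using slope_less[of "x_star d" b0 d] x_star_props[OF d] slope_ge_half[OF d, of b0] b0 d by (auto simp: \<eta>_def)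
  obtain \<rho>1 K1 where r1: "\<rho>1 < 0" "K1 > 0" "\<forall>\<^sub>F n in sequentially. tree_mean n (\<lambda>E. of_bool (\<not> kth_degree 2 E < D1 E)) \<le> K1 * real n powr \<rho>1"
    using top_degree_not_unique_poly_small[OF d] unfolding poly_small_def by blast
  \<comment> \<open>The lower limit -1 lets \<open>n powr (\<sigma> - 1)\<close> dominate the
    variance term \<open>1 / n\<^sup>2\<close> too.\<close>
  define \<sigma> where "\<sigma> = max \<rho>1 (-1)"
  have \<sigma>: "\<rho>1 \<le> \<sigma>" "-1 \<le> \<sigma>" "\<sigma> < 0" using r1 by (auto simp: \<sigma>_def)
  define U where "U n E = (max 0 (real (D1 E) / real n - b0))\<^sup>2" for n :: nat and E
  define e where "e n = tree_mean n (U n)" for n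
  have d1: "d \<ge> 1" using d by simp
  have step: "e (Suc n) \<le> (1 + (- \<eta>) / real n) * e n + (1 + 3 * K1) * real n powr (\<sigma> - 1)"
    if n: "n \<ge> 1" and bad: "tree_mean n (\<lambda>E. of_bool (\<not> kth_degree 2 E < D1 E)) \<le> K1 * real n powr \<rho>1" for n
  proof -
    have "e (Suc n) \<le> tree_mean n (\<lambda>E. (1 - \<eta> / real n) * U n E + (1 / (real n)\<^sup>2 + 3 / real n * of_bool (\<not> kth_degree 2 E < D1 E)))"
      unfolding e_def
    proof (rule tree_mean_Suc_le[where F = "\<lambda>E t. if t = D1 E then (max 0 (real (D1 E + 1) / real (Suc n) - b0))\<^sup>2
         else (max 0 (real (D1 E) / real (Suc n) - b0))\<^sup>2", OF n d1])
      fix E y assume E: "E \<in> trees n" and y: "y \<in> {1..n + 1}"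
      show "U (Suc n) (insert {n + 2, y} E) \<le> (if degree_of E y = D1 E then (max 0 (real (D1 E + 1) / real (Suc n) - b0))\<^sup>2
         else (max 0 (real (D1 E) / real (Suc n) - b0))\<^sup>2)"
        unfolding U_def max_degree_insert[OF E y] by (simp add: add.commute)
    next
      fix E assume E: "E \<in> trees n"
      define m where "m = D1 E"
      have M: "1 \<le> m" "m \<le> n" using D1_bounds[OF E] by (auto simp: m_def)
      define r where "r = attach_prob n E m"
      have r: "0 \<le> r" "r \<le> 1"
        using attach_prob_nonneg[OF E M(1)] attach_prob_max_le_1[OF E d1] by (auto simp: r_def m_def)
      define x where "x = real m / real n"
      have x: "0 < x" "x \<le> 1" using M by (auto simp: x_def)
      define N where "N = real (Suc n)"
      have N: "N > 0" "N = real n + 1" by (auto simp: N_def)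
      have mx: "real m = x * real n" using n by (simp add: x_def)
      have x1: "real (m + 1) / N - b0 - (x - b0) = (1 - x) / N" and x0: "real m / N - b0 - (x - b0) = (- x) / N"
        using N(1) by (simp_all add: mx divide_simps) (simp_all add: N(2) algebra_simps)
      define v where "v = max 0 (x - b0)"
      have v: "0 \<le> v" "v \<le> x" "v \<le> 1" using x b0 by (auto simp: v_def)
      have sq: "r * ((1 - x) / N)\<^sup>2 + (1 - r) * ((- x) / N)\<^sup>2 \<le> 1 / (real n)\<^sup>2"
      proof -
        have "(1 - x)\<^sup>2 \<le> 1" "x\<^sup>2 \<le> 1" using x by (auto intro!: power_le_one)
        then have "r * (1 - x)\<^sup>2 + (1 - r) * x\<^sup>2 \<le> r * 1 + (1 - r) * 1" using r by (intro add_mono mult_left_mono) auto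
        then have "(r * (1 - x)\<^sup>2 + (1 - r) * x\<^sup>2) / N\<^sup>2 \<le> 1 / N\<^sup>2" by (intro divide_right_mono) auto
        also have "\<dots> \<le> 1 / (real n)\<^sup>2" using n N by (intro divide_left_mono power_mono) auto
        finally show ?thesis by (simp add: power_divide add_divide_distrib)
      qed
      have mean: "2 * v * (r * ((1 - x) / N) + (1 - r) * ((- x) / N)) \<le> 
          - (\<eta> / real n) * v\<^sup>2 + 3 / real n * of_bool (\<not> kth_degree 2 E < D1 E)"
      proof -
        have eq: "r * ((1 - x) / N) + (1 - r) * ((- x) / N) = (r - x) / N" using N(1) by (simp add: field_simps)
        show ?thesis
        proof (cases "kth_degree 2 E < D1 E")
          case top: True
          show ?thesis
          proof (cases "x \<le> b0")
            case True
            then show ?thesis using top by (simp add: v_def)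
          next
            case False
            have "r = pick d (x / 2)"
              unfolding r_def m_def attach_prob_max[OF E] top_degree_unique_weight[OF E top] x_def by (simp add: mult.commute)
            also have "\<dots> = x * slope d x" by (rule pick_eq_slope)
            also have "\<dots> \<le> x * (1 - \<eta>)"
              unfolding \<eta>_def using False x d by (intro mult_left_mono) (auto intro!: slope_mono)
            finally have "r - x \<le> - (\<eta> * x)" by (simp add: algebra_simps)
            also have "\<dots> \<le> - (\<eta> * v)" using v \<eta> by (simp add: mult_left_mono)
            finally have "2 * v * ((r - x) / N) \<le> 2 * v * (- (\<eta> * v) / N)"
              using v N by (intro mult_left_mono divide_right_mono) auto
            also have "\<dots> = - (\<eta> * v\<^sup>2 * (2 / N))" by (simp add: power2_eq_square)
            also have "\<dots> \<le> - (\<eta> * v\<^sup>2 * (1 / real n))"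
            proof -
              \<comment> \<open>The factor 2 from the derivative of the square pays for passing from
                \<open>Suc n\<close> to \<open>n\<close>.\<close>
              have "1 / real n \<le> 2 / N" using n N by (simp add: field_simps)
              then show ?thesis using \<eta> by (intro le_imp_neg_le mult_left_mono) auto
            qed
            finally show ?thesis unfolding eq using top by simp
          qed
        next
          case False
          \<comment> \<open>With ties the drift costs at most \<open>2 / n\<close>, and the
            contraction term, which is claimed nevertheless, at most \<open>1 / n\<close>; hence the
            3.\<close>
          have "(r - x) / N \<le> 1 / N" using r x N by (intro divide_right_mono) auto
          also have "\<dots> \<le> 1 / real n" using n N by (intro divide_left_mono) auto
          finally have "2 * v * ((r - x) / N) \<le> 2 * 1 * (1 / real n)" using v
            by (smt (verit, best) mult_left_mono mult_right_mono n of_nat_0_le_iff zero_le_divide_1_iff)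
          moreover have "\<eta> / real n * v\<^sup>2 \<le> 1 / real n * 1"
            using v \<eta> by (intro mult_mono divide_right_mono) (auto simp: power_le_one)
          ultimately show ?thesis unfolding eq using False by simp
        qed
      qed
      have "r * (max 0 (real (m + 1) / N - b0))\<^sup>2 + (1 - r) * (max 0 (real m / N - b0))\<^sup>2 \<le> 
          v\<^sup>2 + 2 * v * (r * ((1 - x) / N) + (1 - r) * ((- x) / N)) + (r * ((1 - x) / N)\<^sup>2 + (1 - r) * ((- x) / N)\<^sup>2)"
        unfolding v_def x1[symmetric] x0[symmetric] by (rule pos_part_square_mean[OF r])
      also have "\<dots> \<le> v\<^sup>2 + (- (\<eta> / real n) * v\<^sup>2 + 3 / real n * of_bool (\<not> kth_degree 2 E < D1 E)) + 1 / (real n)\<^sup>2"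
        by (intro add_mono order_refl mean sq)
      finally show "(\<Sum>t\<in>{1..n}. attach_prob n E t * (if t = D1 E then (max 0 (real (D1 E + 1) / real (Suc n) - b0))\<^sup>2
         else (max 0 (real (D1 E) / real (Suc n) - b0))\<^sup>2)) \<le> 
         (1 - \<eta> / real n) * U n E + (1 / (real n)\<^sup>2 + 3 / real n * of_bool (\<not> kth_degree 2 E < D1 E))"
        unfolding sum_attach_prob_max[OF E d1] U_def r_def m_def v_def x_def N_def by (simp add: algebra_simps)
    qed
    also have "\<dots> = (1 - \<eta> / real n) * e n + (1 / (real n)\<^sup>2 + 3 / real n * tree_mean n (\<lambda>E. of_bool (\<not> kth_degree 2 E < D1 E)))"
      unfolding tree_mean_add tree_mean_cmult tree_mean_const[OF n d1] e_def ..
    also have "1 / (real n)\<^sup>2 + 3 / real n * tree_mean n (\<lambda>E. of_bool (\<not> kth_degree 2 E < D1 E)) \<le> 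
       real n powr (\<sigma> - 1) + 3 / real n * (K1 * real n powr \<sigma>)"
    proof (intro add_mono mult_left_mono)
      have "1 / (real n)\<^sup>2 = real n powr (-2)" using n by (simp add: powr_minus powr_numeral divide_inverse)
      also have "\<dots> \<le> real n powr (\<sigma> - 1)" using n \<sigma> by (intro powr_mono) auto
      finally show "1 / (real n)\<^sup>2 \<le> real n powr (\<sigma> - 1)" .
      have "K1 * real n powr \<rho>1 \<le> K1 * real n powr \<sigma>" using n \<sigma> r1 by (intro mult_left_mono powr_mono) auto
      then show "tree_mean n (\<lambda>E. of_bool (\<not> kth_degree 2 E < D1 E)) \<le> K1 * real n powr \<sigma>" using bad by simp
    qed simp
    also have "real n powr (\<sigma> - 1) + 3 / real n * (K1 * real n powr \<sigma>) = (1 + 3 * K1) * real n powr (\<sigma> - 1)"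
      using n by (simp add: powr_diff algebra_simps add_divide_distrib)
    finally show ?thesis by simp
  qed
  define \<rho> where "\<rho> = max \<sigma> (- (\<eta> / 2))"
  have \<rho>: "\<rho> < 0" using \<sigma> \<eta> by (simp add: \<rho>_def)
  have "\<exists>K>0. \<forall>\<^sub>F n in sequentially. e n \<le> K * real n powr \<rho>"
  proof (rule recursion_bound[of "- \<eta>" \<rho> "\<sigma> - 1" "1 + 3 * K1"])
    show "- \<eta> < \<rho>" unfolding \<rho>_def using \<eta> by linarith
    show "\<sigma> - 1 \<le> \<rho> - 1" unfolding \<rho>_def by simp
    show "\<forall>\<^sub>F n in sequentially. e (Suc n) \<le> (1 + (- \<eta>) / real n) * e n + (1 + 3 * K1) * real n powr (\<sigma> - 1)"
      using eventually_ge_at_top[of 1] r1(3) by eventually_elim (rule step)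
  qed (use r1 in auto)
  then obtain K where K: "K > 0" "\<forall>\<^sub>F n in sequentially. e n \<le> K * real n powr \<rho>" by blast
  show ?thesis
  proof (rule poly_small_if_moment[OF K(2)[unfolded e_def] K(1) _ \<rho>])
    show "(b - b0)\<^sup>2 > 0" using b0 by simp
    show "\<forall>\<^sub>F n in sequentially. \<forall>E\<in>trees n. b * real n < real (D1 E) \<longrightarrow> (b - b0)\<^sup>2 * real n powr 0 \<le> U n E"
      using eventually_ge_at_top[of 1]
    proof eventually_elim
      case (elim n)
      show ?case
      proof (intro ballI impI)
        fix E assume "b * real n < real (D1 E)"
        then have "b < real (D1 E) / real n" using elim by (simp add: less_divide_eq)
        then have "(b - b0)\<^sup>2 \<le> U n E" unfolding U_def using b0 by (intro power_mono) auto
        then show "(b - b0)\<^sup>2 * real n powr 0 \<le> U n E" using elim by simp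
      qed
    qed
  qed (simp add: U_def)
qed

text \<open>Among tied degrees it is the one of smallest rank that grows, so a single rank may have no drift;
  the sum over the ranks \<open>2, \<dots>, k\<close> does not see this.\<close>

definition rank_moment :: "real \<Rightarrow> nat \<Rightarrow> nat set set \<Rightarrow> real" where
  "rank_moment p k E = (\<Sum>i\<in>{2..k}. rise (- p) (kth_degree i E))"

lemma rank_moment_le:
  assumes E: "E \<in> trees n" and p: "0 < p" "p < 1"
  shows "rank_moment p k E \<le> real k"
proof -
  have "rank_moment p k E \<le> (\<Sum>i\<in>{2..k}. 1)"
    unfolding rank_moment_def
  proof (rule sum_mono)
    fix i assume "i \<in> {2..k}"
    then show "rise (- p) (kth_degree i E) \<le> 1"
      using rise_antimono[of "- p" 1 "kth_degree i E"] kth_degree_ge_1[OF E, of i] p by simp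
  qed
  then show ?thesis by simp
qed

lemma rank_moment_insert_le:
  assumes E: "E \<in> trees n" and y: "y \<in> {1..n + 1}" and p: "0 < p" "p < 1"
  shows "rank_moment p k (insert {n + 2, y} E) \<le> rank_moment p k E"
  unfolding rank_moment_def
proof (rule sum_mono)
  fix i assume "i \<in> {2..k}"
  then show "rise (- p) (kth_degree i (insert {n + 2, y} E)) \<le> rise (- p) (kth_degree i E)"
    using p kth_degree_ge_1[OF E, of i] kth_degree_insert_ge[OF E y, of i] by (intro rise_antimono) auto
qed

text \<open>One rank of degree \<open>t\<close> moves to at least \<open>t + 1\<close>, which gives
  the exact decrement of \<open>rise\<close>; the terms of the other ranks cannot increase.\<close>

lemma rank_moment_insert_drop:
  assumes E: "E \<in> trees n" and y: "y \<in> {1..n + 1}" and p: "0 < p" "p < 1"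
    and k: "k \<le> n" and top: "kth_degree 2 E < D1 E" 
    and t: "degree_of E y \<in> (\<lambda>i. kth_degree i E) ` {2..k}"
  shows "rank_moment p k (insert {n + 2, y} E) \<le> rank_moment p k E - rise (- p) (degree_of E y) * p / real (degree_of E y)"
proof -
  define t where "t = degree_of E y"
  have t1: "t \<ge> 1" using degree_pos[OF E y] by (simp add: t_def)
  obtain i where i: "degree_of E y = kth_degree i E" "i \<in> {2..k}" using t by (rule imageE)
  obtain j where j: "2 \<le> j" "j \<le> k" "kth_degree j E = t" "t + 1 \<le> kth_degree j (insert {n + 2, y} E)"
    using kth_degree_insert_max_rank[OF E y _ _ _ k top, of i] i unfolding t_def by auto
  have "rise (- p) (kth_degree j (insert {n + 2, y} E)) \<le> rise (- p) (t + 1)"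
    using p j by (intro rise_antimono) auto
  also have "\<dots> = rise (- p) t - rise (- p) t * p / real t" using t1 by (simp add: rise_Suc algebra_simps)
  finally have dj: "rise (- p) (kth_degree j (insert {n + 2, y} E)) \<le> rise (- p) (kth_degree j E) - rise (- p) t * p / real t"
    by (simp add: j)
  have "(\<Sum>i\<in>{2..k}. rise (- p) (kth_degree i (insert {n + 2, y} E))) \<le>
     (\<Sum>i\<in>{2..k}. rise (- p) (kth_degree i E) - (if i = j then rise (- p) t * p / real t else 0))"
  proof (rule sum_mono)
    fix i assume "i \<in> {2..k}"
    then show "rise (- p) (kth_degree i (insert {n + 2, y} E)) \<le> rise (- p) (kth_degree i E) - (if i = j then rise (- p) t * p / real t else 0)"
      using dj rise_antimono[of "-p" "kth_degree i E" "kth_degree i (insert {n + 2, y} E)"] p 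
        kth_degree_ge_1[OF E, of i] kth_degree_insert_ge[OF E y, of i] by (cases "i = j") auto
  qed
  also have "\<dots> = rank_moment p k E - rise (- p) t * p / real t"
    unfolding rank_moment_def sum_subtractf using j by (simp add: sum.delta)
  finally show ?thesis unfolding rank_moment_def t_def .
qed

text \<open>Only the \<open>L\<close> vertices of degree \<open>t\<close> with rank up to
  \<open>k\<close> are used. They occupy an interval of masses of length
  \<open>L * t / (2 * n)\<close>, and together with everything above them they reach at most
  \<open>b / 2\<close>, where concavity bounds the derivative of \<open>pick\<close> from
  below.\<close>

lemma attach_prob_ge:
  assumes d: "d > 2" and E: "E \<in> trees n" and k: "k \<le> n" and top: "kth_degree 2 E < D1 E"
    and t: "t \<in> (\<lambda>i. kth_degree i E) ` {2..k}"
    and b: "real (D1 E) + real k * real (kth_degree 2 E) \<le> b * real n" "b \<le> 2"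
  shows "real (card {i \<in> {2..k}. kth_degree i E = t}) * real t / real n * rate d b \<le> attach_prob n E t"
proof -
  have n: "n \<ge> 1" using trees_pos E .
  define L where "L = card {i \<in> {2..k}. kth_degree i E = t}"
  obtain i where i: "t = kth_degree i E" "i \<in> {2..k}" using t by (rule imageE)
  have t1: "t \<ge> 1" using kth_degree_ge_1[OF E, of i] i by simp
  have t2: "t \<le> kth_degree 2 E" using kth_degree_antimono[OF E, of 2 i] i by simp
  have L: "L \<le> min k (num_ge E t) - num_ge E (Suc t)" unfolding L_def by (rule card_rank_eq[OF E k t1])
  have "\<not> i \<le> num_ge E (Suc t)" using le_kth_degree_iff[OF E, of i "Suc t"] i k by simp
  then have lt: "num_ge E (Suc t) < k" using i by simp
  have Lc: "L \<le> degree_count E t" using L num_ge_degree_count[OF E, of t] by simp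
  have Lk: "num_ge E (Suc t) + L \<le> k" using L lt by simp
  have "weight_ge E (Suc t) + L * t + kth_degree 2 E \<le> D1 E + num_ge E (Suc t) * kth_degree 2 E + L * kth_degree 2 E"
  proof -
    have "Suc t \<le> D1 E" using t2 top by simp
    from weight_ge_le_kth[OF E top this] show ?thesis using mult_le_mono2[OF t2, of L] by linarith
  qed
  also have "\<dots> \<le> D1 E + k * kth_degree 2 E"
    using mult_le_mono1[OF Lk, of "kth_degree 2 E"] by (simp add: algebra_simps)
  finally have "weight_ge E (Suc t) + L * t \<le> D1 E + k * kth_degree 2 E" by simp
  then have "real (weight_ge E (Suc t) + L * t) \<le> real (D1 E + k * kth_degree 2 E)" by (rule of_nat_mono)
  then have W: "real (weight_ge E (Suc t)) + real L * real t \<le> b * real n" using b by simp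
  define u where "u = real (weight_ge E (Suc t)) / (2 * real n)"
  define v where "v = u + real L * real t / (2 * real n)"
  have vb: "v \<le> b / 2" using W n by (simp add: v_def u_def field_simps)
  have uv: "u \<le> v" by (simp add: v_def)
  have "v \<le> real (weight_ge E t) / (2 * real n)"
    unfolding v_def u_def weight_ge_degree_count[OF E, of t] add_divide_distrib[symmetric]
    using mult_le_mono1[OF Lc, of t] by (intro divide_right_mono) (auto simp flip: of_nat_mult of_nat_add)
  then have "pick d v \<le> pick d (real (weight_ge E t) / (2 * real n))" by (intro pick_mono weight_ge_ratio[OF E t1])
  then have "pick d v - pick d u \<le> attach_prob n E t" unfolding attach_prob_def u_def[symmetric] by simp
  moreover have "real d * (1 - v) ^ (d - 1) * (v - u) \<le> pick d v - pick d u"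
    using uv vb b(2) d by (intro pick_bounds(1)) auto
  moreover have "real d * (1 - b / 2) ^ (d - 1) * (v - u) \<le> real d * (1 - v) ^ (d - 1) * (v - u)"
    using uv vb b(2) by (intro mult_right_mono mult_left_mono power_mono) auto
  moreover have "real d * (1 - b / 2) ^ (d - 1) * (v - u) = real L * real t / real n * rate d b"
    by (simp add: v_def rate_def mult_ac)
  ultimately show ?thesis unfolding L_def by linarith
qed

lemma kth_degree_lower:
  assumes d: "d > 2" and k: "k \<ge> 2" and \<epsilon>: "\<epsilon> > 0"
  shows "poly_small (\<lambda>n E. real (kth_degree k E) \<le> real n powr (growth_exponent d - \<epsilon>))"
proof -
  obtain \<delta> where \<delta>: "\<delta> > 0" "\<And>x. \<bar>x - x_star d\<bar> < \<delta> \<Longrightarrow> \<bar>rate d x - growth_exponent d\<bar> < \<epsilon> / 2"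
    using rate_near_x_star[OF d, of "\<epsilon> / 2"] \<epsilon> by auto
  note xs = x_star_props[OF d]
  define b where "b = min 2 (x_star d + \<delta> / 2)"
  have b: "x_star d < b" "b \<le> 2" "\<bar>b - x_star d\<bar> < \<delta>"
    using xs \<delta>(1) by (auto simp: b_def min_def abs_if)
  have rb: "growth_exponent d - \<epsilon> / 2 < rate d b" using \<delta>(2)[OF b(3)] by linarith
  have rb0: "0 \<le> rate d b" using b by (simp add: rate_def)
  define b' where "b' = (x_star d + b) / 2"
  have b': "x_star d < b'" "b' < b" "b' \<le> 2" using b by (auto simp: b'_def)
  define bad where "bad E n \<longleftrightarrow> \<not> kth_degree 2 E < D1 E \<or> b * real n < real (D1 E) + real k * real (kth_degree 2 E)" for E n
  have "poly_small (\<lambda>n E. bad E n)"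
  proof -
    \<comment> \<open>Splits the allowance: M_1 may use \<open>b' * n\<close>, and \<open>k\<close>
      times M_2 the remaining \<open>(b - b') * n\<close>.\<close>
    define a where "a = (b - b') / real k"
    have a: "a > 0" using b' k by (simp add: a_def)
    have "poly_small (\<lambda>n E. \<not> kth_degree 2 E < D1 E \<or> (b' * real n < real (D1 E) \<or> a * real n < real (kth_degree 2 E)))"
      by (intro poly_small_disj top_degree_not_unique_poly_small[OF d] max_degree_upper[OF d b'(1,3)] second_degree_sublinear[OF d a])
    moreover have "\<forall>\<^sub>F n in sequentially. \<forall>E\<in>trees n. bad E n \<longrightarrow> 
       \<not> kth_degree 2 E < D1 E \<or> (b' * real n < real (D1 E) \<or> a * real n < real (kth_degree 2 E))"
    proof (intro always_eventually allI ballI impI)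
      fix n E assume bad: "bad E n"
      show "\<not> kth_degree 2 E < D1 E \<or> (b' * real n < real (D1 E) \<or> a * real n < real (kth_degree 2 E))"
      proof (rule ccontr)
        assume not: "\<not> (\<not> kth_degree 2 E < D1 E \<or> (b' * real n < real (D1 E) \<or> a * real n < real (kth_degree 2 E)))"
        have "real k * real (kth_degree 2 E) \<le> real k * (a * real n)" using not by (intro mult_left_mono) auto
        also have "real k * (a * real n) = (real k * a) * real n" by simp
        also have "real k * a = b - b'" using k by (simp add: a_def)
        also have "(b - b') * real n = b * real n - b' * real n" by (rule left_diff_distrib)
        finally have "real (D1 E) + real k * real (kth_degree 2 E) \<le> b * real n" using not by linarith
        then show False using bad not unfolding bad_def by linarith
      qed
    qed
    ultimately show ?thesis by (rule poly_small_mono)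
  qed
  then obtain \<rho>1 K1 where r1: "\<rho>1 < 0" "K1 > 0" "\<forall>\<^sub>F n in sequentially. tree_mean n (\<lambda>E. of_bool (bad E n)) \<le> K1 * real n powr \<rho>1"
    unfolding poly_small_def by blast
  \<comment> \<open>The error exponent \<open>\<rho>1 - 1\<close> must not exceed
    \<open>\<rho> - 1\<close>. As the growth exponent is below 1, \<open>\<rho> \<ge> - p\<close>,
    so \<open>p \<le> - \<rho>1\<close> is enough.\<close>
  define p where "p = min (1 / 2) (- \<rho>1)"
  have p: "0 < p" "p < 1" "p \<le> - \<rho>1" using r1 by (auto simp: p_def)
  have d1: "d \<ge> 1" using d by simp
  obtain c C where C: "0 < c" "0 < C" "\<And>a. a \<ge> 1 \<Longrightarrow> c * real a powr (-p) \<le> rise (-p) a" "\<And>a. a \<ge> 1 \<Longrightarrow> rise (-p) a \<le> C * real a powr (-p)"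
    using rise_bounds[of "-p"] p by auto
  define e where "e n = tree_mean n (rank_moment p k)" for n
  define g where "g = p * rate d b"
  have g: "g \<ge> 0" using p rb0 by (simp add: g_def)
  have step: "e (Suc n) \<le> (1 + (- g) / real n) * e n + g * real k * K1 * real n powr (\<rho>1 - 1)"
    if n: "n \<ge> 1" "n \<ge> k" and badn: "tree_mean n (\<lambda>E. of_bool (bad E n)) \<le> K1 * real n powr \<rho>1" for n
  proof -
    have "e (Suc n) \<le> tree_mean n (\<lambda>E. (1 - g / real n) * rank_moment p k E + g * real k / real n * of_bool (bad E n))"
      unfolding e_def
    proof (rule tree_mean_Suc_le[where F = "\<lambda>E t. rank_moment p k E - 
         (if \<not> bad E n \<and> t \<in> (\<lambda>i. kth_degree i E) ` {2..k} then rise (- p) t * p / real t else 0)", OF n(1) d1])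
      fix E y assume E: "E \<in> trees n" and y: "y \<in> {1..n + 1}"
      show "rank_moment p k (insert {n + 2, y} E) \<le> rank_moment p k E - 
         (if \<not> bad E n \<and> degree_of E y \<in> (\<lambda>i. kth_degree i E) ` {2..k} then rise (- p) (degree_of E y) * p / real (degree_of E y) else 0)"
      proof (cases "\<not> bad E n \<and> degree_of E y \<in> (\<lambda>i. kth_degree i E) ` {2..k}")
        case True
        then have "kth_degree 2 E < D1 E" by (simp add: bad_def)
        then show ?thesis unfolding if_P[OF True]
          by (rule rank_moment_insert_drop[OF E y p(1,2) n(2) _ conjunct2[OF True]])
      next
        case False
        then show ?thesis unfolding if_not_P[OF False] using rank_moment_insert_le[OF E y p(1,2), of k] by simp
      qed
    next
      fix E assume E: "E \<in> trees n"
      let ?T = "(\<lambda>i. kth_degree i E) ` {2..k}"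
      show "(\<Sum>t\<in>{1..n}. attach_prob n E t * (rank_moment p k E - (if \<not> bad E n \<and> t \<in> ?T then rise (- p) t * p / real t else 0))) \<le> 
        (1 - g / real n) * rank_moment p k E + g * real k / real n * of_bool (bad E n)"
      proof (cases "bad E n")
        case True
        have "(\<Sum>t\<in>{1..n}. attach_prob n E t * (rank_moment p k E - (if \<not> bad E n \<and> t \<in> ?T then rise (- p) t * p / real t else 0))) =
           (\<Sum>t\<in>{1..n}. attach_prob n E t) * rank_moment p k E"
          unfolding sum_distrib_right using True by simp
        also have "\<dots> = rank_moment p k E" unfolding sum_attach_prob[OF E d1] by simp
        \<comment> \<open>On the bad event the moment still does not increase; the contraction
          claimed in general is repaid with the bound \<open>k\<close>.\<close>
        also have "\<dots> = (1 - g / real n) * rank_moment p k E + g / real n * rank_moment p k E" by (simp add: algebra_simps)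
        also have "g / real n * rank_moment p k E \<le> g / real n * real k"
          using g rank_moment_le[OF E p(1,2)] by (intro mult_left_mono) auto
        finally show ?thesis using True by simp
      next
        case False
        then have top: "kth_degree 2 E < D1 E" and poly_small: "real (D1 E) + real k * real (kth_degree 2 E) \<le> b * real n"
          by (auto simp: bad_def not_less)
        have T: "?T \<subseteq> {1..n}"
        proof
          fix t assume "t \<in> ?T"
          then obtain i where "t = kth_degree i E" "i \<in> {2..k}" by (rule imageE)
          then show "t \<in> {1..n}" 
            using kth_degree_ge_1[OF E, of i] kth_degree_antimono[OF E, of 1 i] D1_bounds[OF E] by simp
        qed
        \<comment> \<open>Grouping the ranks by degree matches \<open>attach_prob\<close>, which
          does not distinguish vertices of equal degree; the multiplicity cancels against the number
          of ranks in \<open>attach_prob_ge\<close>.\<close>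
        have grp: "rank_moment p k E = (\<Sum>t\<in>?T. real (card {i \<in> {2..k}. kth_degree i E = t}) * rise (- p) t)"
        proof -
          have "rank_moment p k E = (\<Sum>t\<in>?T. \<Sum>i\<in>{i \<in> {2..k}. kth_degree i E = t}. rise (- p) (kth_degree i E))"
            unfolding rank_moment_def by (rule sum.group[symmetric]) simp_all
          also have "\<dots> = (\<Sum>t\<in>?T. real (card {i \<in> {2..k}. kth_degree i E = t}) * rise (- p) t)"
            by (intro sum.cong refl) simp
          finally show ?thesis .
        qed
        have "g / real n * rank_moment p k E \<le> (\<Sum>t\<in>?T. attach_prob n E t * (rise (- p) t * p / real t))"
          unfolding grp sum_distrib_left
        proof (rule sum_mono)
          fix t assume t: "t \<in> ?T"
          have t1: "t \<ge> 1" using T t by auto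
          have "real (card {i \<in> {2..k}. kth_degree i E = t}) * real t / real n * rate d b * (rise (- p) t * p / real t) \<le> 
             attach_prob n E t * (rise (- p) t * p / real t)"
            using p rise_pos[of "- p" t] by (intro mult_right_mono attach_prob_ge[OF d E n(2) top t poly_small b(2)]) auto
          moreover have "real (card {i \<in> {2..k}. kth_degree i E = t}) * real t / real n * rate d b * (rise (- p) t * p / real t) =
             g / real n * (real (card {i \<in> {2..k}. kth_degree i E = t}) * rise (- p) t)"
            using t1 by (simp add: g_def)
          ultimately show "g / real n * (real (card {i \<in> {2..k}. kth_degree i E = t}) * rise (- p) t) \<le> attach_prob n E t * (rise (- p) t * p / real t)"
            by simp
        qed
        also have "\<dots> = (\<Sum>t\<in>{1..n}. if t \<in> ?T then attach_prob n E t * (rise (- p) t * p / real t) else 0)"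
        proof -
          have "{1..n} \<inter> ?T = ?T" using T by blast
          then show ?thesis 
            using sum.inter_restrict[OF finite_atLeastAtMost, of "\<lambda>t. attach_prob n E t * (rise (- p) t * p / real t)" 1 n ?T] 
            by (simp only:)
        qed
        finally have main: "g / real n * rank_moment p k E \<le> (\<Sum>t\<in>{1..n}. if t \<in> ?T then attach_prob n E t * (rise (- p) t * p / real t) else 0)" .
        have "(\<Sum>t\<in>{1..n}. attach_prob n E t * (rank_moment p k E - (if \<not> bad E n \<and> t \<in> ?T then rise (- p) t * p / real t else 0))) =
           (\<Sum>t\<in>{1..n}. attach_prob n E t * rank_moment p k E - (if t \<in> ?T then attach_prob n E t * (rise (- p) t * p / real t) else 0))"
          using False by (intro sum.cong refl) (simp add: right_diff_distrib)
        also have "\<dots> = rank_moment p k E - (\<Sum>t\<in>{1..n}. if t \<in> ?T then attach_prob n E t * (rise (- p) t * p / real t) else 0)"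
          unfolding sum_subtractf sum_distrib_right[symmetric] sum_attach_prob[OF E d1] by simp
        also have "\<dots> \<le> rank_moment p k E - g / real n * rank_moment p k E" using main by simp
        finally show ?thesis using False by (simp add: algebra_simps)
      qed
    qed
    also have "\<dots> = (1 - g / real n) * e n + g * real k / real n * tree_mean n (\<lambda>E. of_bool (bad E n))"
      unfolding tree_mean_add tree_mean_cmult e_def ..
    also have "\<dots> \<le> (1 - g / real n) * e n + g * real k / real n * (K1 * real n powr \<rho>1)"
      using badn g by (intro add_left_mono mult_left_mono) auto
    also have "g * real k / real n * (K1 * real n powr \<rho>1) = g * real k * K1 * real n powr (\<rho>1 - 1)"
      using n by (simp add: powr_diff)
    finally show ?thesis by simp
  qed
  \<comment> \<open>3/4 lies strictly between the loss \<open>\<epsilon> / 2\<close> in the rate and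
    the full \<open>\<epsilon>\<close> of the target exponent.\<close>
  define \<rho> where "\<rho> = - p * (growth_exponent d - 3 / 4 * \<epsilon>)"
  have "\<exists>K>0. \<forall>\<^sub>F n in sequentially. e n \<le> K * real n powr \<rho>"
  proof (rule recursion_bound[of "- g" \<rho> "\<rho>1 - 1" "g * real k * K1"])
    have "p * (growth_exponent d - 3 / 4 * \<epsilon>) < p * rate d b" using rb p \<epsilon> by (intro mult_strict_left_mono) auto
    then show "- g < \<rho>" by (simp add: \<rho>_def g_def)
    have "p * (growth_exponent d - 3 / 4 * \<epsilon>) \<le> p * 1" using growth_exponent_bounds[OF d] \<epsilon> p by (intro mult_left_mono) auto
    then show "\<rho>1 - 1 \<le> \<rho> - 1" unfolding \<rho>_def using p(3) by simp
    show "\<forall>\<^sub>F n in sequentially. e (Suc n) \<le> (1 + (- g) / real n) * e n + g * real k * K1 * real n powr (\<rho>1 - 1)"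
      using eventually_ge_at_top[of 1] eventually_ge_at_top[of k] r1(3) by eventually_elim (rule step)
  qed (use r1 g in auto)
  then obtain K where K: "K > 0" "\<forall>\<^sub>F n in sequentially. e n \<le> K * real n powr \<rho>" by blast
  define \<sigma> where "\<sigma> = (growth_exponent d - \<epsilon>) * (- p)"
  have less: "\<rho> < \<sigma>" using p \<epsilon> by (simp add: \<rho>_def \<sigma>_def algebra_simps)
  show ?thesis
  proof (rule poly_small_if_moment[OF K(2)[unfolded e_def] K(1) C(1) less])
    fix n E assume "E \<in> trees n"
    show "0 \<le> rank_moment p k E" unfolding rank_moment_def using p by (intro sum_nonneg less_imp_le rise_pos) auto
  next
    show "\<forall>\<^sub>F n in sequentially. \<forall>E\<in>trees n. real (kth_degree k E) \<le> real n powr (growth_exponent d - \<epsilon>) \<longrightarrow> c * real n powr \<sigma> \<le> rank_moment p k E"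
      using eventually_ge_at_top[of 1]
    proof eventually_elim
      case (elim n)
      show ?case
      proof (intro ballI impI)
        fix E assume E: "E \<in> trees n" and le: "real (kth_degree k E) \<le> real n powr (growth_exponent d - \<epsilon>)"
        have k1: "kth_degree k E \<ge> 1" using kth_degree_ge_1[OF E] k by simp
        have "real n powr \<sigma> = (real n powr (growth_exponent d - \<epsilon>)) powr (- p)" by (simp only: \<sigma>_def powr_powr)
        also have "\<dots> \<le> real (kth_degree k E) powr (- p)" using le k1 p by (intro powr_mono2') auto
        finally have "c * real n powr \<sigma> \<le> c * real (kth_degree k E) powr (- p)" using C by simp
        also have "\<dots> \<le> rise (- p) (kth_degree k E)" by (rule C(3)[OF k1])
        also have "\<dots> = (\<Sum>i\<in>{k}. rise (- p) (kth_degree i E))" by simp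
        also have "\<dots> \<le> rank_moment p k E"
          unfolding rank_moment_def using k p by (intro sum_mono2) (auto intro!: less_imp_le rise_pos)
        finally show "c * real n powr \<sigma> \<le> rank_moment p k E" .
      qed
    qed
  qed
qed

end

section \<open>Combination of the two bounds\<close>

theorem theorem1p1:
  fixes M :: "'w measure" and d k :: nat
    and X :: "nat \<Rightarrow> nat \<Rightarrow> 'w \<Rightarrow> nat" and Y :: "nat \<Rightarrow> 'w \<Rightarrow> nat" and \<epsilon> :: real
  assumes "max_choice_pa M d X Y" and "d > 2" and "k > 1" and "\<epsilon> > 0"
  shows "(\<lambda>n. measure M {w \<in> space M.
            real n powr (c_const d ^ (d - 1) * real d / 2 - \<epsilon>) < real (kth_degree k (pa_tree Y n w)) \<and>
            real (kth_degree k (pa_tree Y n w)) < real n powr (c_const d ^ (d - 1) * real d / 2 + \<epsilon>)})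
         \<longlonglongrightarrow> 1"
proof -
  interpret max_choice_pa M d X Y by fact
  have d: "d \<ge> 1" using assms(2) by simp
  define good where "good n E \<longleftrightarrow> real n powr (growth_exponent d - \<epsilon>) < real (kth_degree k E) \<and>
            real (kth_degree k E) < real n powr (growth_exponent d + \<epsilon>)" for n E
  have "poly_small (\<lambda>n E. real (kth_degree k E) \<le> real n powr (growth_exponent d - \<epsilon>) \<or> real n powr (growth_exponent d + \<epsilon>) \<le> real (kth_degree 2 E))"
    using assms by (intro poly_small_disj kth_degree_lower second_degree_upper) auto
  moreover have "\<forall>\<^sub>F n in sequentially. \<forall>E\<in>trees n. \<not> good n E \<longrightarrow> 
     real (kth_degree k E) \<le> real n powr (growth_exponent d - \<epsilon>) \<or> real n powr (growth_exponent d + \<epsilon>) \<le> real (kth_degree 2 E)"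
  proof (intro always_eventually allI ballI impI)
    fix n E assume E: "E \<in> trees n" and bad: "\<not> good n E"
    \<comment> \<open>The bound for M_2 serves as the upper bound for every rank from 2 on.\<close>
    have "real (kth_degree k E) \<le> real (kth_degree 2 E)" using kth_degree_antimono[OF E, of 2 k] assms(3) by simp
    then show "real (kth_degree k E) \<le> real n powr (growth_exponent d - \<epsilon>) \<or> real n powr (growth_exponent d + \<epsilon>) \<le> real (kth_degree 2 E)"
      using bad unfolding good_def by linarith
  qed
  ultimately have "poly_small (\<lambda>n E. \<not> good n E)" by (rule poly_small_mono)
  then have "(\<lambda>n. 1 - tree_mean n (\<lambda>E. of_bool (\<not> good n E))) \<longlonglongrightarrow> 1 - 0"
    by (intro tendsto_diff tendsto_const poly_small_tendsto)
  moreover have "\<forall>\<^sub>F n in sequentially. 1 - tree_mean n (\<lambda>E. of_bool (\<not> good n E)) = \<P>(w in M. good n (pa_tree Y n w))"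
    using eventually_ge_at_top[of 1]
  proof eventually_elim
    case (elim n)
    have "tree_mean n (\<lambda>E. of_bool (good n E)) + tree_mean n (\<lambda>E. of_bool (\<not> good n E)) = tree_mean n (\<lambda>E. 1)"
      unfolding tree_mean_add[symmetric] by (intro arg_cong[of _ _ "tree_mean n"] ext) auto
    then show ?case unfolding prob_eq_tree_mean[OF elim d] tree_mean_const[OF elim d] by simp
  qed
  ultimately have "(\<lambda>n. \<P>(w in M. good n (pa_tree Y n w))) \<longlonglongrightarrow> 1 - 0" by (rule Lim_transform_eventually)
  then show ?thesis unfolding good_def growth_exponent_def by simp
qed

end
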